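(* Let $1<p<\infty$, let $\omega\in\widehat{\mathcal{D}}$ be a radial weight, and let $\nu$ be a radial weight. Then $P_\omega:L^p_\nu\to L^p_\nu$ is bounded if and only if $(A^{p'}_\sigma)^\star\simeq A^p_\nu$ via the $A^2_\omega$-pairing with equivalence of norms, that is: every $g\in A^p_\nu$ induces a bounded linear functional $T_g(f)=\langle f,g\rangle_{A^2_\omega}=\int_{\mathbb{D}}f\overline{g}\,\omega\,dA$ on $A^{p'}_\sigma$, every bounded linear functional on $A^{p'}_\sigma$ is of the form $T_g$ for a unique $g\in A^p_\nu$, and $\|T_g\|\asymp\|g\|_{A^p_\nu}$ with constants independent of $g$.
   Context: $\mathbb{D}$ is the unit disc of $\mathbb{C}$ and $dA(z)=\frac{dx\,dy}{\pi}$. A radial weight is a nonnegative $\omega\in L^1([0,1))$, extended to $\mathbb{D}$ by $\omega(z)=\omega(|z|)$; it is always assumed that $\widehat{\omega}(r)=\int_r^1\omega(s)\,ds>0$ for all $0\le r<1$. For a nonnegative measurable $\eta$ on $[0,1)$ (extended radially) and $0<p<\infty$, $L^p_\eta$ is the space of measurable $f$ on $\mathbb{D}$ with $\|f\|_{L^p_\eta}^p=\int_{\mathbb{D}}|f|^p\eta\,dA<\infty$, and $A^p_\eta$ is the subspace of analytic functions in $\mathbb{D}$. The class $\widehat{\mathcal{D}}$ consists of radial weights with $\sup_{0\le r<1}\widehat{\omega}(r)/\widehat{\omega}(\frac{1+r}{2})<\infty$. Write $\omega_x=\int_0^1 r^x\omega(r)\,dr$. The Bergman projection is $P_\omega(f)(z)=\int_{\mathbb{D}}f(\zeta)\overline{B^\omega_z(\zeta)}\omega(\zeta)\,dA(\zeta)$,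 where $B^\omega_z(\zeta)=\sum_{n=0}^\infty\frac{(\overline{z}\zeta)^n}{2\omega_{2n+1}}$ is the reproducing kernel of $A^2_\omega$. For $1<p<\infty$, $p'=\frac{p}{p-1}$ and $\sigma(r)=\left(\frac{\omega(r)}{\nu(r)^{1/p}}\right)^{p'}$. *)

theory Defs
  imports "HOL-Analysis.Analysis"
begin

definition disc :: "complex set" where
  "disc = ball 0 1"

definition dA :: "complex measure" where
  "dA = density (restrict_space lebesgue disc) (\<lambda>_. ennreal (1 / pi))"

definition hat :: "(real \<Rightarrow> real) \<Rightarrow> real \<Rightarrow> real" where
  "hat \<omega> r = (LINT s:{r..<1}|lebesgue. \<omega> s)"

definition radial_weight :: "(real \<Rightarrow> real) \<Rightarrow> bool" where
  "radial_weight \<omega> \<longleftrightarrow>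
     (\<forall>r\<in>{0..<1}. 0 \<le> \<omega> r) \<and> set_integrable lebesgue {0..<1} \<omega> \<and>
     (\<forall>r\<in>{0..<1}. 0 < hat \<omega> r)"

definition Dhat :: "(real \<Rightarrow> real) \<Rightarrow> bool" where
  "Dhat \<omega> \<longleftrightarrow> radial_weight \<omega> \<and>
     (\<exists>C. \<forall>r\<in>{0..<1}. hat \<omega> r / hat \<omega> ((1 + r) / 2) \<le> C)"

definition moment :: "(real \<Rightarrow> real) \<Rightarrow> real \<Rightarrow> real" where
  "moment \<omega> x = (LINT r:{0..<1}|lebesgue. r powr x * \<omega> r)"

definition Lp_w :: "real \<Rightarrow> (real \<Rightarrow> ennreal) \<Rightarrow> (complex \<Rightarrow> complex) set" where
  "Lp_w p \<eta> = {f. f \<in> borel_measurable dA \<and>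
      (\<integral>\<^sup>+ z. ennreal (cmod (f z) powr p) * \<eta> (cmod z) \<partial>dA) < \<infinity>}"

definition Ap_w :: "real \<Rightarrow> (real \<Rightarrow> ennreal) \<Rightarrow> (complex \<Rightarrow> complex) set" where
  "Ap_w p \<eta> = {f \<in> Lp_w p \<eta>. f holomorphic_on disc}"

definition norm_w :: "real \<Rightarrow> (real \<Rightarrow> ennreal) \<Rightarrow> (complex \<Rightarrow> complex) \<Rightarrow> real" where
  "norm_w p \<eta> f = enn2real (\<integral>\<^sup>+ z. ennreal (cmod (f z) powr p) * \<eta> (cmod z) \<partial>dA) powr (1 / p)"

text \<open>Reproducing kernel of A^2_omega and the Bergman projection.\<close>
definition bkernel :: "(real \<Rightarrow> real) \<Rightarrow> complex \<Rightarrow> complex \<Rightarrow> complex" where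
  "bkernel \<omega> z \<zeta> = (\<Sum>n. (cnj z * \<zeta>) ^ n / complex_of_real (2 * moment \<omega> (2 * real n + 1)))"

definition bproj :: "(real \<Rightarrow> real) \<Rightarrow> (complex \<Rightarrow> complex) \<Rightarrow> complex \<Rightarrow> complex" where
  "bproj \<omega> f z = (\<integral>\<zeta>. f \<zeta> * cnj (bkernel \<omega> z \<zeta>) * complex_of_real (\<omega> (cmod \<zeta>)) \<partial>dA)"

definition pairing :: "(real \<Rightarrow> real) \<Rightarrow> (complex \<Rightarrow> complex) \<Rightarrow> (complex \<Rightarrow> complex) \<Rightarrow> complex" where
  "pairing \<omega> f g = (\<integral>z. f z * cnj (g z) * complex_of_real (\<omega> (cmod z)) \<partial>dA)"

definition conj_exp :: "real \<Rightarrow> real" where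
  "conj_exp p = p / (p - 1)"

definition sigma_w :: "real \<Rightarrow> (real \<Rightarrow> real) \<Rightarrow> (real \<Rightarrow> real) \<Rightarrow> real \<Rightarrow> ennreal" where
  "sigma_w p \<omega> \<nu> r =
     (if \<nu> r = 0 then (if \<omega> r = 0 then 0 else \<infinity>)
      else ennreal ((\<omega> r / \<nu> r powr (1 / p)) powr conj_exp p))"

definition proj_bounded :: "real \<Rightarrow> (real \<Rightarrow> real) \<Rightarrow> (real \<Rightarrow> real) \<Rightarrow> bool" where
  "proj_bounded p \<omega> \<nu> \<longleftrightarrow>
     (\<exists>C. \<forall>f \<in> Lp_w p (\<lambda>r. ennreal (\<nu> r)).
        (\<forall>z\<in>disc. integrable dA (\<lambda>\<zeta>. f \<zeta> * cnj (bkernel \<omega> z \<zeta>) * complex_of_real (\<omega> (cmod \<zeta>)))) \<and>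
        bproj \<omega> f \<in> Lp_w p (\<lambda>r. ennreal (\<nu> r)) \<and>
        norm_w p (\<lambda>r. ennreal (\<nu> r)) (bproj \<omega> f) \<le> C * norm_w p (\<lambda>r. ennreal (\<nu> r)) f)"

definition bounded_functional ::
  "(complex \<Rightarrow> complex) set \<Rightarrow> ((complex \<Rightarrow> complex) \<Rightarrow> real) \<Rightarrow> ((complex \<Rightarrow> complex) \<Rightarrow> complex) \<Rightarrow> bool" where
  "bounded_functional X N L \<longleftrightarrow>
     (\<forall>f\<in>X. \<forall>g\<in>X. \<forall>a b. L (\<lambda>z. a * f z + b * g z) = a * L f + b * L g) \<and>
     (\<exists>C. \<forall>f\<in>X. cmod (L f) \<le> C * N f)"

definition functional_norm ::
  "(complex \<Rightarrow> complex) set \<Rightarrow> ((complex \<Rightarrow> complex) \<Rightarrow> real) \<Rightarrow> ((complex \<Rightarrow> complex) \<Rightarrow> complex) \<Rightarrow> real" where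
  "functional_norm X N L = (SUP f\<in>{f\<in>X. N f \<le> 1}. cmod (L f))"

definition dual_via_pairing :: "real \<Rightarrow> (real \<Rightarrow> real) \<Rightarrow> (real \<Rightarrow> real) \<Rightarrow> bool" where
  "dual_via_pairing p \<omega> \<nu> \<longleftrightarrow>
    (let q = conj_exp p; \<sigma> = sigma_w p \<omega> \<nu>; \<nu>' = (\<lambda>r. ennreal (\<nu> r));
         X = Ap_w q \<sigma>; N = norm_w q \<sigma>; T = (\<lambda>g f. pairing \<omega> f g) in
      (\<forall>g \<in> Ap_w p \<nu>'.
         (\<forall>f\<in>X. integrable dA (\<lambda>z. f z * cnj (g z) * complex_of_real (\<omega> (cmod z)))) \<and>
         bounded_functional X N (T g)) \<and>
      (\<forall>L. bounded_functional X N L \<longrightarrow>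
         (\<exists>g \<in> Ap_w p \<nu>'. \<forall>f\<in>X. L f = T g f) \<and>
         (\<forall>g1 \<in> Ap_w p \<nu>'. \<forall>g2 \<in> Ap_w p \<nu>'.
            (\<forall>f\<in>X. L f = T g1 f) \<longrightarrow> (\<forall>f\<in>X. L f = T g2 f) \<longrightarrow> (\<forall>z\<in>disc. g1 z = g2 z))) \<and>
      (\<exists>c C. 0 < c \<and> 0 < C \<and> (\<forall>g \<in> Ap_w p \<nu>'.
         c * norm_w p \<nu>' g \<le> functional_norm X N (T g) \<and>
         functional_norm X N (T g) \<le> C * norm_w p \<nu>' g)))"

end

theory Submission
  imports Defs "HOL-Library.Real_Mod" "HOL-Complex_Analysis.Complex_Analysis"
begin

text \<open>
  Everything is done on Fejer means of Taylor coefficients, so that neither Hahn-Banach nor the Riesz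
  representation of the dual of \<open>L\<^sup>p\<close> is needed. For a rotation invariant weight the Fejer means
  contract the weighted norm of an analytic function and converge to it, and radiality of \<open>\<omega>\<close>
  makes monomials orthogonal, so the projection acts on coefficients and is formally self-adjoint.

  If the projection is bounded on \<open>L\<^sup>p\<^sub>\<nu>\<close>, testing it on truncations of \<open>(\<omega>/\<nu>)\<^sup>q\<^sup>-\<^sup>1\<close>
  (\<open>q\<close> being the conjugate exponent) shows that \<open>\<sigma>\<close> is integrable, and testing with the extremals
  of Hoelder's inequality transfers the bound to Fejer means in \<open>L\<^sup>q\<^sub>\<sigma>\<close>. A functional \<open>L\<close> prescribes,
  through its values on monomials, the Taylor coefficients of its only possible representative \<open>g\<close>;
  the same extremals bound the Fejer means of \<open>g\<close> by the norm of \<open>L\<close>, and Fatou's lemma bounds \<open>g\<close>.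

  Conversely, if the pairing realises the dual, then \<open>1\<close> is not annihilated, which forces \<open>\<sigma>\<close> to be
  integrable. The functional induced by \<open>u\<close> in \<open>L\<^sup>p\<^sub>\<nu>\<close> is then represented by an analytic \<open>g\<close> with
  the same coefficients as the projection of \<open>u\<close>, and the norm equivalence bounds \<open>g\<close> by \<open>u\<close>.
\<close>

section \<open>Rotations and radial integration\<close>

text \<open>Two degeneracies shape the argument. Where \<nu> vanishes but \<omega> does not,
  \<sigma> is infinite; and if \<sigma> is not integrable, monomials may be missing from the space
  on the \<sigma> side, so a functional could not be read off from them. Hence integrability of
  \<sigma> is extracted early in both directions. Where \<omega> vanishes but \<nu> does not, the
  pairing is blind although the norm of \<open>g\<close> is not, so no test function recovers that
  part of the norm; the projection does, because it reproduces an analytic \<open>g\<close> from its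
  values on the rest. This costs a second factor \<open>C\<close> and explains the constant
  \<open>C\<^sup>2\<close>. Fejer means are preferred to Taylor partial sums because they average
  rotations with nonnegative weights: this gives contractions for every exponent at least 1 without
  singular integrals, and exponent 1 serves to identify coefficients. They also keep the functions
  to be estimated polynomial, so that norms are known to be finite before they are cancelled, and
  the adjoint of the projection is a matter of finite sums instead of a double integral of the
  kernel.\<close>

lemma lborel_complex: "(lborel :: complex measure) = distr (lborel \<Otimes>\<^sub>M lborel) borel (\<lambda>(x, y). Complex x y)"
proof (rule lborel_eqI)
  fix l u :: complex assume le: "\<And>b. b \<in> Basis \<Longrightarrow> l \<bullet> b \<le> u \<bullet> b"
  have m: "(\<lambda>(x, y). Complex x y) \<in> borel_measurable (lborel \<Otimes>\<^sub>M lborel)"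
    unfolding lborel_prod measurable_lborel2
    by (intro borel_measurable_continuous_onI) (simp add: case_prod_unfold Complex_eq, intro continuous_intros)
  have "(\<lambda>(x, y). Complex x y) -` box l u = box (Re l, Im l) (Re u, Im u)"
    by (auto simp: box_def Basis_complex_def Basis_prod_def)
  then show "emeasure (distr (lborel \<Otimes>\<^sub>M lborel) borel (\<lambda>(x, y). Complex x y)) (box l u) = (\<Prod>b\<in>Basis. (u - l) \<bullet> b)"
    using le[of 1] le[of \<i>] m
    by (subst emeasure_distr) (auto simp: lborel_prod emeasure_lborel_box_eq Basis_complex_def Basis_prod_def
        image_Un prod.union_disjoint ennreal_mult' mult.commute)
qed simp

lemma Complex_measurable [measurable (raw)]:
  assumes [measurable]: "f \<in> borel_measurable M" "g \<in> borel_measurable M"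
  shows "(\<lambda>x. Complex (f x) (g x)) \<in> borel_measurable M"
  unfolding Complex_eq by measurable

text \<open>Both orders of iteration are recorded because a shear along one axis is a translation of
  the inner variable by an amount that the outer one fixes.\<close>

lemma nn_integral_lborel_complex:
  assumes [measurable]: "F \<in> borel_measurable borel"
  shows "(\<integral>\<^sup>+z. F z \<partial>lborel) = (\<integral>\<^sup>+y. \<integral>\<^sup>+x. F (Complex x y) \<partial>lborel \<partial>lborel)"
    and "(\<integral>\<^sup>+z. F z \<partial>lborel) = (\<integral>\<^sup>+x. \<integral>\<^sup>+y. F (Complex x y) \<partial>lborel \<partial>lborel)"
proof -
  have *: "(\<integral>\<^sup>+z. F z \<partial>lborel) = (\<integral>\<^sup>+q. F (Complex (fst q) (snd q)) \<partial>(lborel \<Otimes>\<^sub>M lborel))"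
    by (subst lborel_complex, subst nn_integral_distr) (auto simp: case_prod_unfold)
  then show "(\<integral>\<^sup>+z. F z \<partial>lborel) = (\<integral>\<^sup>+x. \<integral>\<^sup>+y. F (Complex x y) \<partial>lborel \<partial>lborel)"
    by (subst (asm) lborel.nn_integral_fst[symmetric]) auto
  show "(\<integral>\<^sup>+z. F z \<partial>lborel) = (\<integral>\<^sup>+y. \<integral>\<^sup>+x. F (Complex x y) \<partial>lborel \<partial>lborel)"
    unfolding * by (subst lborel_pair.nn_integral_snd[symmetric]) auto
qed

lemma nn_integral_shear_Re:
  assumes [measurable]: "F \<in> borel_measurable borel"
  shows "(\<integral>\<^sup>+z. F (Complex (Re z + s * Im z) (Im z)) \<partial>lborel) = (\<integral>\<^sup>+z. F z \<partial>lborel)"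
proof -
  have "(\<integral>\<^sup>+x. F (Complex (x + s * y) y) \<partial>lborel) = (\<integral>\<^sup>+x. F (Complex x y) \<partial>lborel)" for y
    by (subst nn_integral_real_affine[of _ 1 "s * y"]) (auto simp: add.commute)
  then show ?thesis
    by (subst (1 2) nn_integral_lborel_complex(1)) auto
qed

lemma nn_integral_shear_Im:
  assumes [measurable]: "F \<in> borel_measurable borel"
  shows "(\<integral>\<^sup>+z. F (Complex (Re z) (Im z + s * Re z)) \<partial>lborel) = (\<integral>\<^sup>+z. F z \<partial>lborel)"
proof -
  have "(\<integral>\<^sup>+y. F (Complex x (y + s * x)) \<partial>lborel) = (\<integral>\<^sup>+y. F (Complex x y) \<partial>lborel)" for x
    by (subst nn_integral_real_affine[of _ 1 "s * x"]) (auto simp: add.commute)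
  then show ?thesis
    by (subst (1 2) nn_integral_lborel_complex(2)) auto
qed

text \<open>A rotation with nonzero sine is a product of three shears.\<close>

lemma nn_integral_rotation:
  assumes [measurable]: "F \<in> borel_measurable borel" and w: "cmod w = 1"
  shows "(\<integral>\<^sup>+z. F (w * z) \<partial>lborel) = (\<integral>\<^sup>+z. F z \<partial>lborel)"
proof (cases "Im w = 0")
  case True
  then have "\<bar>Re w\<bar> = 1"
    using w by (simp add: cmod_def)
  then have "w = 1 \<or> w = -1"
    using True by (auto simp: complex_eq_iff)
  moreover have "(\<integral>\<^sup>+z. F (-z) \<partial>lborel) = (\<integral>\<^sup>+z. F z \<partial>lborel)"
    by (subst (2) lborel_affine[of "-1" 0]) (auto simp: nn_integral_distr nn_integral_density)
  ultimately show ?thesis by auto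
next
  case False
  have sq: "(Re w)\<^sup>2 + (Im w)\<^sup>2 = 1"
    using w by (simp add: cmod_def)
  \<comment> \<open>For \<open>w = cis t\<close> this is \<open>- tan (t / 2)\<close>, the outer
    shear in the factorisation of a rotation into three shears; the modulus condition
    \<open>sq\<close> enters through \<open>s2\<close>.\<close>
  define s where "s = (Re w - 1) / Im w"
  have s1: "1 + s * Im w = Re w" and s2: "s * (Re w + 1) = - Im w"
    using False sq by (auto simp: s_def field_simps power2_eq_square)
  define F1 where "F1 z = F (Complex (Re z + s * Im z) (Im z))" for z
  define F2 where "F2 z = F1 (Complex (Re z) (Im z + Im w * Re z))" for z
  have [measurable]: "F1 \<in> borel_measurable borel" "F2 \<in> borel_measurable borel"
    unfolding F1_def F2_def by measurable
  have "w * z = Complex ((Re z + s * Im z) + s * (Im z + Im w * (Re z + s * Im z))) (Im z + Im w * (Re z + s * Im z))" for z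
  proof -
    have "(Re z + s * Im z) + s * (Im z + Im w * (Re z + s * Im z))
        = (1 + s * Im w) * Re z + s * ((1 + s * Im w) + 1) * Im z"
      by (simp add: algebra_simps)
    moreover have "Im z + Im w * (Re z + s * Im z) = Im w * Re z + (1 + s * Im w) * Im z"
      by (simp add: algebra_simps)
    ultimately show ?thesis
      by (simp add: complex_eq_iff s1 s2)
  qed
  then have "(\<integral>\<^sup>+z. F (w * z) \<partial>lborel) = (\<integral>\<^sup>+z. F2 (Complex (Re z + s * Im z) (Im z)) \<partial>lborel)"
    by (simp add: F1_def F2_def)
  also have "\<dots> = (\<integral>\<^sup>+z. F2 z \<partial>lborel)" by (rule nn_integral_shear_Re) simp
  also have "\<dots> = (\<integral>\<^sup>+z. F1 z \<partial>lborel)" unfolding F2_def by (rule nn_integral_shear_Im) simp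
  also have "\<dots> = (\<integral>\<^sup>+z. F z \<partial>lborel)" unfolding F1_def by (rule nn_integral_shear_Re) simp
  finally show ?thesis .
qed

text \<open>Measurability for the completed measure is not automatic, since preimages of null sets
  must be null. Invariance of the Borel measure supplies this, so it is proved first
  (\<open>d\<close>).\<close>

lemma distr_lebesgue_rotation:
  assumes w: "cmod w = 1"
  shows "distr lebesgue lebesgue ((*) w) = lebesgue"
    and "(*) w \<in> lebesgue \<rightarrow>\<^sub>M lebesgue"
proof -
  have d: "distr lborel lborel ((*) w) = lborel"
  proof (rule measure_eqI)
    fix A :: "complex set" assume "A \<in> sets (distr lborel lborel ((*) w))"
    then have [measurable]: "A \<in> sets borel" by simp
    have "emeasure (distr lborel lborel ((*) w)) A = (\<integral>\<^sup>+z. indicator A z \<partial>distr lborel lborel ((*) w))"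
      by simp
    also have "\<dots> = (\<integral>\<^sup>+z. indicator A (w * z) \<partial>lborel)"
      by (subst nn_integral_distr) auto
    also have "\<dots> = emeasure lborel A"
      by (subst nn_integral_rotation[OF _ w]) auto
    finally show "emeasure (distr lborel lborel ((*) w)) A = emeasure lborel A" .
  qed simp
  have m: "(*) w \<in> lebesgue \<rightarrow>\<^sub>M lborel"
    by (intro measurable_completion) auto
  have d': "distr lebesgue lborel ((*) w) = lborel"
    by (subst distr_completion) (auto simp: d)
  show "(*) w \<in> lebesgue \<rightarrow>\<^sub>M lebesgue"
    by (rule completion.measurable_completion2[OF m]) (simp add: d')
  show "distr lebesgue lebesgue ((*) w) = lebesgue"
    using completion.completion_distr_eq[OF m] d' by simp
qed

section \<open>The normalised area measure on the disc\<close>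

lemma space_dA [simp]: "space dA = disc"
  by (simp add: dA_def space_restrict_space)

lemma sets_dA: "sets dA = sets (lebesgue_on disc)"
  by (simp add: dA_def)

lemma disc_lebesgue [measurable]: "disc \<in> sets lebesgue"
  by (simp add: disc_def)

lemma borel_measurable_dA: "f \<in> borel_measurable dA \<longleftrightarrow> f \<in> borel_measurable (lebesgue_on disc)"
  by (simp add: dA_def)

lemma nn_integral_dA:
  assumes "f \<in> borel_measurable dA"
  shows "(\<integral>\<^sup>+z. f z \<partial>dA) = (\<integral>\<^sup>+z. ennreal (1 / pi) * f z * indicator disc z \<partial>lebesgue)"
  using assms unfolding dA_def
  by (subst nn_integral_density) (auto simp: nn_integral_restrict_space)

lemma emeasure_dA:
  assumes "A \<in> sets dA"
  shows "emeasure dA A = ennreal (1 / pi) * emeasure lebesgue A"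
proof -
  have "A \<subseteq> disc" "A \<in> sets lebesgue"
    using assms by (auto simp: sets_dA sets_restrict_space_iff)
  moreover from assms have "A \<in> sets (lebesgue_on disc)" by (simp add: sets_dA)
  ultimately show ?thesis
    by (simp add: dA_def emeasure_density nn_integral_cmult emeasure_restrict_space)
qed

lemma finite_measure_dA: "finite_measure dA"
proof
  have "emeasure dA disc = ennreal (1 / pi) * emeasure lebesgue disc"
    by (rule emeasure_dA) (metis sets.top space_dA)
  also have "\<dots> < \<infinity>"
    using emeasure_bounded_finite[of disc] by (auto simp: disc_def ennreal_mult_less_top emeasure_ball)
  finally show "emeasure dA (space dA) \<noteq> \<infinity>" by simp
qed

lemma rotation_measurable_dA [measurable]:
  assumes "cmod w = 1"
  shows "(*) w \<in> dA \<rightarrow>\<^sub>M dA"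
proof -
  have "(*) w \<in> lebesgue_on disc \<rightarrow>\<^sub>M lebesgue_on disc"
    by (rule measurable_restrict_space3[OF distr_lebesgue_rotation(2)[OF assms]])
       (auto simp: disc_def norm_mult assms)
  then show ?thesis
    using measurable_cong_sets[OF sets_dA sets_dA] by blast
qed

lemma distr_dA_rotation:
  assumes w: "cmod w = 1"
  shows "distr dA dA ((*) w) = dA"
proof (rule measure_eqI)
  fix A assume "A \<in> sets (distr dA dA ((*) w))"
  then have A: "A \<in> sets dA" by simp
  then have A': "A \<in> sets lebesgue" "A \<subseteq> disc"
    by (auto simp: sets_dA sets_restrict_space_iff)
  have eq: "(*) w -` A \<inter> disc = (*) w -` A"
    using A' by (auto simp: disc_def norm_mult w subset_iff)
  have "emeasure (distr dA dA ((*) w)) A = emeasure dA ((*) w -` A)"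
    using A w by (subst emeasure_distr) (auto simp: eq)
  also have "\<dots> = ennreal (1 / pi) * emeasure lebesgue ((*) w -` A)"
    using measurable_sets[OF rotation_measurable_dA[OF w] A] by (subst emeasure_dA) (auto simp: eq)
  also have "emeasure lebesgue ((*) w -` A) = emeasure (distr lebesgue lebesgue ((*) w)) A"
    using A' distr_lebesgue_rotation(2)[OF w] by (subst emeasure_distr) auto
  also have "ennreal (1 / pi) * \<dots> = emeasure dA A"
    by (simp only: distr_lebesgue_rotation(1)[OF w] emeasure_dA[OF A])
  finally show "emeasure (distr dA dA ((*) w)) A = emeasure dA A" .
qed simp

lemma nn_integral_dA_rotation:
  assumes "F \<in> borel_measurable dA" "cmod w = 1"
  shows "(\<integral>\<^sup>+z. F (w * z) \<partial>dA) = (\<integral>\<^sup>+z. F z \<partial>dA)"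
  using assms by (subst (2) distr_dA_rotation[OF assms(2), symmetric]) (simp add: nn_integral_distr)

lemma integral_dA_rotation:
  fixes F :: "complex \<Rightarrow> complex"
  assumes "F \<in> borel_measurable dA" "cmod w = 1"
  shows "(\<integral>z. F (w * z) \<partial>dA) = (\<integral>z. F z \<partial>dA)"
  using assms by (subst (2) distr_dA_rotation[OF assms(2), symmetric]) (simp add: integral_distr)

section \<open>Polar coordinates for radial functions\<close>

lemma distr_lborel_cmod: "distr lborel lborel cmod = density lborel (\<lambda>r. ennreal (2 * pi * r) * indicator {0..} r)"
  (is "?L = ?R")
proof (rule measure_eqI_generator_eq[where E = "range (\<lambda>b::real. {..b})" and \<Omega> = UNIV and A = "\<lambda>n. {..real n}"])
  show "Int_stable (range (\<lambda>b::real. {..b}))"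
    by (auto simp: Int_stable_def)
  show "sets ?L = sigma_sets UNIV (range atMost)" "sets ?R = sigma_sets UNIV (range atMost)"
    by (simp_all add: borel_eq_atMost)
  \<comment> \<open>A half-line pulls back to a closed disc of area \<open>pi * b^2\<close>; the
    derivative of this area is the density, so no angular variable appears.\<close>
  have L: "emeasure ?L {..b} = ennreal (if 0 \<le> b then pi * b^2 else 0)" for b
  proof -
    have "emeasure ?L {..b} = emeasure lborel (cball (0::complex) b)"
      by (subst emeasure_distr) (auto intro!: arg_cong[where f = "emeasure lborel"])
    also have "\<dots> = ennreal (if 0 \<le> b then pi * b^2 else 0)"
      by (auto simp: emeasure_cball eval_unit_ball_vol)
    finally show ?thesis .
  qed
  have R: "emeasure ?R {..b} = ennreal (if 0 \<le> b then pi * b^2 else 0)" for b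
  proof -
    have "emeasure ?R {..b} = (\<integral>\<^sup>+r. ennreal (2 * pi * r) * indicator {0..b} r \<partial>lborel)"
      by (subst emeasure_density) (auto intro!: nn_integral_cong split: split_indicator)
    also have "\<dots> = ennreal (if 0 \<le> b then pi * b^2 else 0)"
    proof (cases "0 \<le> b")
      case True
      have "(\<integral>\<^sup>+r. ennreal (2 * pi * r) * indicator {0..b} r \<partial>lborel) = pi * b^2 - pi * 0^2"
        by (rule nn_integral_FTC_Icc[OF _ _ _ True]) (auto intro!: derivative_eq_intros)
      then show ?thesis using True by simp
    qed auto
    finally show ?thesis .
  qed
  show "\<And>X. X \<in> range atMost \<Longrightarrow> emeasure ?L X = emeasure ?R X"
    unfolding L R by auto (metis L R)
  show "(\<Union>i. {..real i}) = UNIV"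
    by (auto simp: real_arch_simple)
  show "emeasure ?L {..real i} \<noteq> \<infinity>" for i
    by (simp add: L)
qed auto

text \<open>Weights are merely Lebesgue measurable in the radius, so composing them with
  \<open>cmod\<close> needs preimages of null sets to be null; this holds because the image measure
  has a density.\<close>

lemma cmod_measurable_lebesgue: "cmod \<in> lebesgue \<rightarrow>\<^sub>M lebesgue"
proof (rule completion.measurable_completion2)
  show "cmod \<in> lebesgue \<rightarrow>\<^sub>M lborel"
    by (intro measurable_completion) auto
  have d: "distr lebesgue lborel cmod = density lborel (\<lambda>r. ennreal (2 * pi * r) * indicator {0..} r)"
    by (subst distr_completion) (auto simp: distr_lborel_cmod)
  show "null_sets lborel \<subseteq> null_sets (distr lebesgue lborel cmod)"
  proof
    fix N :: "real set" assume "N \<in> null_sets lborel"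
    then have "N \<in> sets borel" "AE r in lborel. r \<notin> N"
      by (auto dest: AE_not_in)
    then show "N \<in> null_sets (distr lebesgue lborel cmod)"
      unfolding d by (auto simp: null_sets_density_iff elim!: eventually_mono)
  qed
qed

lemma cmod_measurable_dA: "cmod \<in> dA \<rightarrow>\<^sub>M lebesgue_on {0..<1}"
proof -
  have "cmod \<in> lebesgue_on disc \<rightarrow>\<^sub>M lebesgue_on {0..<1}"
    by (rule measurable_restrict_space3[OF cmod_measurable_lebesgue]) (auto simp: disc_def)
  then show ?thesis
    using measurable_cong_sets[OF sets_dA refl] by blast
qed

lemma nn_integral_lebesgue_cmod:
  fixes F :: "real \<Rightarrow> ennreal"
  assumes F: "F \<in> borel_measurable lebesgue"
  shows "(\<integral>\<^sup>+z. F (cmod z) \<partial>lebesgue) = (\<integral>\<^sup>+r. ennreal (2 * pi * r) * indicator {0..} r * F r \<partial>lebesgue)"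
proof -
  obtain G where [measurable]: "G \<in> borel_measurable borel" and G: "AE r in lborel. F r = G r"
    using completion_ex_borel_measurable[OF F] by auto
  have "AE r in distr lborel lborel cmod. F r = G r"
    unfolding distr_lborel_cmod using G by (subst AE_density) auto
  then have "AE z in lborel. F (cmod z) = G (cmod z)"
    by (rule AE_distrD[rotated]) simp
  then have "(\<integral>\<^sup>+z. F (cmod z) \<partial>lebesgue) = (\<integral>\<^sup>+z. G (cmod z) \<partial>lborel)"
    by (simp add: nn_integral_completion nn_integral_cong_AE)
  also have "\<dots> = (\<integral>\<^sup>+r. G r \<partial>distr lborel lborel cmod)"
    by (subst nn_integral_distr) auto
  also have "\<dots> = (\<integral>\<^sup>+r. ennreal (2 * pi * r) * indicator {0..} r * G r \<partial>lborel)"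
    unfolding distr_lborel_cmod by (subst nn_integral_density) auto
  also have "\<dots> = (\<integral>\<^sup>+r. ennreal (2 * pi * r) * indicator {0..} r * F r \<partial>lebesgue)"
    using G by (subst nn_integral_completion) (auto intro!: nn_integral_cong_AE)
  finally show ?thesis .
qed

text \<open>The factor \<open>1 / pi\<close> of \<open>dA\<close> reduces the circumference to
  \<open>2 * r\<close>; the 2 survives in \<open>even_moment\<close>.\<close>

lemma nn_integral_dA_radial:
  fixes F :: "real \<Rightarrow> ennreal"
  assumes F: "F \<in> borel_measurable (lebesgue_on {0..<1})"
  shows "(\<integral>\<^sup>+z. F (cmod z) \<partial>dA) = (\<integral>\<^sup>+r. ennreal (2 * r) * F r \<partial>lebesgue_on {0..<1})"
proof -
  define G where "G r = F r * indicator {0..<1} r" for r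
  have G: "G \<in> borel_measurable lebesgue"
    unfolding G_def using F by (subst (asm) borel_measurable_restrict_space_iff_ennreal) auto
  have "(\<lambda>z. F (cmod z)) \<in> borel_measurable dA"
    using measurable_compose[OF cmod_measurable_dA F] .
  then have "(\<integral>\<^sup>+z. F (cmod z) \<partial>dA) = (\<integral>\<^sup>+z. ennreal (1 / pi) * G (cmod z) \<partial>lebesgue)"
    by (subst nn_integral_dA) (auto intro!: nn_integral_cong simp: G_def disc_def split: split_indicator)
  also have "\<dots> = (\<integral>\<^sup>+r. ennreal (2 * pi * r) * indicator {0..} r * (ennreal (1 / pi) * G r) \<partial>lebesgue)"
    using G by (intro nn_integral_lebesgue_cmod) auto
  also have "\<dots> = (\<integral>\<^sup>+r. (ennreal (2 * r) * F r) * indicator {0..<1} r \<partial>lebesgue)"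
    by (intro nn_integral_cong)
       (auto simp: G_def ennreal_mult'[symmetric] mult.assoc[symmetric] split: split_indicator)
  also have "\<dots> = (\<integral>\<^sup>+r. ennreal (2 * r) * F r \<partial>lebesgue_on {0..<1})"
    by (subst nn_integral_restrict_space) auto
  finally show ?thesis .
qed

section \<open>Fejer means\<close>

text \<open>Only frequencies below \<open>N\<close> occur, so \<open>fejer a 1\<close> is the
  constant \<open>a 0\<close>; this mean isolates the value at the origin twice below.\<close>

definition fejer :: "(nat \<Rightarrow> complex) \<Rightarrow> nat \<Rightarrow> complex \<Rightarrow> complex" where
  "fejer a N z = (\<Sum>n<N. of_real (1 - real n / real N) * a n * z ^ n)"

definition taylor_on_disc :: "(complex \<Rightarrow> complex) \<Rightarrow> (nat \<Rightarrow> complex) \<Rightarrow> bool" where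
  "taylor_on_disc f a \<longleftrightarrow> (\<forall>z\<in>disc. (\<lambda>n. a n * z ^ n) sums f z)"

lemma taylor_on_disc_ex:
  assumes "f holomorphic_on disc"
  obtains a where "taylor_on_disc f a"
  using holomorphic_power_series[of f 0 1] assms
    that[of "\<lambda>n. (deriv ^^ n) f 0 / fact n"]
  unfolding taylor_on_disc_def disc_def by auto

lemma taylor_on_disc_holomorphic: "taylor_on_disc f a \<Longrightarrow> f holomorphic_on disc"
  using power_series_holomorphic[of 0 1 a f] by (simp add: taylor_on_disc_def disc_def)

lemma taylor_on_disc_unique:
  assumes "taylor_on_disc f a" "taylor_on_disc g a" "z \<in> disc"
  shows "f z = g z"
  using assms sums_unique2[of "\<lambda>n. a n * z ^ n" "f z" "g z"] by (auto simp: taylor_on_disc_def)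

lemma taylor_on_disc_summable:
  assumes a: "taylor_on_disc f a" and z: "z \<in> disc"
  shows "summable (\<lambda>n. norm (a n * z ^ n))"
proof -
  obtain t where t: "cmod z < t" "t < 1"
    using dense[of "cmod z" 1] z by (auto simp: disc_def)
  have t0: "0 < t" using t norm_ge_zero[of z] by linarith
  then have "complex_of_real t \<in> disc"
    using t by (simp add: disc_def)
  then have "summable (\<lambda>n. a n * of_real t ^ n)"
    using a by (auto simp: taylor_on_disc_def sums_iff)
  from powser_insidea[OF this, of z] show ?thesis
    using t t0 by simp
qed

lemma holomorphic_on_disc_measurable:
  assumes "f holomorphic_on disc"
  shows "f \<in> borel_measurable dA"
proof -
  have "f \<in> borel_measurable (lebesgue_on disc)"
    using assms by (intro continuous_imp_measurable_on_sets_lebesgue holomorphic_on_imp_continuous_on) auto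
  then show ?thesis by (simp add: borel_measurable_dA)
qed

lemma fejer_measurable [measurable]: "fejer a N \<in> borel_measurable dA"
  by (intro holomorphic_on_disc_measurable) (auto simp: fejer_def[abs_def] intro!: holomorphic_intros)

lemma tannery_sequence:
  fixes c :: "nat \<Rightarrow> nat \<Rightarrow> complex"
  assumes "\<And>k. (\<lambda>n. c k n) \<longlonglongrightarrow> b k" "\<And>k n. norm (c k n) \<le> M k" "summable M"
  shows "(\<lambda>n. \<Sum>k. c k n) \<longlonglongrightarrow> (\<Sum>k. b k)"
proof -
  have "eventually (\<lambda>(k, n). norm (c k n) \<le> M k) (at_top \<times>\<^sub>F sequentially)"
    by (intro always_eventually) (auto simp: assms(2))
  from tannerys_theorem[OF assms(1) this assms(3)] show ?thesis by simp
qed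

text \<open>Dominated convergence for series: the multipliers lie in [0, 1] and tend to 1, and the
  Taylor series converges absolutely.\<close>

lemma fejer_tendsto:
  assumes a: "taylor_on_disc f a" and z: "z \<in> disc"
  shows "(\<lambda>N. fejer a N z) \<longlonglongrightarrow> f z"
proof -
  define c where "c k N = (if k < N then of_real (1 - real k / real N) else 0) * (a k * z ^ k)" for k N
  have "(\<lambda>N. \<Sum>k. c k N) \<longlonglongrightarrow> (\<Sum>k. a k * z ^ k)"
  proof (rule tannery_sequence[OF _ _ taylor_on_disc_summable[OF a z]])
    fix k
    have "(\<lambda>N. of_real (1 - real k / real N) * (a k * z ^ k)) \<longlonglongrightarrow> of_real (1 - 0) * (a k * z ^ k)"
      by (intro tendsto_intros lim_const_over_n)
    moreover have "eventually (\<lambda>N. of_real (1 - real k / real N) * (a k * z ^ k) = c k N) sequentially"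
      using eventually_gt_at_top[of k] by eventually_elim (simp add: c_def)
    ultimately show "(\<lambda>N. c k N) \<longlonglongrightarrow> a k * z ^ k"
      by (simp add: tendsto_cong)
  next
    fix k N
    have "norm (if k < N then of_real (1 - real k / real N) else 0 :: complex) \<le> 1"
    proof (cases "k < N")
      case True
      then have "norm (of_real (1 - real k / real N) :: complex) = 1 - real k / real N"
        by (subst norm_of_real) (simp add: field_simps)
      then show ?thesis using True by simp
    qed simp
    then show "norm (c k N) \<le> norm (a k * z ^ k)"
      unfolding c_def norm_mult[of _ "a k * z ^ k"] by (rule mult_left_le_one_le[OF norm_ge_zero norm_ge_zero])
  qed
  moreover have "(\<Sum>k. c k N) = fejer a N z" for N
    unfolding fejer_def by (subst suminf_finite[of "{..<N}"]) (auto simp: c_def mult.assoc)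
  moreover have "(\<Sum>k. a k * z ^ k) = f z"
    using a z by (auto simp: taylor_on_disc_def sums_iff)
  ultimately show ?thesis by simp
qed

section \<open>The Fejer kernel averaged over roots of unity\<close>

lemma sum_cis_multiples:
  fixes m :: int
  assumes M: "M > 0"
  shows "(\<Sum>j<M. cis (2 * pi * real j * of_int m / real M)) = (if int M dvd m then of_nat M else 0)"
proof -
  define x where "x = cis (2 * pi * of_int m / real M)"
  have pow: "x ^ j = cis (2 * pi * real j * of_int m / real M)" for j
    unfolding x_def Complex.DeMoivre by (rule arg_cong[where f = cis]) (simp add: field_simps)
  have xM: "x ^ M = 1"
    using M cis_multiple_2pi[of "of_int m"] by (simp add: pow mult.commute mult.left_commute)
  show ?thesis
  proof (cases "x = 1")
    case True
    then obtain k :: int where "2 * pi * of_int m / real M = of_int k * (2 * pi)"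
      unfolding x_def cis_eq_1_iff by blast
    then have "of_int m = of_int k * real M"
      using M by (simp add: field_simps)
    then have "m = k * int M"
      by (metis of_int_eq_iff of_int_mult of_int_of_nat_eq)
    moreover have "(\<Sum>j<M. x ^ j) = of_nat M" using True by simp
    ultimately show ?thesis by (simp only: pow) simp
  next
    case False
    have "\<not> int M dvd m"
    proof
      assume "int M dvd m"
      then obtain k where "m = int M * k" by auto
      then have "x = cis (2 * pi * of_int k)"
        unfolding x_def using M by (intro arg_cong[where f = cis]) (simp add: \<open>m = int M * k\<close>)
      also have "\<dots> = 1"
        by (rule cis_multiple_2pi) simp
      finally show False using False by contradiction
    qed
    moreover have "(\<Sum>j<M. x ^ j) = 0"
      using geometric_sum[OF False, of M] xM by simp
    ultimately show ?thesis by (simp flip: pow)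
  qed
qed

text \<open>Fejer's kernel written as a square, which makes its sign evident. On the unit circle its
  Fourier coefficients for \<open>k < N\<close> are the multipliers \<open>1 - k / N\<close> of
  \<open>fejer\<close>.\<close>

definition fejer_kernel :: "nat \<Rightarrow> complex \<Rightarrow> real" where
  "fejer_kernel N w = (cmod (\<Sum>l<N. w ^ l))\<^sup>2 / real N"

lemma fejer_kernel_nonneg: "0 \<le> fejer_kernel N w"
  by (simp add: fejer_kernel_def)

text \<open>Averaging the Fejer kernel over the \<open>M\<close>-th roots of unity instead of the circle aliases
  frequencies that agree modulo \<open>M\<close>; the true Fejer multiplier reappears as \<open>M\<close> tends to infinity.\<close>

definition aliased_coeff :: "nat \<Rightarrow> nat \<Rightarrow> nat \<Rightarrow> real" where
  "aliased_coeff N M k = (\<Sum>l<N. \<Sum>m<N. of_bool (int M dvd int l - int m + int k)) / real N"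

text \<open>Expanding the square yields the frequencies \<open>l - m + k\<close>; orthogonality of
  the characters of the cyclic group of order \<open>M\<close> keeps those divisible by
  \<open>M\<close>.\<close>

lemma fejer_kernel_average:
  assumes "M > 0"
  shows "(\<Sum>j<M. of_real (fejer_kernel N (cis (2 * pi * real j / real M)) / real M) * cis (2 * pi * real j / real M) ^ k)
    = of_real (aliased_coeff N M k)"
proof -
  define w where "w j = cis (2 * pi * real j / real M)" for j
  have K: "of_real (fejer_kernel N (w j) / real M) * w j ^ k
      = (\<Sum>l<N. \<Sum>m<N. cis (2 * pi * real j * of_int (int l - int m + int k) / real M)) / (of_nat N * of_nat M)" for j
  proof -
    have "complex_of_real ((cmod (\<Sum>l<N. w j ^ l))\<^sup>2) = (\<Sum>l<N. w j ^ l) * cnj (\<Sum>m<N. w j ^ m)"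
      by (rule complex_norm_square)
    also have "\<dots> = (\<Sum>l<N. \<Sum>m<N. w j ^ l * cnj (w j) ^ m)"
      by (simp add: sum_product)
    finally have "complex_of_real ((cmod (\<Sum>l<N. w j ^ l))\<^sup>2) * w j ^ k
        = (\<Sum>l<N. \<Sum>m<N. w j ^ l * cnj (w j) ^ m * w j ^ k)"
      by (simp add: sum_distrib_right)
    also have "\<dots> = (\<Sum>l<N. \<Sum>m<N. cis (2 * pi * real j * of_int (int l - int m + int k) / real M))"
      unfolding w_def cis_cnj Complex.DeMoivre cis_mult
      by (intro sum.cong refl arg_cong[where f = cis]) (simp add: algebra_simps add_divide_distrib diff_divide_distrib)
    finally show ?thesis by (simp add: fejer_kernel_def)
  qed
  have "(\<Sum>j<M. of_real (fejer_kernel N (w j) / real M) * w j ^ k)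
      = (\<Sum>j<M. \<Sum>l<N. \<Sum>m<N. cis (2 * pi * real j * of_int (int l - int m + int k) / real M)) / (of_nat N * of_nat M)"
    unfolding K by (simp add: sum_divide_distrib)
  also have "(\<Sum>j<M. \<Sum>l<N. \<Sum>m<N. cis (2 * pi * real j * of_int (int l - int m + int k) / real M))
      = (\<Sum>l<N. \<Sum>j<M. \<Sum>m<N. cis (2 * pi * real j * of_int (int l - int m + int k) / real M))"
    by (rule sum.swap)
  also have "\<dots> = (\<Sum>l<N. \<Sum>m<N. \<Sum>j<M. cis (2 * pi * real j * of_int (int l - int m + int k) / real M))"
    by (rule sum.cong[OF refl]) (rule sum.swap)
  also have "\<dots> = (\<Sum>l<N. \<Sum>m<N. of_nat M * of_bool (int M dvd int l - int m + int k))"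
    by (intro sum.cong refl, subst sum_cis_multiples[OF assms]) simp
  also have "\<dots> = of_nat M * (\<Sum>l<N. \<Sum>m<N. of_bool (int M dvd int l - int m + int k))"
    by (simp only: sum_distrib_left)
  finally show ?thesis
    using assms by (simp add: aliased_coeff_def w_def)
qed

lemma aliased_coeff_bounds: "0 \<le> aliased_coeff N M k" "aliased_coeff N M k \<le> real N"
proof -
  show "0 \<le> aliased_coeff N M k"
    unfolding aliased_coeff_def by (intro divide_nonneg_nonneg sum_nonneg) auto
  have "(\<Sum>l<N. \<Sum>m<N. of_bool (int M dvd int l - int m + int k)) \<le> (\<Sum>l<N. \<Sum>m<N. (1::real))"
    by (intro sum_mono) auto
  then show "aliased_coeff N M k \<le> real N"
    unfolding aliased_coeff_def by (cases "N = 0") (auto simp: field_simps)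
qed

text \<open>Aliasing stops once \<open>M \<ge> N + k\<close>: all frequencies
  \<open>l - m + k\<close> are then smaller than \<open>M\<close> in modulus, so only frequency 0
  survives, and for \<open>k < N\<close> exactly \<open>N - k\<close> pairs attain it.\<close>

lemma aliased_coeff_eq:
  assumes M: "M \<ge> N + k" and N: "N > 0"
  shows "aliased_coeff N M k = (if k < N then 1 - real k / real N else 0)"
proof -
  have "int M dvd int l - int m + int k \<longleftrightarrow> m = l + k" if "l < N" "m < N" for l m
  proof
    assume "int M dvd int l - int m + int k"
    moreover have "\<bar>int l - int m + int k\<bar> < int M"
      using that M by auto
    ultimately have "int l - int m + int k = 0"
      using dvd_imp_le_int[of "int l - int m + int k" "int M"] by linarith
    then show "m = l + k" by simp
  qed simp
  then have "(\<Sum>l<N. \<Sum>m<N. of_bool (int M dvd int l - int m + int k)) = (\<Sum>l<N. \<Sum>m<N. if m = l + k then 1 else (0::real))"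
    by (intro sum.cong refl) auto
  also have "\<dots> = (\<Sum>l<N. if l + k < N then 1 else 0)"
    by (intro sum.cong refl) (subst sum.delta, auto)
  also have "\<dots> = real (card {l \<in> {..<N}. l + k < N})"
    by (subst sum.If_cases) (auto intro!: arg_cong[where f = card])
  also have "{l \<in> {..<N}. l + k < N} = {..<N - k}" by auto
  finally show ?thesis
    using N by (auto simp: aliased_coeff_def field_simps of_nat_diff)
qed

section \<open>Jensen's inequality and contraction of weighted integrals\<close>

lemma powr_jensen_sum:
  fixes y :: "'i \<Rightarrow> complex" and c :: "'i \<Rightarrow> real"
  assumes p: "p \<ge> 1" and fin: "finite S" and c: "\<And>i. i \<in> S \<Longrightarrow> 0 \<le> c i" "(\<Sum>i\<in>S. c i) = 1"
  shows "cmod (\<Sum>i\<in>S. of_real (c i) * y i) powr p \<le> (\<Sum>i\<in>S. c i * cmod (y i) powr p)"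
proof -
  have ne: "S \<noteq> {}" using c by auto
  \<comment> \<open>The endpoint 0 is treated by hand, through \<open>t powr p \<le> t\<close> on
    the unit interval.\<close>
  have conv: "convex_on {0..} (\<lambda>x::real. x powr p)"
  proof (rule convex_onI)
    fix t x y :: real assume t: "0 < t" "t < 1" and xy: "x \<in> {0..}" "y \<in> {0..}"
    consider "x = 0" | "y = 0" | "x > 0" "y > 0" by (cases "x = 0"; cases "y = 0") (use xy that in auto)
    then show "((1 - t) *\<^sub>R x + t *\<^sub>R y) powr p \<le> (1 - t) * x powr p + t * y powr p"
    proof cases
      case 1
      have "t powr p \<le> t" using t p powr_mono'[of 1 p t] by simp
      then show ?thesis using 1 t xy by (simp add: powr_mult mult_right_mono)
    next
      case 2
      have "(1 - t) powr p \<le> 1 - t" using t p powr_mono'[of 1 p "1 - t"] by simp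
      then show ?thesis using 2 t xy by (simp add: powr_mult mult_right_mono)
    next
      case 3
      then show ?thesis
        using convex_onD[OF powr_convex[OF p], of t x y] t by simp
    qed
  qed simp
  have "cmod (\<Sum>i\<in>S. of_real (c i) * y i) \<le> (\<Sum>i\<in>S. c i * cmod (y i))"
    by (rule order_trans[OF norm_sum]) (auto simp: norm_mult c(1) intro!: sum_mono)
  then have "cmod (\<Sum>i\<in>S. of_real (c i) * y i) powr p \<le> (\<Sum>i\<in>S. c i *\<^sub>R cmod (y i)) powr p"
    using p by (intro powr_mono2) auto
  also have "\<dots> \<le> (\<Sum>i\<in>S. c i * cmod (y i) powr p)"
    by (rule convex_on_sum[OF fin ne conv]) (use c in auto)
  finally show ?thesis .
qed

text \<open>The \<open>p\<close>-th power of \<open>norm_w\<close> before conversion to the reals: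
  extended values let Fatou's lemma run without integrability conditions and absorb points where
  \<sigma> is infinite.\<close>

definition wint :: "real \<Rightarrow> (real \<Rightarrow> ennreal) \<Rightarrow> (complex \<Rightarrow> complex) \<Rightarrow> ennreal" where
  "wint p \<eta> f = (\<integral>\<^sup>+z. ennreal (cmod (f z) powr p) * \<eta> (cmod z) \<partial>dA)"

lemma radial_measurable:
  assumes "\<eta> \<in> borel_measurable (lebesgue_on {0..<1})"
  shows "(\<lambda>z. \<eta> (cmod z)) \<in> borel_measurable dA"
  using measurable_compose[OF cmod_measurable_dA assms] .

text \<open>Multiplication by an infinite weight is not continuous at 0, so limits are taken after
  the weight has been moved into the measure.\<close>

lemma wint_density:
  assumes "\<eta> \<in> borel_measurable (lebesgue_on {0..<1})" "f \<in> borel_measurable dA"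
  shows "wint p \<eta> f = (\<integral>\<^sup>+z. ennreal (cmod (f z) powr p) \<partial>density dA (\<lambda>z. \<eta> (cmod z)))"
  using radial_measurable[OF assms(1)] assms(2) unfolding wint_def
  by (subst nn_integral_density) (auto simp: mult.commute)

lemma wint_rotation:
  assumes \<eta>: "\<eta> \<in> borel_measurable (lebesgue_on {0..<1})" and f: "f \<in> borel_measurable dA" and w: "cmod w = 1"
  shows "wint p \<eta> (\<lambda>z. f (w * z)) = wint p \<eta> f"
proof -
  note [measurable] = radial_measurable[OF \<eta>] f
  show ?thesis
    unfolding wint_def
    using nn_integral_dA_rotation[of "\<lambda>z. ennreal (cmod (f z) powr p) * \<eta> (cmod z)", OF _ w]
    by (simp add: norm_mult w)
qed

text \<open>Jensen's inequality bounds each average \<open>D M\<close> of rotated copies of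
  \<open>f\<close>, rotations preserve the weighted integral, and \<open>D M\<close> tends to the
  Fejer mean pointwise, so Fatou's lemma concludes. Averages over roots of unity replace the
  integral over the circle and spare a Fubini argument in angle and point.\<close>

lemma wint_fejer_le:
  assumes p: "p \<ge> 1" and \<eta>: "\<eta> \<in> borel_measurable (lebesgue_on {0..<1})" and a: "taylor_on_disc f a"
  shows "wint p \<eta> (fejer a N) \<le> wint p \<eta> f"
proof (cases "N = 0")
  case True
  then show ?thesis by (simp add: wint_def fejer_def)
next
  case False
  have [measurable]: "f \<in> borel_measurable dA"
    using holomorphic_on_disc_measurable[OF taylor_on_disc_holomorphic[OF a]] .
  note [measurable] = radial_measurable[OF \<eta>]
  define w where "w M j = cis (2 * pi * real j / real M)" for M j :: nat
  define c where "c M j = fejer_kernel N (w M j) / real M" for M j :: nat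
  have w1: "cmod (w M j) = 1" for M j by (simp add: w_def)
  have [measurable]: "(*) (w M j) \<in> dA \<rightarrow>\<^sub>M dA" for M j by (rule rotation_measurable_dA[OF w1])
  have c0: "0 \<le> c M j" for M j by (simp add: c_def fejer_kernel_nonneg)
  define D where "D M z = (\<Sum>j<M. of_real (c M j) * f (w M j * z))" for M z
  have avg: "(\<Sum>j<M. of_real (c M j) * w M j ^ k) = of_real (aliased_coeff N M k)" if "M > 0" for M k
    using fejer_kernel_average[OF that] by (simp add: c_def w_def)
  \<comment> \<open>The total mass is the aliased coefficient of frequency 0, which is 1 as soon as
    \<open>M \<ge> N\<close>.\<close>
  have sum_c: "(\<Sum>j<M. c M j) = 1" if "M \<ge> N" for M
  proof -
    have "(\<Sum>j<M. complex_of_real (c M j)) = of_real (aliased_coeff N M 0)"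
      using avg[of M 0] that False by simp
    then have "(\<Sum>j<M. c M j) = aliased_coeff N M 0"
      by (metis of_real_eq_iff of_real_sum)
    then show ?thesis using aliased_coeff_eq[of N 0 M] that False by simp
  qed
  have D_le: "wint p \<eta> (D M) \<le> wint p \<eta> f" if M: "M \<ge> N" for M
  proof -
    have "wint p \<eta> (D M) \<le> (\<integral>\<^sup>+z. (\<Sum>j<M. ennreal (c M j) * (ennreal (cmod (f (w M j * z)) powr p) * \<eta> (cmod z))) \<partial>dA)"
      unfolding wint_def
    proof (rule nn_integral_mono)
      fix z
      have "cmod (D M z) powr p \<le> (\<Sum>j<M. c M j * cmod (f (w M j * z)) powr p)"
        unfolding D_def using M by (intro powr_jensen_sum p) (auto simp: c0 sum_c)
      then have "ennreal (cmod (D M z) powr p) \<le> ennreal (\<Sum>j<M. c M j * cmod (f (w M j * z)) powr p)"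
        by (rule ennreal_leI)
      also have "\<dots> = (\<Sum>j<M. ennreal (c M j) * ennreal (cmod (f (w M j * z)) powr p))"
        using c0 by (subst sum_ennreal[symmetric]) (auto simp: ennreal_mult)
      finally have "ennreal (cmod (D M z) powr p) \<le> (\<Sum>j<M. ennreal (c M j) * ennreal (cmod (f (w M j * z)) powr p))" .
      from mult_right_mono[OF this, of "\<eta> (cmod z)"]
      show "ennreal (cmod (D M z) powr p) * \<eta> (cmod z) \<le> (\<Sum>j<M. ennreal (c M j) * (ennreal (cmod (f (w M j * z)) powr p) * \<eta> (cmod z)))"
        by (simp add: sum_distrib_right mult.assoc)
    qed
    also have "\<dots> = (\<Sum>j<M. ennreal (c M j) * wint p \<eta> (\<lambda>z. f (w M j * z)))"
      unfolding wint_def by (subst nn_integral_sum) (auto simp: nn_integral_cmult)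
    also have "\<dots> = (\<Sum>j<M. ennreal (c M j)) * wint p \<eta> f"
      by (simp add: wint_rotation[OF \<eta> _ w1] sum_distrib_right)
    also have "\<dots> = wint p \<eta> f"
      using sum_c[OF M] by (simp add: sum_ennreal c0)
    finally show ?thesis .
  qed
  have D_lim: "(\<lambda>M. D M z) \<longlonglongrightarrow> fejer a N z" if z: "z \<in> disc" for z
  proof -
    have wz: "w M j * z \<in> disc" for M j using z by (simp add: disc_def norm_mult w1)
    have D_eq: "D M z = (\<Sum>k. of_real (aliased_coeff N M k) * (a k * z ^ k))" if "M > 0" for M
    proof -
      have "(\<lambda>k. \<Sum>j<M. of_real (c M j) * (a k * (w M j * z) ^ k)) sums D M z"
        unfolding D_def using a wz by (intro sums_sum sums_mult) (auto simp: taylor_on_disc_def)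
      moreover have "(\<Sum>j<M. of_real (c M j) * (a k * (w M j * z) ^ k)) = of_real (aliased_coeff N M k) * (a k * z ^ k)" for k
        unfolding avg[OF that, symmetric] sum_distrib_right by (simp add: power_mult_distrib algebra_simps)
      ultimately show ?thesis by (simp add: sums_iff)
    qed
    have "(\<lambda>M. \<Sum>k. of_real (aliased_coeff N M k) * (a k * z ^ k))
        \<longlonglongrightarrow> (\<Sum>k. (if k < N then of_real (1 - real k / real N) else 0) * (a k * z ^ k))"
    proof (rule tannery_sequence)
      fix k
      have "eventually (\<lambda>M. (if k < N then of_real (1 - real k / real N) else 0) * (a k * z ^ k)
          = of_real (aliased_coeff N M k) * (a k * z ^ k)) sequentially"
        using eventually_ge_at_top[of "N + k"] by eventually_elim (use False in \<open>simp add: aliased_coeff_eq\<close>)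
      then show "(\<lambda>M. of_real (aliased_coeff N M k) * (a k * z ^ k)) \<longlonglongrightarrow>
          (if k < N then of_real (1 - real k / real N) else 0) * (a k * z ^ k)"
        by (rule Lim_transform_eventually[OF tendsto_const])
      \<comment> \<open>The bound by \<open>N\<close> is crude but independent of \<open>M\<close>,
        as dominated convergence of the series requires.\<close>
      show "norm (of_real (aliased_coeff N M k) * (a k * z ^ k)) \<le> real N * norm (a k * z ^ k)" for M
        using aliased_coeff_bounds[of N M k] unfolding norm_mult[of _ "a k * z ^ k"] by (intro mult_right_mono) auto
      show "summable (\<lambda>k. real N * norm (a k * z ^ k))"
        by (intro summable_mult taylor_on_disc_summable[OF a z])
    qed
    moreover have "(\<Sum>k. (if k < N then of_real (1 - real k / real N) else 0) * (a k * z ^ k)) = fejer a N z"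
      unfolding fejer_def by (subst suminf_finite[of "{..<N}"]) (auto simp: mult.assoc)
    ultimately have "(\<lambda>M. \<Sum>k. of_real (aliased_coeff N M k) * (a k * z ^ k)) \<longlonglongrightarrow> fejer a N z" by simp
    moreover have "eventually (\<lambda>M. (\<Sum>k. of_real (aliased_coeff N M k) * (a k * z ^ k)) = D M z) sequentially"
      using eventually_gt_at_top[of 0] by eventually_elim (simp add: D_eq)
    ultimately show ?thesis by (rule Lim_transform_eventually)
  qed
  have [measurable]: "D M \<in> borel_measurable dA" for M
    unfolding D_def by measurable
  let ?\<mu> = "density dA (\<lambda>z. \<eta> (cmod z))"
  have "wint p \<eta> (fejer a N) = (\<integral>\<^sup>+z. liminf (\<lambda>M. ennreal (cmod (D M z) powr p)) \<partial>?\<mu>)"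
    unfolding wint_density[OF \<eta> fejer_measurable]
  proof (rule nn_integral_cong)
    fix z assume "z \<in> space ?\<mu>"
    then have "(\<lambda>M. ennreal (cmod (D M z) powr p)) \<longlonglongrightarrow> ennreal (cmod (fejer a N z) powr p)"
      using p by (intro tendsto_ennrealI tendsto_powr' tendsto_norm D_lim tendsto_const) auto
    then show "ennreal (cmod (fejer a N z) powr p) = liminf (\<lambda>M. ennreal (cmod (D M z) powr p))"
      by (rule lim_imp_Liminf[OF sequentially_bot, symmetric])
  qed
  also have "\<dots> \<le> liminf (\<lambda>M. \<integral>\<^sup>+z. ennreal (cmod (D M z) powr p) \<partial>?\<mu>)"
    by (rule nn_integral_liminf) measurable
  also have "\<dots> = liminf (\<lambda>M. wint p \<eta> (D M))"
    by (simp add: wint_density[OF \<eta>])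
  also have "\<dots> \<le> liminf (\<lambda>M. wint p \<eta> f)"
    by (intro Liminf_mono eventually_mono[OF eventually_ge_at_top[of N]] D_le)
  also have "\<dots> = wint p \<eta> f"
    by (rule Liminf_const) simp
  finally show ?thesis .
qed

section \<open>Norm convergence from pointwise convergence\<close>

lemma norm_diff_powr_le:
  fixes a b :: complex
  assumes "p > 0"
  shows "cmod (a - b) powr p \<le> 2 powr p * (cmod a powr p + cmod b powr p)"
proof -
  have "cmod (a - b) \<le> 2 * max (cmod a) (cmod b)"
    using norm_triangle_ineq4[of a b] by (simp add: max_def)
  then have "cmod (a - b) powr p \<le> (2 * max (cmod a) (cmod b)) powr p"
    using assms by (intro powr_mono2) auto
  also have "\<dots> = 2 powr p * max (cmod a) (cmod b) powr p"
    by (rule powr_mult)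
  also have "max (cmod a) (cmod b) powr p \<le> cmod a powr p + cmod b powr p"
    by (auto simp: max_def)
  finally show ?thesis by simp
qed

text \<open>Fatou's lemma applied to \<open>2\<^sup>p (|f\<^sub>n|\<^sup>p + |g|\<^sup>p) - |f\<^sub>n - g|\<^sup>p\<close>.\<close>

lemma Lp_convergence:
  fixes f :: "nat \<Rightarrow> 'a \<Rightarrow> complex"
  assumes p: "p > 0" and [measurable]: "\<And>n. f n \<in> borel_measurable M" "g \<in> borel_measurable M"
    and lim: "\<And>x. x \<in> space M \<Longrightarrow> (\<lambda>n. f n x) \<longlonglongrightarrow> g x"
    and le: "\<And>n. (\<integral>\<^sup>+x. ennreal (cmod (f n x) powr p) \<partial>M) \<le> (\<integral>\<^sup>+x. ennreal (cmod (g x) powr p) \<partial>M)"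
    and fin: "(\<integral>\<^sup>+x. ennreal (cmod (g x) powr p) \<partial>M) < \<infinity>"
  shows "(\<lambda>n. \<integral>\<^sup>+x. ennreal (cmod (f n x - g x) powr p) \<partial>M) \<longlonglongrightarrow> 0"
proof -
  define C where "C = 2 powr p"
  have C: "C > 0" by (simp add: C_def)
  define I where "I = (\<integral>\<^sup>+x. ennreal (cmod (g x) powr p) \<partial>M)"
  define J where "J n = (\<integral>\<^sup>+x. ennreal (cmod (f n x - g x) powr p) \<partial>M)" for n
  define h where "h n x = C * (cmod (f n x) powr p + cmod (g x) powr p) - cmod (f n x - g x) powr p" for n x
  have h0: "0 \<le> h n x" for n x
    using norm_diff_powr_le[OF p, of "f n x" "g x"] by (simp add: h_def C_def)
  have [measurable]: "h n \<in> borel_measurable M" for n unfolding h_def by measurable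
  define H where "H n = (\<integral>\<^sup>+x. ennreal (h n x) \<partial>M)" for n
  define K where "K = 2 * ennreal C * I"
  have Kfin: "K < \<infinity>" using fin by (simp add: K_def I_def ennreal_mult_less_top)
  have HJ: "H n + J n \<le> K" for n
  proof -
    have "H n + J n = (\<integral>\<^sup>+x. ennreal C * (ennreal (cmod (f n x) powr p) + ennreal (cmod (g x) powr p)) \<partial>M)"
      unfolding H_def J_def using h0 C
      by (subst nn_integral_add[symmetric])
         (auto intro!: nn_integral_cong simp: ennreal_plus[symmetric] ennreal_mult[symmetric] h_def simp del: ennreal_plus)
    also have "\<dots> = ennreal C * ((\<integral>\<^sup>+x. ennreal (cmod (f n x) powr p) \<partial>M) + I)"
      unfolding I_def by (subst nn_integral_cmult) (auto simp: nn_integral_add)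
    also have "\<dots> \<le> ennreal C * (I + I)"
      using le[of n] by (intro mult_left_mono add_right_mono) (auto simp: I_def)
    finally show ?thesis by (simp add: K_def mult.assoc mult.left_commute mult_2 distrib_left distrib_right)
  qed
  have "K = (\<integral>\<^sup>+x. liminf (\<lambda>n. ennreal (h n x)) \<partial>M)"
  proof -
    have "(\<integral>\<^sup>+x. liminf (\<lambda>n. ennreal (h n x)) \<partial>M) = (\<integral>\<^sup>+x. ennreal (2 * C) * ennreal (cmod (g x) powr p) \<partial>M)"
    proof (rule nn_integral_cong)
      fix x assume "x \<in> space M"
      then have "(\<lambda>n. ennreal (h n x)) \<longlonglongrightarrow> ennreal (C * (cmod (g x) powr p + cmod (g x) powr p) - cmod (g x - g x) powr p)"
        unfolding h_def using p by (intro tendsto_ennrealI tendsto_intros tendsto_powr' lim) auto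
      then show "liminf (\<lambda>n. ennreal (h n x)) = ennreal (2 * C) * ennreal (cmod (g x) powr p)"
        using C p by (simp add: lim_imp_Liminf ennreal_mult[symmetric] algebra_simps)
    qed
    then show ?thesis
      using C by (simp add: K_def I_def nn_integral_cmult ennreal_mult)
  qed
  also have "\<dots> \<le> liminf H"
    unfolding H_def by (rule nn_integral_liminf) measurable
  finally have K_le: "K \<le> liminf H" .
  obtain k where k: "K = ennreal k" "0 \<le> k" using Kfin by (cases K) auto
  \<comment> \<open>\<open>H n + J n \<le> K\<close> together with \<open>K \<le> liminf H\<close>
    leaves no room for \<open>J n\<close>; finiteness of \<open>K\<close> permits the subtraction,
    which is carried out on reals.\<close>
  have "(\<lambda>n. enn2real (J n)) \<longlonglongrightarrow> 0"
  proof (rule LIMSEQ_I)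
    fix e :: real assume e: "e > 0"
    have JK: "J n \<le> K" for n using HJ[of n] by (meson add_increasing dual_order.trans le_add_same_cancel2 order_refl zero_le)
    have "eventually (\<lambda>n. enn2real (J n) < e) sequentially"
    \<comment> \<open>A negative \<open>k - e\<close> would be sent to 0 by \<open>ennreal\<close>;
      in that case \<open>J n \<le> K\<close> already suffices.\<close>
    proof (cases "k < e")
      case True
      have "enn2real (J n) < e" for n
        using JK[of n] k True enn2real_leI[of k "J n"] by auto
      then show ?thesis by simp
    next
      case False
      then have "ennreal (k - e) < K"
        using k e by (simp add: ennreal_less_iff)
      then have "eventually (\<lambda>n. ennreal (k - e) < H n) sequentially"
        using K_le by (simp add: le_Liminf_iff)
      then show ?thesis
      proof eventually_elim
        case (elim n)
        have "H n < \<infinity>" "J n < \<infinity>" using HJ[of n] Kfin by (auto simp: less_top[symmetric] top_unique)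
        then obtain x y where xy: "H n = ennreal x" "J n = ennreal y" "0 \<le> x" "0 \<le> y"
          by (cases "H n"; cases "J n") auto
        then have "x + y \<le> k" "k - e < x"
          using HJ[of n] elim k False by (auto simp: ennreal_plus[symmetric] ennreal_less_iff simp del: ennreal_plus)
        then show "enn2real (J n) < e" using xy by simp
      qed
    qed
    then show "\<exists>no. \<forall>n\<ge>no. norm (enn2real (J n) - 0) < e"
      by (auto simp: eventually_sequentially)
  qed
  then have "(\<lambda>n. ennreal (enn2real (J n))) \<longlonglongrightarrow> ennreal 0"
    by (rule tendsto_ennrealI)
  moreover have "ennreal (enn2real (J n)) = J n" for n
  proof -
    have "J n \<le> K" using HJ[of n] by (meson add_increasing dual_order.trans le_add_same_cancel2 order_refl zero_le)
    then show ?thesis using Kfin by (auto intro: ennreal_enn2real)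
  qed
  ultimately show ?thesis by (simp add: J_def)
qed

text \<open>No integrable majorant of the Fejer means is at hand; contraction and pointwise
  convergence replace it in \<open>Lp_convergence\<close>.\<close>

lemma wint_fejer_tendsto:
  assumes p: "p \<ge> 1" and \<eta>: "\<eta> \<in> borel_measurable (lebesgue_on {0..<1})" and a: "taylor_on_disc f a"
    and fin: "wint p \<eta> f < \<infinity>"
  shows "(\<lambda>N. wint p \<eta> (\<lambda>z. fejer a N z - f z)) \<longlonglongrightarrow> 0"
proof -
  have f: "f \<in> borel_measurable dA"
    using holomorphic_on_disc_measurable[OF taylor_on_disc_holomorphic[OF a]] .
  have "wint p \<eta> (\<lambda>z. fejer a N z - f z)
      = (\<integral>\<^sup>+z. ennreal (cmod (fejer a N z - f z) powr p) \<partial>density dA (\<lambda>z. \<eta> (cmod z)))" for N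
    using f by (intro wint_density[OF \<eta>]) measurable
  then show ?thesis
    using p f fin wint_fejer_le[OF p \<eta> a] fejer_tendsto[OF a]
      Lp_convergence[of p "fejer a" "density dA (\<lambda>z. \<eta> (cmod z))" f]
    by (simp add: wint_density[OF \<eta>])
qed

section \<open>Coefficients and the projection\<close>

lemma radial_weight_nonneg: "radial_weight \<omega> \<Longrightarrow> z \<in> disc \<Longrightarrow> 0 \<le> \<omega> (cmod z)"
  by (simp add: radial_weight_def disc_def)

lemma radial_weight_integrable: "radial_weight \<omega> \<Longrightarrow> integrable (lebesgue_on {0..<1}) \<omega>"
  by (simp add: radial_weight_def set_integrable_def integrable_restrict_space)

lemma radial_weight_measurable: "radial_weight \<omega> \<Longrightarrow> \<omega> \<in> borel_measurable (lebesgue_on {0..<1})"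
  using radial_weight_integrable by blast

lemma radial_weight_measurable_dA: "radial_weight \<omega> \<Longrightarrow> (\<lambda>z. \<omega> (cmod z)) \<in> borel_measurable dA"
  using measurable_compose[OF cmod_measurable_dA radial_weight_measurable] by blast

lemma borel_measurable_cnj [measurable (raw)]:
  "f \<in> borel_measurable M \<Longrightarrow> (\<lambda>x. cnj (f x)) \<in> borel_measurable M"
  by (rule borel_measurable_continuous_on[OF continuous_on_cnj[OF continuous_on_id]])

lemma identity_measurable_dA [measurable]: "(\<lambda>z. z) \<in> borel_measurable dA"
  by (intro holomorphic_on_disc_measurable holomorphic_intros)

lemma radial_weight_integrable_moment:
  assumes \<omega>: "radial_weight \<omega>" and x: "0 \<le> x"
  shows "integrable (lebesgue_on {0..<1}) (\<lambda>r. r powr x * \<omega> r)"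
proof (rule Bochner_Integration.integrable_bound[OF radial_weight_integrable[OF \<omega>]])
  note [measurable] = radial_weight_measurable[OF \<omega>]
  have [measurable]: "(\<lambda>r::real. r) \<in> borel_measurable (lebesgue_on {0..<1})"
    by (intro continuous_imp_measurable_on_sets_lebesgue continuous_intros) auto
  show "(\<lambda>r. r powr x * \<omega> r) \<in> borel_measurable (lebesgue_on {0..<1})"
    by measurable
  show "AE r in lebesgue_on {0..<1}. norm (r powr x * \<omega> r) \<le> norm (\<omega> r)"
  proof (rule AE_I2)
    fix r :: real assume "r \<in> space (lebesgue_on {0..<1})"
    then have "r powr x \<le> 1" using x by (auto intro: powr_le1)
    then show "norm (r powr x * \<omega> r) \<le> norm (\<omega> r)"
      by (simp add: abs_mult mult_left_le_one_le)
  qed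
qed

text \<open>Mass below \<open>r\<close> is dropped, and above it \<open>s powr x\<close> is at least
  \<open>r powr x\<close>. As all tails are positive, moments decay more slowly than every geometric
  sequence.\<close>

lemma moment_lower_bound:
  assumes \<omega>: "radial_weight \<omega>" and x: "0 \<le> x" and r: "r \<in> {0..<1}"
  shows "r powr x * hat \<omega> r \<le> moment \<omega> x"
proof -
  have eq: "hat \<omega> r = (LINT s|lebesgue_on {0..<1}. indicator {r..<1} s * \<omega> s)"
    unfolding hat_def set_lebesgue_integral_def using r
    by (subst integral_restrict_space) (auto intro!: Bochner_Integration.integral_cong split: split_indicator)
  have int: "integrable (lebesgue_on {0..<1}) (\<lambda>s. indicator {r..<1} s * \<omega> s)"
  proof (rule Bochner_Integration.integrable_bound[OF radial_weight_integrable[OF \<omega>]])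
    note [measurable] = radial_weight_measurable[OF \<omega>]
    have [measurable]: "{r..<1} \<in> sets (lebesgue_on {0..<1})"
      using r by (auto simp: sets_restrict_space_iff)
    show "(\<lambda>s. indicator {r..<1} s * \<omega> s) \<in> borel_measurable (lebesgue_on {0..<1})" by measurable
  qed (auto split: split_indicator)
  have "r powr x * hat \<omega> r = (LINT s|lebesgue_on {0..<1}. r powr x * (indicator {r..<1} s * \<omega> s))"
    unfolding eq using int by (subst integral_mult_right_zero) auto
  also have "\<dots> \<le> (LINT s|lebesgue_on {0..<1}. s powr x * \<omega> s)"
  proof (rule integral_mono[OF integrable_mult_right[OF int] radial_weight_integrable_moment[OF \<omega> x]])
    fix s :: real assume "s \<in> space (lebesgue_on {0..<1})"
    then have "0 \<le> \<omega> s" using \<omega> by (auto simp: radial_weight_def)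
    then show "r powr x * (indicator {r..<1} s * \<omega> s) \<le> s powr x * \<omega> s"
      using r x by (auto split: split_indicator intro!: mult_right_mono powr_mono2)
  qed
  also have "\<dots> = moment \<omega> x"
    unfolding moment_def set_lebesgue_integral_def by (subst integral_restrict_space) auto
  finally show ?thesis .
qed

lemma moment_pos:
  assumes "radial_weight \<omega>" "0 \<le> x"
  shows "0 < moment \<omega> x"
proof -
  have "0 < (1/2) powr x * hat \<omega> (1/2)"
    using assms by (auto simp: radial_weight_def)
  then show ?thesis using moment_lower_bound[OF assms, of "1/2"] by simp
qed

text \<open>The squared norm of \<open>z ^ n\<close> in the space \<open>A^2\<close> of \<omega>,
  hence the denominator in \<open>bkernel\<close>.\<close>

definition even_moment :: "(real \<Rightarrow> real) \<Rightarrow> nat \<Rightarrow> real" where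
  "even_moment \<omega> n = 2 * moment \<omega> (2 * real n + 1)"

lemma even_moment_pos: "radial_weight \<omega> \<Longrightarrow> 0 < even_moment \<omega> n"
  using moment_pos[of \<omega> "2 * real n + 1"] by (simp add: even_moment_def)

lemma summable_power_even_moment:
  assumes \<omega>: "radial_weight \<omega>" and x: "0 \<le> x" "x < 1"
  shows "summable (\<lambda>n. x ^ n / even_moment \<omega> n)"
proof -
  obtain t where t: "x < t" "t < 1" using dense[OF x(2)] by auto
  \<comment> \<open>The moments have odd order \<open>2 n + 1\<close>, so the tail beyond
    \<open>sqrt t\<close> bounds them below by a multiple of \<open>t ^ n\<close>, and
    \<open>x < t\<close> leaves a convergent geometric series.\<close>
  define r where "r = sqrt t"
  have r: "0 < r" "r < 1" "r^2 = t" using t x by (auto simp: r_def)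
  define h where "h = r * hat \<omega> r"
  have h: "0 < h" using \<omega> r by (auto simp: h_def radial_weight_def)
  have low: "t ^ n * h \<le> even_moment \<omega> n" for n
  proof -
    have "r powr (2 * real n + 1) = r ^ (2 * n + 1)"
      using r by (subst powr_realpow[symmetric]) (auto simp: add.commute)
    also have "\<dots> = t ^ n * r" using r(3) by (simp add: power_mult)
    finally have "t ^ n * h \<le> moment \<omega> (2 * real n + 1)"
      using moment_lower_bound[OF \<omega>, of "2 * real n + 1" r] r by (simp add: h_def mult.assoc)
    moreover have "0 \<le> moment \<omega> (2 * real n + 1)"
      using moment_pos[OF \<omega>, of "2 * real n + 1"] by simp
    ultimately show ?thesis by (simp add: even_moment_def)
  qed
  show ?thesis
  proof (rule summable_comparison_test')
    show "summable (\<lambda>n. (x / t) ^ n * (1 / h))"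
      using t x by (intro summable_mult2 summable_geometric) auto
    fix n
    have "x ^ n / even_moment \<omega> n \<le> x ^ n / (t ^ n * h)"
      using low[of n] t x h by (intro divide_left_mono) (auto intro!: mult_pos_pos even_moment_pos[OF \<omega>])
    then show "norm (x ^ n / even_moment \<omega> n) \<le> (x / t) ^ n * (1 / h)"
      using x even_moment_pos[OF \<omega>, of n] by (simp add: power_divide abs_of_pos)
  qed
qed

lemma even_moment_eq_integral:
  assumes \<omega>: "radial_weight \<omega>"
  shows "(\<integral>z. cmod z ^ (2 * n) * \<omega> (cmod z) \<partial>dA) = even_moment \<omega> n"
proof -
  note [measurable] = radial_weight_measurable[OF \<omega>] radial_weight_measurable_dA[OF \<omega>]
  have [measurable]: "(\<lambda>r::real. r) \<in> borel_measurable (lebesgue_on {0..<1})"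
    by (intro continuous_imp_measurable_on_sets_lebesgue continuous_intros) auto
  have nonneg: "0 \<le> \<omega> r" if "r \<in> {0..<1}" for r
    using \<omega> that by (auto simp: radial_weight_def)
  have "(\<integral>z. cmod z ^ (2 * n) * \<omega> (cmod z) \<partial>dA) = enn2real (\<integral>\<^sup>+z. ennreal (cmod z ^ (2 * n) * \<omega> (cmod z)) \<partial>dA)"
    by (rule integral_eq_nn_integral) (auto simp: radial_weight_nonneg[OF \<omega>])
  also have "(\<integral>\<^sup>+z. ennreal (cmod z ^ (2 * n) * \<omega> (cmod z)) \<partial>dA)
      = (\<integral>\<^sup>+r. ennreal (2 * r) * ennreal (r ^ (2 * n) * \<omega> r) \<partial>lebesgue_on {0..<1})"
    by (rule nn_integral_dA_radial) measurable
  also have "\<dots> = (\<integral>\<^sup>+r. ennreal (2 * (r powr (2 * real n + 1) * \<omega> r)) \<partial>lebesgue_on {0..<1})"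
  proof (rule nn_integral_cong)
    fix r :: real assume r: "r \<in> space (lebesgue_on {0..<1})"
    have "r powr (2 * real n + 1) = r ^ (2 * n + 1)"
    proof (cases "r = 0")
      case False
      then show ?thesis using r by (subst powr_realpow[symmetric]) (auto simp: add.commute)
    qed simp
    then show "ennreal (2 * r) * ennreal (r ^ (2 * n) * \<omega> r) = ennreal (2 * (r powr (2 * real n + 1) * \<omega> r))"
      using r nonneg[of r] by (subst ennreal_mult[symmetric]) (auto simp: algebra_simps)
  qed
  also have "enn2real \<dots> = (LINT r|lebesgue_on {0..<1}. 2 * (r powr (2 * real n + 1) * \<omega> r))"
    by (rule integral_eq_nn_integral[symmetric]) (auto simp: nonneg)
  also have "\<dots> = 2 * (LINT r|lebesgue_on {0..<1}. r powr (2 * real n + 1) * \<omega> r)"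
    by (rule integral_mult_right_zero)
  also have "\<dots> = even_moment \<omega> n"
    unfolding even_moment_def moment_def set_lebesgue_integral_def
    by (subst integral_restrict_space) auto
  finally show ?thesis .
qed

text \<open>A nonintegrable function has Bochner integral 0 by convention, whereas the integral in
  question is \<open>even_moment \<omega> 0\<close> and hence positive.\<close>

lemma radial_weight_integrable_dA:
  assumes \<omega>: "radial_weight \<omega>"
  shows "integrable dA (\<lambda>z. \<omega> (cmod z))"
proof (rule ccontr)
  assume "\<not> integrable dA (\<lambda>z. \<omega> (cmod z))"
  then have "even_moment \<omega> 0 = 0"
    using even_moment_eq_integral[OF \<omega>, of 0] by (simp add: not_integrable_integral_eq)
  then show False using even_moment_pos[OF \<omega>, of 0] by simp
qed

section \<open>Taylor coefficients read off from the pairing\<close>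

definition weight_coeff :: "(real \<Rightarrow> real) \<Rightarrow> (complex \<Rightarrow> complex) \<Rightarrow> nat \<Rightarrow> complex" where
  "weight_coeff \<omega> u n = pairing \<omega> u (\<lambda>z. z ^ n) / of_real (even_moment \<omega> n)"

text \<open>As monomials are bounded on the disc, this condition makes every
  \<open>weight_coeff\<close> a genuine integral rather than a default value.\<close>

definition weight_integrable :: "(real \<Rightarrow> real) \<Rightarrow> (complex \<Rightarrow> complex) \<Rightarrow> bool" where
  "weight_integrable \<omega> u \<longleftrightarrow> integrable dA (\<lambda>z. u z * of_real (\<omega> (cmod z)))"

lemma pairing_cnj: "pairing \<omega> g u = cnj (pairing \<omega> u g)"
  unfolding pairing_def Bochner_Integration.integral_cnj[symmetric] by (simp add: mult.commute mult.left_commute)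

lemma weight_integrable_mult_bounded:
  assumes u: "weight_integrable \<omega> u" and g: "g \<in> borel_measurable dA" and b: "\<And>z. z \<in> disc \<Longrightarrow> cmod (g z) \<le> B"
  shows "integrable dA (\<lambda>z. u z * g z * of_real (\<omega> (cmod z)))"
proof (rule Bochner_Integration.integrable_bound)
  show "integrable dA (\<lambda>z. B * norm (u z * of_real (\<omega> (cmod z))))"
    using u by (simp add: weight_integrable_def)
  have "(\<lambda>z. u z * of_real (\<omega> (cmod z)) * g z) \<in> borel_measurable dA"
    using u g unfolding weight_integrable_def by measurable
  then show "(\<lambda>z. u z * g z * of_real (\<omega> (cmod z))) \<in> borel_measurable dA"
    by (simp add: mult.assoc mult.commute[of "g _"])
  show "AE z in dA. norm (u z * g z * of_real (\<omega> (cmod z))) \<le> norm (B * norm (u z * of_real (\<omega> (cmod z))))"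
  proof (rule AE_I2)
    fix z assume z: "z \<in> space dA"
    have "norm (u z * g z * of_real (\<omega> (cmod z))) = cmod (g z) * norm (u z * of_real (\<omega> (cmod z)))"
      by (simp add: norm_mult)
    also have "\<dots> \<le> B * norm (u z * of_real (\<omega> (cmod z)))"
      using b z by (intro mult_right_mono) auto
    finally show "norm (u z * g z * of_real (\<omega> (cmod z))) \<le> norm (B * norm (u z * of_real (\<omega> (cmod z))))"
      by simp
  qed
qed

lemma power_norm_le1: "z \<in> disc \<Longrightarrow> cmod (z ^ n) \<le> 1"
  by (simp add: disc_def norm_power power_le_one)

lemma weight_integrable_mult_cnj_power:
  assumes "weight_integrable \<omega> u"
  shows "integrable dA (\<lambda>z. u z * cnj (z ^ n) * of_real (\<omega> (cmod z)))"
  by (rule weight_integrable_mult_bounded[OF assms, where B = 1])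
     (auto simp: power_norm_le1 simp del: complex_cnj_power)

text \<open>\<open>u\<close> enters only through its coefficients below \<open>N\<close>. The sum is
  symmetric up to conjugation, which later yields the adjoint, and it matches the expansion of a
  functional on Fejer means.\<close>

lemma pairing_fejer:
  assumes \<omega>: "radial_weight \<omega>" and u: "weight_integrable \<omega> u"
  shows "pairing \<omega> u (fejer b N)
    = (\<Sum>n<N. of_real (1 - real n / real N) * cnj (b n) * weight_coeff \<omega> u n * of_real (even_moment \<omega> n))"
proof -
  have "pairing \<omega> u (fejer b N)
      = (\<integral>z. (\<Sum>n<N. of_real (1 - real n / real N) * cnj (b n) * (u z * cnj (z ^ n) * of_real (\<omega> (cmod z)))) \<partial>dA)"
    unfolding pairing_def fejer_def by (simp add: sum_distrib_left sum_distrib_right algebra_simps)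
  also have "\<dots> = (\<Sum>n<N. of_real (1 - real n / real N) * cnj (b n) * pairing \<omega> u (\<lambda>z. z ^ n))"
    unfolding pairing_def using weight_integrable_mult_cnj_power[OF u]
    by (subst Bochner_Integration.integral_sum) auto
  also have "\<dots> = (\<Sum>n<N. of_real (1 - real n / real N) * cnj (b n) * weight_coeff \<omega> u n * of_real (even_moment \<omega> n))"
    using even_moment_pos[OF \<omega>] by (intro sum.cong refl) (auto simp: weight_coeff_def less_le)
  finally show ?thesis .
qed

lemma weight_integrable_bounded:
  assumes \<omega>: "radial_weight \<omega>" and g: "g \<in> borel_measurable dA" and b: "\<And>z. z \<in> disc \<Longrightarrow> cmod (g z) \<le> B"
  shows "weight_integrable \<omega> g"
proof -
  have "weight_integrable \<omega> (\<lambda>_. 1)"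
    using radial_weight_integrable_dA[OF \<omega>] by (simp add: weight_integrable_def)
  from weight_integrable_mult_bounded[OF this g b] show ?thesis
    by (simp add: weight_integrable_def)
qed

text \<open>On the diagonal this is a moment. Off it, rotation through \<open>pi / (m - n)\<close>
  changes the sign of the integrand, so the integral equals its own negative and no angular
  integration is needed.\<close>

lemma pairing_monomials:
  assumes \<omega>: "radial_weight \<omega>"
  shows "pairing \<omega> (\<lambda>z. z ^ m) (\<lambda>z. z ^ n) = (if m = n then of_real (even_moment \<omega> n) else 0)"
proof (cases "m = n")
  case True
  have *: "z ^ n * cnj (z ^ n) * of_real (\<omega> (cmod z)) = of_real (cmod z ^ (2 * n) * \<omega> (cmod z))" for z
    unfolding complex_norm_square[symmetric] by (simp add: norm_power power_mult[symmetric] mult.commute)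
  then show ?thesis
    unfolding pairing_def True * integral_complex_of_real even_moment_eq_integral[OF \<omega>] by simp
next
  case False
  define F where "F z = z ^ m * cnj (z ^ n) * of_real (\<omega> (cmod z))" for z
  note [measurable] = radial_weight_measurable_dA[OF \<omega>]
  have F[measurable]: "F \<in> borel_measurable dA"
    unfolding F_def by measurable
  define t where "t = pi / (real m - real n)"
  have eq: "F (cis t * z) = - F z" for z
  proof -
    have "cis t ^ m * cnj (cis t ^ n) = cis (real m * t - real n * t)"
      by (simp add: Complex.DeMoivre cis_cnj cis_mult)
    also have "real m * t - real n * t = (real m - real n) * t"
      by (rule left_diff_distrib[symmetric])
    also have "\<dots> = pi"
      using False by (simp add: t_def)
    finally have "cis t ^ m * cnj (cis t ^ n) = -1" by simp
    moreover have "F (cis t * z) = (cis t ^ m * cnj (cis t ^ n)) * F z"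
      by (simp add: F_def norm_mult power_mult_distrib algebra_simps)
    ultimately show ?thesis by simp
  qed
  have "(\<integral>z. F z \<partial>dA) = (\<integral>z. F (cis t * z) \<partial>dA)"
    by (rule integral_dA_rotation[symmetric]) auto
  also have "\<dots> = - (\<integral>z. F z \<partial>dA)"
    by (simp add: eq)
  finally have "(\<integral>z. F z \<partial>dA) = 0"
    by (simp add: eq_neg_iff_add_eq_0)
  then show ?thesis using False by (simp add: pairing_def F_def)
qed

lemma weight_coeff_fejer:
  assumes \<omega>: "radial_weight \<omega>"
  shows "weight_coeff \<omega> (fejer a N) n = (if n < N then of_real (1 - real n / real N) * a n else 0)"
proof -
  have "weight_integrable \<omega> (\<lambda>z. z ^ n)"
    by (rule weight_integrable_bounded[OF \<omega> _ power_norm_le1]) auto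
  from pairing_fejer[OF \<omega> this, of a N]
  have "cnj (pairing \<omega> (fejer a N) (\<lambda>z. z ^ n))
      = (\<Sum>k<N. of_real (1 - real k / real N) * cnj (a k) * (if k = n then 1 else 0) * of_real (even_moment \<omega> k))"
    using even_moment_pos[OF \<omega>] pairing_cnj[of \<omega> "\<lambda>z. z ^ n" "fejer a N"]
    by (auto simp: weight_coeff_def pairing_monomials[OF \<omega>] less_le intro!: sum.cong)
  also have "\<dots> = (\<Sum>k<N. if k = n then of_real (1 - real n / real N) * cnj (a n) * of_real (even_moment \<omega> n) else 0)"
    by (intro sum.cong refl) auto
  also have "\<dots> = (if n < N then of_real (1 - real n / real N) * cnj (a n) * of_real (even_moment \<omega> n) else 0)"
    by (subst sum.delta) auto
  finally have "pairing \<omega> (fejer a N) (\<lambda>z. z ^ n)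
      = cnj (if n < N then of_real (1 - real n / real N) * cnj (a n) * of_real (even_moment \<omega> n) else 0)"
    by (metis complex_cnj_cnj)
  then show ?thesis
    using even_moment_pos[OF \<omega>, of n] by (auto simp: weight_coeff_def less_le)
qed

lemma fejer_multiplier_tendsto: "(\<lambda>N. if n < N then of_real (1 - real n / real N) * c else 0) \<longlonglongrightarrow> (c :: complex)"
proof -
  have "(\<lambda>N. of_real (1 - real n / real N) * c) \<longlonglongrightarrow> of_real (1 - 0) * c"
    by (intro tendsto_intros lim_const_over_n)
  moreover have "eventually (\<lambda>N. of_real (1 - real n / real N) * c = (if n < N then of_real (1 - real n / real N) * c else 0)) sequentially"
    using eventually_gt_at_top[of n] by eventually_elim simp
  ultimately show ?thesis
    using Lim_transform_eventually by fastforce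
qed

text \<open>The Taylor series of \<open>f\<close> need not converge in the weighted
  \<open>L^1\<close> space, so it cannot simply be integrated term by term. The Fejer means do
  converge there, their coefficients are explicit, and their multipliers tend to 1.\<close>

lemma weight_coeff_taylor:
  assumes \<omega>: "radial_weight \<omega>" and f: "weight_integrable \<omega> f" and a: "taylor_on_disc f a"
  shows "weight_coeff \<omega> f n = a n"
proof -
  note [measurable] = radial_weight_measurable_dA[OF \<omega>] holomorphic_on_disc_measurable[OF taylor_on_disc_holomorphic[OF a]]
  define \<eta> where "\<eta> r = ennreal (\<omega> r)" for r
  have \<eta>: "\<eta> \<in> borel_measurable (lebesgue_on {0..<1})"
    unfolding \<eta>_def using radial_weight_measurable[OF \<omega>] by measurable
  have wint_eq: "wint 1 \<eta> g = (\<integral>\<^sup>+z. ennreal (norm (g z * of_real (\<omega> (cmod z)))) \<partial>dA)" for g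
    unfolding wint_def \<eta>_def using radial_weight_nonneg[OF \<omega>]
    by (intro nn_integral_cong) (auto simp: ennreal_mult[symmetric] norm_mult)
  have fin: "wint 1 \<eta> f < \<infinity>"
    using f unfolding wint_eq weight_integrable_def integrable_iff_bounded by auto
  have fej: "weight_integrable \<omega> (fejer a N)" for N
  proof -
    have "integrable dA (\<lambda>z. fejer a N z * of_real (\<omega> (cmod z)))"
      using wint_fejer_le[OF order_refl \<eta> a, of N] fin unfolding wint_eq integrable_iff_bounded
      by auto
    then show ?thesis by (simp add: weight_integrable_def)
  qed
  have diff: "ennreal (cmod (pairing \<omega> (fejer a N) (\<lambda>z. z ^ n) - pairing \<omega> f (\<lambda>z. z ^ n)))
      \<le> wint 1 \<eta> (\<lambda>z. fejer a N z - f z)" for N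
  proof -
    note ints = weight_integrable_mult_cnj_power[OF fej[of N], of n] weight_integrable_mult_cnj_power[OF f, of n]
    have eq: "(fejer a N z - f z) * cnj (z ^ n) * of_real (\<omega> (cmod z))
        = fejer a N z * cnj (z ^ n) * of_real (\<omega> (cmod z)) - f z * cnj (z ^ n) * of_real (\<omega> (cmod z))" for z
      by (simp only: left_diff_distrib)
    have "pairing \<omega> (fejer a N) (\<lambda>z. z ^ n) - pairing \<omega> f (\<lambda>z. z ^ n)
        = (\<integral>z. (fejer a N z - f z) * cnj (z ^ n) * of_real (\<omega> (cmod z)) \<partial>dA)"
      unfolding pairing_def eq by (rule Bochner_Integration.integral_diff[symmetric, OF ints])
    also have "ennreal (cmod \<dots>) \<le> (\<integral>\<^sup>+z. ennreal (norm ((fejer a N z - f z) * cnj (z ^ n) * of_real (\<omega> (cmod z)))) \<partial>dA)"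
      unfolding eq by (rule integral_norm_bound_ennreal[OF Bochner_Integration.integrable_diff[OF ints]])
    also have "\<dots> \<le> wint 1 \<eta> (\<lambda>z. fejer a N z - f z)"
      unfolding wint_eq
    proof (intro nn_integral_mono ennreal_leI)
      fix z assume "z \<in> space dA"
      then have "cmod (z ^ n) \<le> 1" by (simp add: power_norm_le1)
      then have "cmod (fejer a N z - f z) * cmod (z ^ n) \<le> cmod (fejer a N z - f z) * 1"
        by (intro mult_left_mono) auto
      then have "cmod (fejer a N z - f z) * cmod (z ^ n) * \<bar>\<omega> (cmod z)\<bar> \<le> cmod (fejer a N z - f z) * \<bar>\<omega> (cmod z)\<bar>"
        by (intro mult_right_mono) auto
      then show "norm ((fejer a N z - f z) * cnj (z ^ n) * of_real (\<omega> (cmod z))) \<le> norm ((fejer a N z - f z) * of_real (\<omega> (cmod z)))"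
        unfolding norm_mult complex_mod_cnj norm_of_real .
    qed
    finally show ?thesis .
  qed
  have "(\<lambda>N. ennreal (cmod (pairing \<omega> (fejer a N) (\<lambda>z. z ^ n) - pairing \<omega> f (\<lambda>z. z ^ n)))) \<longlonglongrightarrow> 0"
    by (rule tendsto_sandwich[OF always_eventually always_eventually tendsto_const wint_fejer_tendsto[OF order_refl \<eta> a fin]])
       (simp_all only: zero_le diff simp_thms)
  then have "(\<lambda>N. cmod (pairing \<omega> (fejer a N) (\<lambda>z. z ^ n) - pairing \<omega> f (\<lambda>z. z ^ n))) \<longlonglongrightarrow> 0"
    by (rule iffD1[OF ennreal_tendsto_0_iff, rotated]) (rule norm_ge_zero)
  then have "(\<lambda>N. pairing \<omega> (fejer a N) (\<lambda>z. z ^ n)) \<longlonglongrightarrow> pairing \<omega> f (\<lambda>z. z ^ n)"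
    by (rule LIM_zero_cancel[OF tendsto_norm_zero_cancel])
  then have "(\<lambda>N. weight_coeff \<omega> (fejer a N) n) \<longlonglongrightarrow> weight_coeff \<omega> f n"
    unfolding weight_coeff_def using even_moment_pos[OF \<omega>, of n] by (intro tendsto_divide tendsto_const) auto
  then have "(\<lambda>N. if n < N then of_real (1 - real n / real N) * a n else 0) \<longlonglongrightarrow> weight_coeff \<omega> f n"
    by (simp only: weight_coeff_fejer[OF \<omega>])
  from LIMSEQ_unique[OF this fejer_multiplier_tendsto] show ?thesis .
qed

text \<open>For fixed \<open>z\<close> the \<open>n\<close>-th term of the kernel is at most
  \<open>q n\<close>, uniformly in \<zeta>, and \<open>q\<close> is summable; so termwise
  integration costs only integrability of \<open>u\<close> against \<omega>.\<close>

lemma bproj_series: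
  assumes \<omega>: "radial_weight \<omega>" and u: "weight_integrable \<omega> u" and z: "z \<in> disc"
  shows "integrable dA (\<lambda>\<zeta>. u \<zeta> * cnj (bkernel \<omega> z \<zeta>) * of_real (\<omega> (cmod \<zeta>)))"
    and "(\<lambda>n. weight_coeff \<omega> u n * z ^ n) sums bproj \<omega> u z"
proof -
  define T where "T n \<zeta> = z ^ n / of_real (even_moment \<omega> n) * (u \<zeta> * cnj (\<zeta> ^ n) * of_real (\<omega> (cmod \<zeta>)))" for n \<zeta>
  define q where "q n = cmod z ^ n / even_moment \<omega> n" for n
  have q: "summable q"
    unfolding q_def using z by (intro summable_power_even_moment[OF \<omega>]) (auto simp: disc_def)
  have q0: "0 \<le> q n" for n
    using even_moment_pos[OF \<omega>, of n] by (simp add: q_def)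
  have normT: "norm (T n \<zeta>) \<le> q n * norm (u \<zeta> * of_real (\<omega> (cmod \<zeta>)))" if "\<zeta> \<in> disc" for n \<zeta>
  proof -
    have "norm (T n \<zeta>) = q n * (cmod (\<zeta> ^ n) * norm (u \<zeta> * of_real (\<omega> (cmod \<zeta>))))"
      using even_moment_pos[OF \<omega>, of n]
      by (simp add: T_def q_def norm_mult norm_divide norm_power algebra_simps)
    also have "\<dots> \<le> q n * norm (u \<zeta> * of_real (\<omega> (cmod \<zeta>)))"
      using power_norm_le1[OF that, of n] q0 by (intro mult_left_mono mult_left_le_one_le) auto
    finally show ?thesis .
  qed
  have T_int: "integrable dA (T n)" for n
    unfolding T_def using weight_integrable_mult_cnj_power[OF u] by (intro integrable_mult_right)
  have AE: "AE \<zeta> in dA. summable (\<lambda>n. norm (T n \<zeta>))"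
  proof (rule AE_I2)
    fix \<zeta> assume "\<zeta> \<in> space dA"
    then show "summable (\<lambda>n. norm (T n \<zeta>))"
      by (intro summable_comparison_test'[OF summable_mult2[OF q, of "norm (u \<zeta> * of_real (\<omega> (cmod \<zeta>)))"], where N = 0])
         (simp only: real_norm_def abs_norm_cancel space_dA normT)
  qed
  have sum_int: "summable (\<lambda>n. \<integral>\<zeta>. norm (T n \<zeta>) \<partial>dA)"
  proof (rule summable_comparison_test'[where N = 0])
    show "summable (\<lambda>n. q n * (\<integral>\<zeta>. norm (u \<zeta> * of_real (\<omega> (cmod \<zeta>))) \<partial>dA))"
      using summable_mult2[OF q] .
    fix n
    have "(\<integral>\<zeta>. norm (T n \<zeta>) \<partial>dA) \<le> (\<integral>\<zeta>. q n * norm (u \<zeta> * of_real (\<omega> (cmod \<zeta>))) \<partial>dA)"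
      using u T_int normT by (intro integral_mono) (auto simp: weight_integrable_def simp del: norm_mult)
    then show "norm (\<integral>\<zeta>. norm (T n \<zeta>) \<partial>dA) \<le> q n * (\<integral>\<zeta>. norm (u \<zeta> * of_real (\<omega> (cmod \<zeta>))) \<partial>dA)"
      by simp
  qed
  have sumT: "(\<Sum>n. T n \<zeta>) = u \<zeta> * cnj (bkernel \<omega> z \<zeta>) * of_real (\<omega> (cmod \<zeta>))" if \<zeta>: "\<zeta> \<in> disc" for \<zeta>
  proof -
    define k where "k n = (cnj z * \<zeta>) ^ n / complex_of_real (even_moment \<omega> n)" for n
    have "summable k"
    proof (rule summable_norm_cancel, rule summable_comparison_test'[where N = 0, OF q])
      fix n
      show "norm (norm (k n)) \<le> q n"
        using even_moment_pos[OF \<omega>, of n] power_norm_le1[OF \<zeta>, of n]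
        by (auto simp: k_def q_def norm_divide norm_mult norm_power power_mult_distrib intro!: divide_right_mono mult_right_le_one_le)
    qed
    then have "k sums bkernel \<omega> z \<zeta>"
      unfolding bkernel_def k_def even_moment_def by (rule summable_sums)
    then have "(\<lambda>n. u \<zeta> * of_real (\<omega> (cmod \<zeta>)) * cnj (k n)) sums (u \<zeta> * of_real (\<omega> (cmod \<zeta>)) * cnj (bkernel \<omega> z \<zeta>))"
      by (intro sums_mult) (simp add: sums_cnj)
    moreover have "u \<zeta> * of_real (\<omega> (cmod \<zeta>)) * cnj (k n) = T n \<zeta>" for n
      by (simp add: k_def T_def power_mult_distrib)
    ultimately show ?thesis by (simp add: sums_iff mult.commute mult.left_commute)
  qed
  show "integrable dA (\<lambda>\<zeta>. u \<zeta> * cnj (bkernel \<omega> z \<zeta>) * of_real (\<omega> (cmod \<zeta>)))"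
    using integrable_suminf[OF T_int AE sum_int]
    by (subst Bochner_Integration.integrable_cong[OF refl sumT[symmetric]]) auto
  have "(\<lambda>n. \<integral>\<zeta>. T n \<zeta> \<partial>dA) sums (\<integral>\<zeta>. (\<Sum>n. T n \<zeta>) \<partial>dA)"
    by (rule sums_integral[OF T_int AE sum_int])
  moreover have "(\<integral>\<zeta>. T n \<zeta> \<partial>dA) = weight_coeff \<omega> u n * z ^ n" for n
    unfolding T_def weight_coeff_def pairing_def by simp
  moreover have "(\<integral>\<zeta>. (\<Sum>n. T n \<zeta>) \<partial>dA) = bproj \<omega> u z"
    unfolding bproj_def by (rule Bochner_Integration.integral_cong) (auto simp: sumT)
  ultimately show "(\<lambda>n. weight_coeff \<omega> u n * z ^ n) sums bproj \<omega> u z" by simp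
qed

section \<open>Weighted norms and Hoelder's inequality between \<sigma> and \<nu>\<close>

lemma norm_w_wint: "norm_w p \<eta> f = enn2real (wint p \<eta> f) powr (1 / p)"
  by (simp add: norm_w_def wint_def)

lemma Lp_w_iff: "f \<in> Lp_w p \<eta> \<longleftrightarrow> f \<in> borel_measurable dA \<and> wint p \<eta> f < \<infinity>"
  by (simp add: Lp_w_def wint_def)

lemma norm_w_powr:
  assumes "p > 0" "wint p \<eta> f < \<infinity>"
  shows "wint p \<eta> f = ennreal (norm_w p \<eta> f powr p)"
  using assms by (simp add: norm_w_wint powr_powr)

lemma norm_w_nonneg: "0 \<le> norm_w p \<eta> f"
  by (simp add: norm_w_wint)

lemma sigma_w_measurable:
  assumes "radial_weight \<omega>" "radial_weight \<nu>"
  shows "sigma_w p \<omega> \<nu> \<in> borel_measurable (lebesgue_on {0..<1})"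
proof -
  note [measurable] = assms[THEN radial_weight_measurable]
  show ?thesis unfolding sigma_w_def[abs_def] by measurable
qed

text \<open>Young's inequality for the factors \<open>x * (\<omega> r / c)\<close> and
  \<open>y * c\<close> with \<open>c = \<nu> r powr (1 / p)\<close>. If \<nu> vanishes and \<omega>
  does not, \<sigma> is infinite and the right side is too, unless \<open>x = 0\<close>.\<close>

lemma young_sigma_w:
  assumes p: "1 < p" and "0 \<le> x" "0 \<le> y" "0 \<le> \<omega> r" "0 \<le> \<nu> r"
  shows "ennreal (x * y * \<omega> r)
    \<le> ennreal (x powr conj_exp p / conj_exp p) * sigma_w p \<omega> \<nu> r + ennreal (y powr p / p) * ennreal (\<nu> r)"
proof -
  define q where "q = conj_exp p"
  have q: "1 < q" "1 / q + 1 / p = 1"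
    using p by (auto simp: q_def conj_exp_def field_simps)
  show ?thesis
  proof (cases "\<nu> r = 0")
    case True
    then show ?thesis
      using q assms by (cases "x = 0") (auto simp: sigma_w_def q_def ennreal_mult_top)
  next
    case False
    define c where "c = \<nu> r powr (1 / p)"
    have c: "0 < c" "c powr p = \<nu> r"
      using False assms by (auto simp: c_def powr_powr)
    have "x * y * \<omega> r = (x * (\<omega> r / c)) * (y * c)"
      using c by simp
    also have "\<dots> \<le> (x * (\<omega> r / c)) powr q / q + (y * c) powr p / p"
      using c assms q by (intro Youngs_inequality) auto
    also have "\<dots> = x powr q / q * (\<omega> r / c) powr q + y powr p / p * \<nu> r"
      unfolding powr_mult[of x "\<omega> r / c" q] powr_mult[of y c p] using c by simp
    finally have "ennreal (x * y * \<omega> r) \<le> ennreal (x powr q / q * (\<omega> r / c) powr q + y powr p / p * \<nu> r)"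
      by (rule ennreal_leI)
    also have "\<dots> = ennreal (x powr q / q * (\<omega> r / c) powr q) + ennreal (y powr p / p * \<nu> r)"
      using q p assms by (intro ennreal_plus) auto
    also have "ennreal (x powr q / q * (\<omega> r / c) powr q) = ennreal (x powr q / q) * ennreal ((\<omega> r / c) powr q)"
      using q by (intro ennreal_mult) auto
    also have "ennreal (y powr p / p * \<nu> r) = ennreal (y powr p / p) * ennreal (\<nu> r)"
      using p assms by (intro ennreal_mult) auto
    finally show ?thesis
      using False by (simp add: sigma_w_def q_def c_def)
  qed
qed

lemma holder_sigma_w:
  assumes p: "1 < p" and \<omega>: "radial_weight \<omega>" and \<nu>: "radial_weight \<nu>"
    and f: "f \<in> Lp_w (conj_exp p) (sigma_w p \<omega> \<nu>)" and g: "g \<in> Lp_w p (\<lambda>r. ennreal (\<nu> r))"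
  shows "integrable dA (\<lambda>z. f z * cnj (g z) * of_real (\<omega> (cmod z)))"
    and "cmod (pairing \<omega> f g) \<le> norm_w (conj_exp p) (sigma_w p \<omega> \<nu>) f * norm_w p (\<lambda>r. ennreal (\<nu> r)) g"
proof -
  define q where "q = conj_exp p"
  have q: "1 < q" "1 / q + 1 / p = 1"
    using p by (auto simp: q_def conj_exp_def field_simps)
  define \<sigma> where "\<sigma> = sigma_w p \<omega> \<nu>"
  have [measurable]: "f \<in> borel_measurable dA" "g \<in> borel_measurable dA"
    using f g by (auto simp: Lp_w_iff)
  note [measurable] = radial_weight_measurable_dA[OF \<omega>] radial_weight_measurable_dA[OF \<nu>]
    radial_measurable[OF sigma_w_measurable[OF \<omega> \<nu>, of p], folded \<sigma>_def]
  define A where "A = enn2real (wint q \<sigma> f)"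
  define B where "B = enn2real (wint p (\<lambda>r. ennreal (\<nu> r)) g)"
  have A: "wint q \<sigma> f = ennreal A" "0 \<le> A"
    using f by (auto simp: A_def Lp_w_iff q_def \<sigma>_def)
  have B: "wint p (\<lambda>r. ennreal (\<nu> r)) g = ennreal B" "0 \<le> B"
    using g by (auto simp: B_def Lp_w_iff)
  define I where "I = (\<integral>\<^sup>+z. ennreal (cmod (f z) * cmod (g z) * \<omega> (cmod z)) \<partial>dA)"
  \<comment> \<open>The functions are normalised by their norms; the shift by \<open>e\<close> keeps
    the divisors positive when a norm vanishes and is removed by letting \<open>e\<close> tend to
    0.\<close>
  have bound: "I \<le> ennreal ((A + e) powr (1 / q) * (B + e) powr (1 / p))" if e: "e > 0" for e
  proof -
    have Ae: "0 < A + e" "0 < B + e" using A B e by auto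
    define a where "a = (A + e) powr (1 / q)"
    define b where "b = (B + e) powr (1 / p)"
    have ab: "0 < a" "0 < b" "a powr q = A + e" "b powr p = B + e"
      using A B e p q by (auto simp: a_def b_def powr_powr)
    have "I = (\<integral>\<^sup>+z. ennreal (a * b) * ennreal ((cmod (f z) / a) * (cmod (g z) / b) * \<omega> (cmod z)) \<partial>dA)"
      unfolding I_def using ab radial_weight_nonneg[OF \<omega>]
      by (intro nn_integral_cong) (auto simp: ennreal_mult[symmetric])
    also have "\<dots> = ennreal (a * b) * (\<integral>\<^sup>+z. ennreal ((cmod (f z) / a) * (cmod (g z) / b) * \<omega> (cmod z)) \<partial>dA)"
      by (rule nn_integral_cmult) measurable
    finally have I_eq: "I = ennreal (a * b) * (\<integral>\<^sup>+z. ennreal ((cmod (f z) / a) * (cmod (g z) / b) * \<omega> (cmod z)) \<partial>dA)" .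
    have "(\<integral>\<^sup>+z. ennreal ((cmod (f z) / a) * (cmod (g z) / b) * \<omega> (cmod z)) \<partial>dA)
        \<le> (\<integral>\<^sup>+z. ennreal (1 / (q * (A + e))) * (ennreal (cmod (f z) powr q) * \<sigma> (cmod z))
             + ennreal (1 / (p * (B + e))) * (ennreal (cmod (g z) powr p) * ennreal (\<nu> (cmod z))) \<partial>dA)"
    proof (rule nn_integral_mono)
      fix z assume "z \<in> space dA"
      then have z: "0 \<le> \<omega> (cmod z)" "0 \<le> \<nu> (cmod z)"
        using radial_weight_nonneg[OF \<omega>] radial_weight_nonneg[OF \<nu>] by auto
      have "ennreal ((cmod (f z) / a) * (cmod (g z) / b) * \<omega> (cmod z))
          \<le> ennreal ((cmod (f z) / a) powr q / q) * \<sigma> (cmod z) + ennreal ((cmod (g z) / b) powr p / p) * ennreal (\<nu> (cmod z))"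
        unfolding q_def \<sigma>_def using ab z by (intro young_sigma_w[OF p]) auto
      also have "(cmod (f z) / a) powr q / q = 1 / (q * (A + e)) * cmod (f z) powr q"
        by (simp add: powr_divide ab)
      also have "(cmod (g z) / b) powr p / p = 1 / (p * (B + e)) * cmod (g z) powr p"
        by (simp add: powr_divide ab)
      also have "ennreal (1 / (q * (A + e)) * cmod (f z) powr q) = ennreal (1 / (q * (A + e))) * ennreal (cmod (f z) powr q)"
        using q Ae by (intro ennreal_mult) auto
      also have "ennreal (1 / (p * (B + e)) * cmod (g z) powr p) = ennreal (1 / (p * (B + e))) * ennreal (cmod (g z) powr p)"
        using p Ae by (intro ennreal_mult) auto
      finally show "ennreal ((cmod (f z) / a) * (cmod (g z) / b) * \<omega> (cmod z))
          \<le> ennreal (1 / (q * (A + e))) * (ennreal (cmod (f z) powr q) * \<sigma> (cmod z))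
             + ennreal (1 / (p * (B + e))) * (ennreal (cmod (g z) powr p) * ennreal (\<nu> (cmod z)))"
        by (simp add: mult.assoc)
    qed
    also have "\<dots> = ennreal (1 / (q * (A + e))) * ennreal A + ennreal (1 / (p * (B + e))) * ennreal B"
      unfolding A(1)[symmetric] B(1)[symmetric] wint_def
      by (subst nn_integral_add) (auto simp: nn_integral_cmult)
    also have "\<dots> = ennreal (A / (q * (A + e)) + B / (p * (B + e)))"
    proof -
      have "ennreal (1 / (q * (A + e))) * ennreal A = ennreal (A / (q * (A + e)))"
        using A Ae q by (subst ennreal_mult[symmetric]) auto
      moreover have "ennreal (1 / (p * (B + e))) * ennreal B = ennreal (B / (p * (B + e)))"
        using B Ae p by (subst ennreal_mult[symmetric]) auto
      ultimately show ?thesis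
        using A B Ae p q by (subst ennreal_plus) auto
    qed
    also have "\<dots> \<le> ennreal (1 / q + 1 / p)"
    proof (rule ennreal_leI)
      have "A / (q * (A + e)) \<le> 1 / q" "B / (p * (B + e)) \<le> 1 / p"
        using A B Ae e p q by (simp_all add: divide_le_eq)
      then show "A / (q * (A + e)) + B / (p * (B + e)) \<le> 1 / q + 1 / p" by linarith
    qed
    also have "\<dots> = 1" using q by simp
    finally have "(\<integral>\<^sup>+z. ennreal ((cmod (f z) / a) * (cmod (g z) / b) * \<omega> (cmod z)) \<partial>dA) \<le> 1" .
    from mult_left_mono[OF this, of "ennreal (a * b)"] show ?thesis
      unfolding I_eq by (simp add: a_def b_def)
  qed
  have I_le: "I \<le> ennreal (A powr (1 / q) * B powr (1 / p))"
  proof (rule tendsto_lowerbound)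
    show "((\<lambda>e. ennreal ((A + e) powr (1 / q) * (B + e) powr (1 / p))) \<longlongrightarrow> ennreal (A powr (1 / q) * B powr (1 / p))) (at_right 0)"
    proof (rule tendsto_ennrealI, rule tendsto_mult)
      have lim: "((\<lambda>e. A + e) \<longlongrightarrow> A) (at_right 0)" "((\<lambda>e. B + e) \<longlongrightarrow> B) (at_right 0)"
        by (auto intro!: tendsto_eq_intros)
      have ev: "eventually (\<lambda>e::real. 0 \<le> A + e) (at_right 0)" "eventually (\<lambda>e::real. 0 \<le> B + e) (at_right 0)"
        using A B by (auto simp: eventually_at_right_field intro!: exI[of _ 1])
      show "((\<lambda>e. (A + e) powr (1 / q)) \<longlongrightarrow> A powr (1 / q)) (at_right 0)"
        using lim(1) ev(1) q A by (intro tendsto_powr') auto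
      show "((\<lambda>e. (B + e) powr (1 / p)) \<longlongrightarrow> B powr (1 / p)) (at_right 0)"
        using lim(2) ev(2) p B by (intro tendsto_powr') auto
    qed
    show "eventually (\<lambda>e. I \<le> ennreal ((A + e) powr (1 / q) * (B + e) powr (1 / p))) (at_right 0)"
      using bound by (auto simp: eventually_at_right_field intro!: exI[of _ 1])
  qed simp
  have I_eq: "(\<integral>\<^sup>+z. ennreal (norm (f z * cnj (g z) * of_real (\<omega> (cmod z)))) \<partial>dA) = I"
    unfolding I_def using radial_weight_nonneg[OF \<omega>] by (intro nn_integral_cong) (auto simp: norm_mult)
  show int: "integrable dA (\<lambda>z. f z * cnj (g z) * of_real (\<omega> (cmod z)))"
    unfolding integrable_iff_bounded I_eq
    using I_le le_less_trans[OF I_le ennreal_less_top] by auto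
  have "ennreal (cmod (pairing \<omega> f g)) \<le> ennreal (A powr (1 / q) * B powr (1 / p))"
    unfolding pairing_def using integral_norm_bound_ennreal[OF int] I_le I_eq by (simp add: order_trans)
  then show "cmod (pairing \<omega> f g) \<le> norm_w (conj_exp p) (sigma_w p \<omega> \<nu>) f * norm_w p (\<lambda>r. ennreal (\<nu> r)) g"
    by (simp add: norm_w_wint A_def B_def q_def \<sigma>_def)
qed

section \<open>Duality\<close>

lemma wint_cong: "(\<And>z. z \<in> disc \<Longrightarrow> cmod (f z) = cmod (g z)) \<Longrightarrow> wint p \<eta> f = wint p \<eta> g"
  unfolding wint_def by (intro nn_integral_cong) auto

lemma norm_w_cong: "(\<And>z. z \<in> disc \<Longrightarrow> cmod (f z) = cmod (g z)) \<Longrightarrow> norm_w p \<eta> f = norm_w p \<eta> g"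
  unfolding norm_w_wint by (subst wint_cong[of f g]) auto

lemma norm_w_mono:
  assumes "p > 0" "wint p \<eta> f \<le> wint p \<eta> g" "wint p \<eta> g < \<infinity>"
  shows "norm_w p \<eta> f \<le> norm_w p \<eta> g"
  unfolding norm_w_wint using assms by (intro powr_mono2 enn2real_mono) auto

lemma wint_cmult:
  assumes \<eta>: "\<eta> \<in> borel_measurable (lebesgue_on {0..<1})" and f: "f \<in> borel_measurable dA"
  shows "wint p \<eta> (\<lambda>z. c * f z) = ennreal (cmod c powr p) * wint p \<eta> f"
proof -
  note [measurable] = radial_measurable[OF \<eta>] f
  have "wint p \<eta> (\<lambda>z. c * f z) = (\<integral>\<^sup>+z. ennreal (cmod c powr p) * (ennreal (cmod (f z) powr p) * \<eta> (cmod z)) \<partial>dA)"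
    unfolding wint_def by (intro nn_integral_cong) (simp add: norm_mult powr_mult ennreal_mult mult.assoc)
  also have "\<dots> = ennreal (cmod c powr p) * wint p \<eta> f"
    unfolding wint_def by (rule nn_integral_cmult) measurable
  finally show ?thesis .
qed

lemma norm_w_cmult:
  assumes p: "p > 0" and \<eta>: "\<eta> \<in> borel_measurable (lebesgue_on {0..<1})" and f: "f \<in> borel_measurable dA"
  shows "norm_w p \<eta> (\<lambda>z. c * f z) = cmod c * norm_w p \<eta> f"
  unfolding norm_w_wint wint_cmult[OF \<eta> f] using p
  by (simp add: enn2real_mult powr_mult powr_powr)

lemma wint_bounded_le:
  assumes p: "p > 0" and \<eta>: "\<eta> \<in> borel_measurable (lebesgue_on {0..<1})"
    and B: "\<And>z. z \<in> disc \<Longrightarrow> cmod (f z) \<le> B"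
  shows "wint p \<eta> f \<le> ennreal (B powr p) * wint p \<eta> (\<lambda>_. 1)"
proof -
  note [measurable] = radial_measurable[OF \<eta>]
  have "wint p \<eta> f \<le> (\<integral>\<^sup>+z. ennreal (B powr p) * \<eta> (cmod z) \<partial>dA)"
    unfolding wint_def using p B by (intro nn_integral_mono mult_right_mono ennreal_leI powr_mono2) auto
  also have "\<dots> = ennreal (B powr p) * wint p \<eta> (\<lambda>_. 1)"
    unfolding wint_def by (subst nn_integral_cmult) auto
  finally show ?thesis .
qed

lemma wint_lincomb_less_top:
  assumes p: "p > 0" and \<eta>: "\<eta> \<in> borel_measurable (lebesgue_on {0..<1})"
    and f: "f \<in> borel_measurable dA" "wint p \<eta> f < \<infinity>" and g: "g \<in> borel_measurable dA" "wint p \<eta> g < \<infinity>"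
  shows "wint p \<eta> (\<lambda>z. a * f z + b * g z) < \<infinity>"
proof -
  note [measurable] = radial_measurable[OF \<eta>] f(1) g(1)
  have "wint p \<eta> (\<lambda>z. a * f z + b * g z)
      \<le> (\<integral>\<^sup>+z. ennreal (2 powr p) * (ennreal (cmod (a * f z) powr p) * \<eta> (cmod z) + ennreal (cmod (b * g z) powr p) * \<eta> (cmod z)) \<partial>dA)"
    unfolding wint_def
  proof (rule nn_integral_mono)
    fix z
    have "cmod (a * f z + b * g z) powr p \<le> 2 powr p * (cmod (a * f z) powr p + cmod (b * g z) powr p)"
      using norm_diff_powr_le[OF p, of "a * f z" "- (b * g z)"] by simp
    then have "ennreal (cmod (a * f z + b * g z) powr p) \<le> ennreal (2 powr p * (cmod (a * f z) powr p + cmod (b * g z) powr p))"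
      by (rule ennreal_leI)
    also have "\<dots> = ennreal (2 powr p) * (ennreal (cmod (a * f z) powr p) + ennreal (cmod (b * g z) powr p))"
      by (subst ennreal_mult) auto
    finally show "ennreal (cmod (a * f z + b * g z) powr p) * \<eta> (cmod z)
      \<le> ennreal (2 powr p) * (ennreal (cmod (a * f z) powr p) * \<eta> (cmod z) + ennreal (cmod (b * g z) powr p) * \<eta> (cmod z))"
      by (metis (no_types, lifting) mult_right_mono zero_le distrib_right mult.assoc)
  qed
  also have "\<dots> = ennreal (2 powr p) * (wint p \<eta> (\<lambda>z. a * f z) + wint p \<eta> (\<lambda>z. b * g z))"
    unfolding wint_def by (subst nn_integral_cmult) (auto simp: nn_integral_add)
  also have "\<dots> < \<infinity>"
    using f g by (simp add: wint_cmult[OF \<eta>] ennreal_mult_less_top)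
  finally show ?thesis .
qed

lemma Ap_w_iff: "f \<in> Ap_w p \<eta> \<longleftrightarrow> f holomorphic_on disc \<and> wint p \<eta> f < \<infinity>"
  using holomorphic_on_disc_measurable by (auto simp: Ap_w_def Lp_w_iff)

lemma Ap_w_measurable: "f \<in> Ap_w p \<eta> \<Longrightarrow> f \<in> borel_measurable dA"
  by (simp add: Ap_w_def Lp_w_iff)

lemma Ap_w_lincomb:
  assumes p: "p > 0" and \<eta>: "\<eta> \<in> borel_measurable (lebesgue_on {0..<1})"
    and "f \<in> Ap_w p \<eta>" "g \<in> Ap_w p \<eta>"
  shows "(\<lambda>z. a * f z + b * g z) \<in> Ap_w p \<eta>"
  using assms wint_lincomb_less_top[OF p \<eta>, of f g a b]
  by (auto simp: Ap_w_iff holomorphic_on_disc_measurable intro!: holomorphic_intros)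

lemma Ap_w_zero: "p > 0 \<Longrightarrow> (\<lambda>_. 0) \<in> Ap_w p \<eta>"
  by (simp add: Ap_w_iff wint_def)

lemma Ap_w_bounded:
  assumes p: "p > 0" and \<eta>: "\<eta> \<in> borel_measurable (lebesgue_on {0..<1})" and fin: "wint p \<eta> (\<lambda>_. 1) < \<infinity>"
    and f: "f holomorphic_on disc" and B: "\<And>z. z \<in> disc \<Longrightarrow> cmod (f z) \<le> B"
  shows "f \<in> Ap_w p \<eta>"
proof -
  have "wint p \<eta> f \<le> ennreal (B powr p) * wint p \<eta> (\<lambda>_. 1)"
    by (rule wint_bounded_le[OF p \<eta> B])
  also have "\<dots> < \<infinity>"
    using fin by (simp add: ennreal_mult_less_top)
  finally show ?thesis using f by (simp add: Ap_w_iff)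
qed

lemma fejer_holomorphic: "fejer a N holomorphic_on disc"
  unfolding fejer_def[abs_def] by (intro holomorphic_intros)

lemma fejer_bounded:
  assumes "z \<in> disc"
  shows "cmod (fejer a N z) \<le> (\<Sum>n<N. cmod (of_real (1 - real n / real N) * a n))"
  unfolding fejer_def
proof (rule order_trans[OF norm_sum sum_mono])
  fix n
  show "cmod (of_real (1 - real n / real N) * a n * z ^ n) \<le> cmod (of_real (1 - real n / real N) * a n)"
    unfolding norm_mult[of _ "z ^ n"] by (rule mult_right_le_one_le) (auto intro: power_norm_le1[OF assms])
qed

text \<open>Fatou's lemma, complementary to \<open>wint_fejer_le\<close>. Finiteness for
  \<open>g\<close> is not presupposed, so this can establish membership in the space.\<close>

lemma wint_taylor_le:
  assumes p: "p > 0" and \<eta>: "\<eta> \<in> borel_measurable (lebesgue_on {0..<1})" and g: "taylor_on_disc g b"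
    and le: "\<And>N. wint p \<eta> (fejer b N) \<le> B"
  shows "wint p \<eta> g \<le> B"
proof -
  have gm: "g \<in> borel_measurable dA"
    using holomorphic_on_disc_measurable[OF taylor_on_disc_holomorphic[OF g]] .
  note [measurable] = radial_measurable[OF \<eta>]
  let ?\<mu> = "density dA (\<lambda>z. \<eta> (cmod z))"
  have "wint p \<eta> g = (\<integral>\<^sup>+z. liminf (\<lambda>N. ennreal (cmod (fejer b N z) powr p)) \<partial>?\<mu>)"
    unfolding wint_density[OF \<eta> gm]
  proof (rule nn_integral_cong)
    fix z assume "z \<in> space ?\<mu>"
    then have "(\<lambda>N. ennreal (cmod (fejer b N z) powr p)) \<longlonglongrightarrow> ennreal (cmod (g z) powr p)"
      using p by (intro tendsto_ennrealI tendsto_powr' tendsto_norm fejer_tendsto[OF g] tendsto_const) auto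
    then show "ennreal (cmod (g z) powr p) = liminf (\<lambda>N. ennreal (cmod (fejer b N z) powr p))"
      by (rule lim_imp_Liminf[OF sequentially_bot, symmetric])
  qed
  also have "\<dots> \<le> liminf (\<lambda>N. \<integral>\<^sup>+z. ennreal (cmod (fejer b N z) powr p) \<partial>?\<mu>)"
    by (rule nn_integral_liminf) measurable
  also have "\<dots> = liminf (\<lambda>N. wint p \<eta> (fejer b N))"
    by (simp add: wint_density[OF \<eta>])
  also have "\<dots> \<le> liminf (\<lambda>N::nat. B)"
    by (intro Liminf_mono always_eventually allI le)
  also have "\<dots> = B"
    by (rule Liminf_const) simp
  finally show ?thesis .
qed

lemma bounded_functionalE:
  assumes "bounded_functional X N L" and N: "\<And>f. 0 \<le> N f"
  obtains C where "0 \<le> C" "\<And>f. f \<in> X \<Longrightarrow> cmod (L f) \<le> C * N f"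
proof -
  obtain C where C: "\<And>f. f \<in> X \<Longrightarrow> cmod (L f) \<le> C * N f"
    using assms(1) unfolding bounded_functional_def by blast
  have "cmod (L f) \<le> max C 0 * N f" if "f \<in> X" for f
    using C[OF that] mult_right_mono[OF max.cobounded1[of C 0] N[of f]] by linarith
  then show ?thesis using that[of "max C 0"] by auto
qed

lemma bounded_functional_lincomb:
  "bounded_functional X N L \<Longrightarrow> f \<in> X \<Longrightarrow> g \<in> X \<Longrightarrow> L (\<lambda>z. a * f z + b * g z) = a * L f + b * L g"
  by (simp add: bounded_functional_def)

text \<open>If \<open>x\<close> is the \<open>p\<close>-th power of a norm, a bound linear in that norm can be cancelled.\<close>

lemma powr_absorb:
  fixes x M p q :: real
  assumes x: "0 \<le> x" and M: "0 \<le> M" and pq: "1 / q + 1 / p = 1" and le: "x \<le> M * x powr (1 / p)"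
  shows "x powr (1 / q) \<le> M"
proof (cases "x = 0")
  case False
  then have "x powr (1 / q) * x powr (1 / p) \<le> M * x powr (1 / p)"
    using x le pq by (simp add: powr_add[symmetric])
  then show ?thesis
    using False x by simp
qed (use M in simp)

text \<open>The function \<open>h * |h|^(e - 2)\<close> is the extremal of Hoelder's inequality for
  exponent \<open>e\<close>, and \<open>T\<close> carries the weights. A negative exponent is
  harmless at zeros of \<open>h\<close>, since \<open>0 powr x = 0\<close>.\<close>

lemma dual_test_norm: "cmod (h * of_real (cmod h powr (e - 2) * T)) = cmod h powr (e - 1) * \<bar>T\<bar>"
proof -
  have "cmod h * cmod h powr (e - 2) = cmod h powr (e - 1)"
    by (subst powr_mult_base) auto
  then show ?thesis
    by (simp add: norm_mult abs_mult mult.assoc[symmetric])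
qed

lemma dual_test_mult: "h * cnj (h * of_real (cmod h powr (e - 2) * T)) = of_real (cmod h powr e * T)"
proof -
  have "cmod h * (cmod h * cmod h powr (e - 2)) = cmod h powr e"
    by (subst powr_mult_base, simp)+ simp
  then have "(cmod h)\<^sup>2 * (cmod h powr (e - 2) * T) = cmod h powr e * T"
    by (simp add: power2_eq_square mult.assoc[symmetric])
  moreover have "h * cnj (h * of_real c) = of_real ((cmod h)\<^sup>2 * c)" for c
    unfolding of_real_mult complex_norm_square by simp
  ultimately show ?thesis by (simp only:)
qed

section \<open>Functionals on the space of the dual weight\<close>

locale weight_pair =
  fixes p q :: real and \<omega> \<nu> :: "real \<Rightarrow> real" and \<sigma> \<nu>' :: "real \<Rightarrow> ennreal"
  assumes p: "1 < p" and \<omega>: "radial_weight \<omega>" and \<nu>: "radial_weight \<nu>"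
  defines "q \<equiv> conj_exp p" and "\<sigma> \<equiv> sigma_w p \<omega> \<nu>" and "\<nu>' \<equiv> \<lambda>r. ennreal (\<nu> r)"
begin

lemma q: "1 < q" "1 / q + 1 / p = 1" "1 / p + 1 / q = 1" "(q - 1) * p = q" "(p - 1) * q = p"
  using p by (auto simp: q_def conj_exp_def field_simps)

lemma pq0: "0 < p" "0 < q" using p q by auto

lemma \<nu>'_measurable: "\<nu>' \<in> borel_measurable (lebesgue_on {0..<1})"
  using radial_weight_measurable[OF \<nu>] unfolding \<nu>'_def by measurable

lemma \<sigma>_measurable: "\<sigma> \<in> borel_measurable (lebesgue_on {0..<1})"
  using sigma_w_measurable[OF \<omega> \<nu>] unfolding \<sigma>_def .

lemmas weights_measurable [measurable] = radial_weight_measurable_dA[OF \<omega>] radial_weight_measurable_dA[OF \<nu>]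
  radial_measurable[OF \<nu>'_measurable] radial_measurable[OF \<sigma>_measurable]

lemmas holder = holder_sigma_w[OF p \<omega> \<nu>, folded q_def \<sigma>_def \<nu>'_def]

lemma wint_\<nu>_one: "wint p \<nu>' (\<lambda>_. 1) = ennreal (even_moment \<nu> 0)"
proof -
  have "wint p \<nu>' (\<lambda>_. 1) = (\<integral>\<^sup>+z. ennreal (\<nu> (cmod z)) \<partial>dA)"
    by (simp add: wint_def \<nu>'_def)
  also have "\<dots> = ennreal (\<integral>z. \<nu> (cmod z) \<partial>dA)"
    using radial_weight_integrable_dA[OF \<nu>] radial_weight_nonneg[OF \<nu>] by (intro nn_integral_eq_integral) auto
  finally show ?thesis using even_moment_eq_integral[OF \<nu>, of 0] by simp
qed

lemma A\<nu>_bounded: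
  assumes "f holomorphic_on disc" "\<And>z. z \<in> disc \<Longrightarrow> cmod (f z) \<le> B"
  shows "f \<in> Ap_w p \<nu>'"
  using assms by (intro Ap_w_bounded[OF pq0(1) \<nu>'_measurable]) (auto simp: wint_\<nu>_one)

lemma one_A\<nu>: "(\<lambda>_. 1) \<in> Ap_w p \<nu>'"
  by (rule A\<nu>_bounded[where B = 1]) auto

text \<open>Hoelder's inequality against the constant 1, whose \<nu> norm is finite. The mirror
  image \<open>L\<nu>_weight_integrable\<close> needs \<sigma> to be integrable.\<close>

lemma L\<sigma>_weight_integrable:
  assumes "f \<in> Lp_w q \<sigma>"
  shows "weight_integrable \<omega> f"
  using holder(1)[OF assms, of "\<lambda>_. 1"] one_A\<nu> by (simp add: weight_integrable_def Ap_w_def)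

lemma pairing_lincomb:
  assumes g: "g \<in> Lp_w p \<nu>'" and "f1 \<in> Lp_w q \<sigma>" "f2 \<in> Lp_w q \<sigma>"
  shows "pairing \<omega> (\<lambda>z. a * f1 z + b * f2 z) g = a * pairing \<omega> f1 g + b * pairing \<omega> f2 g"
proof -
  have "(a * f1 z + b * f2 z) * cnj (g z) * of_real (\<omega> (cmod z))
      = a * (f1 z * cnj (g z) * of_real (\<omega> (cmod z))) + b * (f2 z * cnj (g z) * of_real (\<omega> (cmod z)))" for z
    by (simp add: algebra_simps)
  then show ?thesis
    unfolding pairing_def using holder(1)[OF assms(2) g] holder(1)[OF assms(3) g] by simp
qed

lemma pairing_bounded_functional:
  assumes g: "g \<in> Lp_w p \<nu>'"
  shows "bounded_functional (Ap_w q \<sigma>) (norm_w q \<sigma>) (\<lambda>f. pairing \<omega> f g)"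
proof -
  have "cmod (pairing \<omega> f g) \<le> norm_w p \<nu>' g * norm_w q \<sigma> f" if "f \<in> Ap_w q \<sigma>" for f
    using holder(2)[OF _ g, of f] that by (simp add: Ap_w_def mult.commute)
  then show ?thesis
    using pairing_lincomb[OF g] unfolding bounded_functional_def by (auto simp: Ap_w_def)
qed

lemma functional_norm_le:
  assumes "\<And>f. f \<in> Ap_w q \<sigma> \<Longrightarrow> norm_w q \<sigma> f \<le> 1 \<Longrightarrow> cmod (L f) \<le> C"
  shows "functional_norm (Ap_w q \<sigma>) (norm_w q \<sigma>) L \<le> C"
  unfolding functional_norm_def
proof (rule cSUP_least)
  have "(\<lambda>_. 0) \<in> {f \<in> Ap_w q \<sigma>. norm_w q \<sigma> f \<le> 1}"
    using Ap_w_zero[of q \<sigma>] q by (simp add: norm_w_wint wint_def)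
  then show "{f \<in> Ap_w q \<sigma>. norm_w q \<sigma> f \<le> 1} \<noteq> {}" by blast
qed (use assms in auto)

text \<open>A real supremum is meaningful only over a set bounded above, which boundedness of
  \<open>L\<close> supplies.\<close>

lemma functional_norm_upper:
  assumes L: "bounded_functional (Ap_w q \<sigma>) (norm_w q \<sigma>) L" and f: "f \<in> Ap_w q \<sigma>" "norm_w q \<sigma> f \<le> 1"
  shows "cmod (L f) \<le> functional_norm (Ap_w q \<sigma>) (norm_w q \<sigma>) L"
proof -
  obtain C where C: "0 \<le> C" "\<And>f. f \<in> Ap_w q \<sigma> \<Longrightarrow> cmod (L f) \<le> C * norm_w q \<sigma> f"
    using bounded_functionalE[OF L norm_w_nonneg] by blast
  have "bdd_above ((\<lambda>f. cmod (L f)) ` {f \<in> Ap_w q \<sigma>. norm_w q \<sigma> f \<le> 1})"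
  proof (rule bdd_aboveI2)
    fix f assume "f \<in> {f \<in> Ap_w q \<sigma>. norm_w q \<sigma> f \<le> 1}"
    then show "cmod (L f) \<le> C"
      using C(2)[of f] mult_left_mono[OF _ C(1), of "norm_w q \<sigma> f" 1] by auto
  qed
  then show ?thesis
    unfolding functional_norm_def using f by (intro cSUP_upper) auto
qed

lemma functional_norm_bound:
  assumes L: "bounded_functional (Ap_w q \<sigma>) (norm_w q \<sigma>) L" and f: "f \<in> Ap_w q \<sigma>"
  shows "cmod (L f) \<le> functional_norm (Ap_w q \<sigma>) (norm_w q \<sigma>) L * norm_w q \<sigma> f"
proof -
  obtain C where C: "0 \<le> C" "\<And>f. f \<in> Ap_w q \<sigma> \<Longrightarrow> cmod (L f) \<le> C * norm_w q \<sigma> f"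
    using bounded_functionalE[OF L norm_w_nonneg] by blast
  define n where "n = norm_w q \<sigma> f"
  show ?thesis
  proof (cases "n = 0")
    case True
    then show ?thesis using C(2)[OF f] by (simp add: n_def)
  next
    case False
    then have n: "n > 0" using norm_w_nonneg[of q \<sigma> f] by (simp add: n_def)
    \<comment> \<open>The zero summand gives the rescaled function the shape of a linear combination
      of two members, the only form of linearity in \<open>bounded_functional\<close>.\<close>
    define F where "F z = of_real (1 / n) * f z + 0 * f z" for z
    have F: "F \<in> Ap_w q \<sigma>" "L F = of_real (1 / n) * L f"
      unfolding F_def using Ap_w_lincomb[OF pq0(2) \<sigma>_measurable f f, of "of_real (1 / n)" 0] bounded_functional_lincomb[OF L f f, of "of_real (1 / n)" 0]
      by auto
    have "norm_w q \<sigma> F = cmod (of_real (1 / n)) * n"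
      unfolding F_def n_def mult_zero_left add_0_right
      by (rule norm_w_cmult[OF pq0(2) \<sigma>_measurable Ap_w_measurable[OF f]])
    then have NF: "norm_w q \<sigma> F = 1" using n by (simp add: norm_divide)
    have "cmod (L F) \<le> functional_norm (Ap_w q \<sigma>) (norm_w q \<sigma>) L"
      using functional_norm_upper[OF L F(1)] NF by simp
    then show ?thesis
      using n unfolding F(2) by (simp add: norm_mult norm_divide n_def[symmetric] divide_le_eq)
  qed
qed

section \<open>Polynomials as test functions when \<sigma> is integrable\<close>

context
  assumes \<sigma>_integrable: "wint q \<sigma> (\<lambda>_. 1) < \<infinity>"
begin

lemma A\<sigma>_bounded:
  assumes "f holomorphic_on disc" "\<And>z. z \<in> disc \<Longrightarrow> cmod (f z) \<le> B"
  shows "f \<in> Ap_w q \<sigma>"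
  using assms by (intro Ap_w_bounded[OF pq0(2) \<sigma>_measurable \<sigma>_integrable]) auto

lemma power_A\<sigma>: "(\<lambda>z. z ^ n) \<in> Ap_w q \<sigma>"
  by (rule A\<sigma>_bounded[OF _ power_norm_le1]) (auto intro!: holomorphic_intros)

lemma fejer_A\<sigma>: "fejer a N \<in> Ap_w q \<sigma>"
  by (rule A\<sigma>_bounded[OF fejer_holomorphic fejer_bounded])

lemma L\<nu>_weight_integrable:
  assumes "u \<in> Lp_w p \<nu>'"
  shows "weight_integrable \<omega> u"
proof -
  have "integrable dA (\<lambda>z. cnj (1 * cnj (u z) * of_real (\<omega> (cmod z))))"
    using holder(1)[OF _ assms, of "\<lambda>_. 1"] power_A\<sigma>[of 0] by (intro integrable_cnj) (simp add: Ap_w_def)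
  then show ?thesis by (simp add: weight_integrable_def)
qed

lemma A\<nu>_taylor_coeff:
  assumes "g \<in> Ap_w p \<nu>'" "taylor_on_disc g b"
  shows "weight_coeff \<omega> g n = b n"
  using weight_coeff_taylor[OF \<omega> L\<nu>_weight_integrable assms(2)] assms(1) by (simp add: Ap_w_def)

lemma weight_coeff_eq_if_pairing_eq:
  assumes "\<And>f. f \<in> Ap_w q \<sigma> \<Longrightarrow> pairing \<omega> f u = pairing \<omega> f v"
  shows "weight_coeff \<omega> u n = weight_coeff \<omega> v n"
  unfolding weight_coeff_def using assms[OF power_A\<sigma>, of n]
  by (metis pairing_cnj)

lemma functional_fejer:
  assumes L: "bounded_functional (Ap_w q \<sigma>) (norm_w q \<sigma>) L"
  shows "L (fejer a N) = (\<Sum>n<N. of_real (1 - real n / real N) * a n * L (\<lambda>z. z ^ n))"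
proof -
  have poly: "(\<lambda>z. \<Sum>n<m. c n * z ^ n) \<in> Ap_w q \<sigma> \<and> L (\<lambda>z. \<Sum>n<m. c n * z ^ n) = (\<Sum>n<m. c n * L (\<lambda>z. z ^ n))" for c m
  proof (induction m)
    case 0
    show ?case
      using bounded_functional_lincomb[OF L power_A\<sigma> power_A\<sigma>, of 0 0 0 0] Ap_w_zero[OF pq0(2)] by simp
  next
    case (Suc m)
    have eq: "(\<lambda>z. \<Sum>n<Suc m. c n * z ^ n) = (\<lambda>z. 1 * (\<Sum>n<m. c n * z ^ n) + c m * z ^ m)" by simp
    show ?case
      unfolding eq
      using bounded_functional_lincomb[OF L conjunct1[OF Suc.IH] power_A\<sigma>[of m], of 1 "c m"]
        Ap_w_lincomb[OF pq0(2) \<sigma>_measurable conjunct1[OF Suc.IH] power_A\<sigma>[of m], of 1 "c m"] Suc.IH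
      by simp
  qed
  show ?thesis
    unfolding fejer_def[abs_def] by (rule conjunct2[OF poly])
qed

text \<open>Fejer means make polynomials dense in the space on the \<sigma> side, and both
  functionals are continuous there.\<close>

lemma functional_eqI:
  assumes L: "bounded_functional (Ap_w q \<sigma>) (norm_w q \<sigma>) L" and L': "bounded_functional (Ap_w q \<sigma>) (norm_w q \<sigma>) L'"
    and eq: "\<And>n. L (\<lambda>z. z ^ n) = L' (\<lambda>z. z ^ n)" and f: "f \<in> Ap_w q \<sigma>"
  shows "L f = L' f"
proof -
  obtain C where C: "\<And>f. f \<in> Ap_w q \<sigma> \<Longrightarrow> cmod (L f) \<le> C * norm_w q \<sigma> f"
    using bounded_functionalE[OF L norm_w_nonneg] by blast
  obtain C' where C': "\<And>f. f \<in> Ap_w q \<sigma> \<Longrightarrow> cmod (L' f) \<le> C' * norm_w q \<sigma> f"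
    using bounded_functionalE[OF L' norm_w_nonneg] by blast
  have "f holomorphic_on disc" and fin: "wint q \<sigma> f < \<infinity>" using f by (auto simp: Ap_w_iff)
  then obtain a where a: "taylor_on_disc f a" using taylor_on_disc_ex by blast
  define d where "d N z = 1 * fejer a N z + (-1) * f z" for N z
  have d: "d N \<in> Ap_w q \<sigma>" for N
    unfolding d_def using fejer_A\<sigma> f by (intro Ap_w_lincomb[OF pq0(2) \<sigma>_measurable])
  have Ld: "L (d N) = L (fejer a N) - L f" "L' (d N) = L' (fejer a N) - L' f" for N
    unfolding d_def
    using bounded_functional_lincomb[OF L fejer_A\<sigma> f, of 1 _ _ "-1"] bounded_functional_lincomb[OF L' fejer_A\<sigma> f, of 1 _ _ "-1"]
    by simp_all
  have "L (fejer a N) = L' (fejer a N)" for N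
    by (simp add: functional_fejer[OF L] functional_fejer[OF L'] eq)
  then have bound: "cmod (L f - L' f) \<le> (C + C') * norm_w q \<sigma> (d N)" for N
    using norm_triangle_ineq4[of "L (d N)" "L' (d N)"] C[OF d[of N]] C'[OF d[of N]] unfolding Ld
    by (simp add: norm_minus_commute algebra_simps)
  have "(\<lambda>N. wint q \<sigma> (d N)) \<longlonglongrightarrow> 0"
    using wint_fejer_tendsto[OF less_imp_le[OF q(1)] \<sigma>_measurable a fin] by (simp add: d_def[abs_def])
  then have "(\<lambda>N. enn2real (wint q \<sigma> (d N))) \<longlonglongrightarrow> 0"
    using tendsto_enn2real[of "\<lambda>N. wint q \<sigma> (d N)" 0] by simp
  then have "(\<lambda>N. norm_w q \<sigma> (d N)) \<longlonglongrightarrow> 0 powr (1 / q)"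
    unfolding norm_w_wint using q by (intro tendsto_powr' tendsto_const) auto
  then have "(\<lambda>N. (C + C') * norm_w q \<sigma> (d N)) \<longlonglongrightarrow> (C + C') * 0"
    by (intro tendsto_mult tendsto_const) simp
  then have "cmod (L f - L' f) \<le> (C + C') * 0"
    by (rule tendsto_lowerbound) (use bound in auto)
  then show ?thesis by simp
qed

end

section \<open>From duality to the projection\<close>

lemma sigma_integrable_if_dual:
  assumes D: "dual_via_pairing p \<omega> \<nu>"
  shows "wint q \<sigma> (\<lambda>_. 1) < \<infinity>"
proof -
  have int1: "weight_integrable \<omega> f" if "f \<in> Ap_w q \<sigma>" for f
    using L\<sigma>_weight_integrable that by (simp add: Ap_w_def)
  have uniq: "\<forall>z\<in>disc. g1 z = g2 z"
    if "bounded_functional (Ap_w q \<sigma>) (norm_w q \<sigma>) L" "g1 \<in> Ap_w p \<nu>'" "g2 \<in> Ap_w p \<nu>'"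
      "\<forall>f\<in>Ap_w q \<sigma>. L f = pairing \<omega> f g1" "\<forall>f\<in>Ap_w q \<sigma>. L f = pairing \<omega> f g2" for L g1 g2
    using D that unfolding dual_via_pairing_def Let_def q_def[symmetric] \<sigma>_def[symmetric] \<nu>'_def[symmetric] by blast
  have zero: "bounded_functional (Ap_w q \<sigma>) (norm_w q \<sigma>) (\<lambda>_. 0)"
    by (auto simp: bounded_functional_def intro!: exI[of _ 0])
  \<comment> \<open>Otherwise the constants 1 and 0 would both represent the zero functional,
    against uniqueness.\<close>
  have "\<exists>f\<in>Ap_w q \<sigma>. pairing \<omega> f (\<lambda>_. 1) \<noteq> 0"
  proof (rule ccontr)
    assume "\<not> ?thesis"
    then have "\<forall>z\<in>disc. (\<lambda>_. 1) z = (\<lambda>_. 0 :: complex) z"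
      using one_A\<nu> Ap_w_zero[OF pq0(1)] by (intro uniq[OF zero]) (auto simp: pairing_def)
    moreover have "0 \<in> disc" by (simp add: disc_def)
    ultimately show False by auto
  qed
  then obtain f where f: "f \<in> Ap_w q \<sigma>" and nz: "pairing \<omega> f (\<lambda>_. 1) \<noteq> 0" by blast
  obtain a where a: "taylor_on_disc f a"
    using f taylor_on_disc_ex by (auto simp: Ap_w_iff)
  have "a 0 \<noteq> 0"
    using nz weight_coeff_taylor[OF \<omega> int1[OF f] a, of 0] even_moment_pos[OF \<omega>, of 0]
    by (auto simp: weight_coeff_def)
  \<comment> \<open>The first Fejer mean is the constant \<open>a 0\<close>, so one member that does
    not vanish at the origin forces nonzero constants to have finite norm.\<close>
  have "wint q \<sigma> (fejer a 1) \<le> wint q \<sigma> f"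
    using q by (intro wint_fejer_le[OF _ \<sigma>_measurable a]) auto
  also have "\<dots> < \<infinity>" using f by (simp add: Ap_w_iff)
  finally have "wint q \<sigma> (\<lambda>z. a 0 * 1) < \<infinity>"
    by (simp add: fejer_def[abs_def])
  then have "ennreal (cmod (a 0) powr q) * wint q \<sigma> (\<lambda>_. 1) < \<infinity>"
    by (subst (asm) wint_cmult[OF \<sigma>_measurable]) auto
  then show ?thesis
    using \<open>a 0 \<noteq> 0\<close> by (auto simp: ennreal_mult_less_top)
qed

lemma proj_bounded_if_dual:
  assumes D: "dual_via_pairing p \<omega> \<nu>"
  shows "proj_bounded p \<omega> \<nu>"
proof -
  note fin = sigma_integrable_if_dual[OF D]
  note D' = D[unfolded dual_via_pairing_def Let_def, folded q_def \<sigma>_def \<nu>'_def]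
  obtain c where c: "0 < c"
    "\<And>g. g \<in> Ap_w p \<nu>' \<Longrightarrow> c * norm_w p \<nu>' g \<le> functional_norm (Ap_w q \<sigma>) (norm_w q \<sigma>) (\<lambda>f. pairing \<omega> f g)"
    using D' by blast
  have "(\<forall>z\<in>disc. integrable dA (\<lambda>\<zeta>. u \<zeta> * cnj (bkernel \<omega> z \<zeta>) * complex_of_real (\<omega> (cmod \<zeta>)))) \<and>
      bproj \<omega> u \<in> Lp_w p \<nu>' \<and> norm_w p \<nu>' (bproj \<omega> u) \<le> (1 / c) * norm_w p \<nu>' u"
    if u: "u \<in> Lp_w p \<nu>'" for u
  proof (intro conjI ballI)
    note ui = L\<nu>_weight_integrable[OF fin u]
    show "integrable dA (\<lambda>\<zeta>. u \<zeta> * cnj (bkernel \<omega> z \<zeta>) * complex_of_real (\<omega> (cmod \<zeta>)))" if "z \<in> disc" for z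
      by (rule bproj_series(1)[OF \<omega> ui that])
    \<comment> \<open>\<open>u\<close> is only measurable, yet Hoelder's inequality makes its
      functional bounded, and the duality replaces \<open>u\<close> by an analytic
      \<open>g\<close>.\<close>
    obtain g where g: "g \<in> Ap_w p \<nu>'" and eq: "\<And>f. f \<in> Ap_w q \<sigma> \<Longrightarrow> pairing \<omega> f u = pairing \<omega> f g"
      using D' pairing_bounded_functional[OF u] by blast
    obtain b where b: "taylor_on_disc g b"
      using g taylor_on_disc_ex by (auto simp: Ap_w_iff)
    have "weight_coeff \<omega> u n = b n" for n
      using weight_coeff_eq_if_pairing_eq[OF fin eq] A\<nu>_taylor_coeff[OF fin g b] by simp
    then have Pu: "bproj \<omega> u z = g z" if "z \<in> disc" for z
      using bproj_series(2)[OF \<omega> ui that] b that sums_unique2 by (fastforce simp: taylor_on_disc_def)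
    have "bproj \<omega> u \<in> borel_measurable dA"
      using Ap_w_measurable[OF g] Pu measurable_cong[of dA "bproj \<omega> u" g borel] by simp
    moreover have "wint p \<nu>' (bproj \<omega> u) = wint p \<nu>' g"
      by (rule wint_cong) (simp add: Pu)
    ultimately show "bproj \<omega> u \<in> Lp_w p \<nu>'"
      using g by (simp add: Lp_w_iff Ap_w_iff)
    \<comment> \<open>\<open>g\<close> and \<open>u\<close> induce the same functional: its norm
      dominates \<open>c\<close> times that of \<open>g\<close>, and Hoelder's inequality bounds it
      by that of \<open>u\<close>. Hence the operator bound \<open>1 / c\<close>.\<close>
    have "c * norm_w p \<nu>' g \<le> functional_norm (Ap_w q \<sigma>) (norm_w q \<sigma>) (\<lambda>f. pairing \<omega> f g)"
      by (rule c(2)[OF g])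
    also have "\<dots> \<le> norm_w p \<nu>' u"
    proof (rule functional_norm_le)
      fix f assume f: "f \<in> Ap_w q \<sigma>" "norm_w q \<sigma> f \<le> 1"
      have "cmod (pairing \<omega> f u) \<le> norm_w q \<sigma> f * norm_w p \<nu>' u"
        using holder(2)[OF _ u] f by (simp add: Ap_w_def)
      also have "\<dots> \<le> norm_w p \<nu>' u"
        using f norm_w_nonneg by (intro mult_left_le_one_le) auto
      finally show "cmod (pairing \<omega> f g) \<le> norm_w p \<nu>' u" using eq[OF f(1)] by simp
    qed
    finally have "norm_w p \<nu>' g \<le> (1 / c) * norm_w p \<nu>' u"
      using c(1) by (simp add: field_simps)
    moreover have "norm_w p \<nu>' (bproj \<omega> u) = norm_w p \<nu>' g"
      by (rule norm_w_cong) (simp add: Pu)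
    ultimately show "norm_w p \<nu>' (bproj \<omega> u) \<le> (1 / c) * norm_w p \<nu>' u" by simp
  qed
  then show ?thesis
    unfolding proj_bounded_def \<nu>'_def[symmetric] by blast
qed

section \<open>The density dual to the weights\<close>

definition dual_weight :: "real \<Rightarrow> real" where
  "dual_weight r = (\<omega> r / \<nu> r) powr (q - 1)"

lemma dual_weight_nonneg: "0 \<le> dual_weight r" by (simp add: dual_weight_def)

lemma dual_weight_measurable [measurable]: "(\<lambda>z. dual_weight (cmod z)) \<in> borel_measurable dA"
  unfolding dual_weight_def by measurable

text \<open>Since \<open>(q - 1) * p = q\<close>, the test function \<open>dual_weight\<close> has
  the same \<open>p\<close>-th power integral against \<nu> as its pairing with 1. Zeros of either
  weight are covered by the conventions for division and \<open>powr\<close>.\<close>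

lemma dual_weight_powr:
  assumes "0 \<le> \<omega> r" "0 \<le> \<nu> r"
  shows "dual_weight r powr p * \<nu> r = dual_weight r * \<omega> r"
proof (cases "\<omega> r = 0 \<or> \<nu> r = 0")
  case True
  then show ?thesis by (auto simp: dual_weight_def)
next
  case False
  define x where "x = \<omega> r / \<nu> r"
  have x: "0 < x" "x * \<nu> r = \<omega> r" using False assms by (auto simp: x_def)
  have "dual_weight r powr p = x powr q"
    unfolding dual_weight_def x_def[symmetric] powr_powr q(4) ..
  also have "\<dots> = x * x powr (q - 1)"
    using x by (subst powr_mult_base) auto
  finally show ?thesis
    using x by (simp add: dual_weight_def x_def[symmetric] mult.assoc mult.left_commute)
qed

text \<open>The last assumption excludes the infinite value of \<sigma>; the rest is the exponent
  identity \<open>q / p = q - 1\<close>.\<close>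

lemma sigma_eq_dual_weight:
  assumes "0 \<le> \<omega> r" "0 \<le> \<nu> r" "\<nu> r = 0 \<Longrightarrow> \<omega> r = 0"
  shows "\<sigma> r = ennreal (dual_weight r * \<omega> r)"
proof (cases "\<omega> r = 0 \<or> \<nu> r = 0")
  case True
  then show ?thesis using assms by (auto simp: dual_weight_def \<sigma>_def sigma_w_def)
next
  case False
  have "q / p = q - 1" using p q by (simp add: field_simps)
  then have "(\<omega> r / \<nu> r powr (1 / p)) powr q = \<omega> r powr q / \<nu> r powr (q - 1)"
    by (simp add: powr_divide powr_powr)
  also have "\<dots> = (\<omega> r * \<omega> r powr (q - 1)) / \<nu> r powr (q - 1)"
    using False assms by (subst powr_mult_base) auto
  also have "\<dots> = dual_weight r * \<omega> r"
    by (simp add: dual_weight_def powr_divide)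
  finally show ?thesis using False by (simp add: \<sigma>_def sigma_w_def q_def[symmetric])
qed

text \<open>This is why the extremal on the \<sigma> side will carry the factor
  \<open>\<nu> / \<omega>\<close>: its \<open>q\<close>-th power converts \<sigma> into
  \<nu>.\<close>

lemma sigma_ratio:
  assumes "0 < \<omega> r" "0 < \<nu> r"
  shows "(\<nu> r / \<omega> r) powr q * (dual_weight r * \<omega> r) = \<nu> r"
proof -
  define x where "x = \<omega> r / \<nu> r"
  have x: "0 < x" "\<omega> r = x * \<nu> r" "\<nu> r / \<omega> r = inverse x" using assms by (auto simp: x_def)
  have "inverse x powr q = x powr (- q)"
    using x(1) by (simp add: inverse_powr powr_minus)
  then have "inverse x powr q * x powr (q - 1) = x powr (-1)"
    by (simp only: powr_add[symmetric]) simp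
  also have "\<dots> = inverse x"
    using x(1) by (simp add: powr_minus)
  finally have "inverse x powr q * (x powr (q - 1) * \<omega> r) = inverse x * \<omega> r"
    by (simp only: mult.assoc[symmetric])
  also have "\<dots> = \<nu> r"
    using x(1) by (simp add: x(2))
  finally show ?thesis
    unfolding dual_weight_def x_def[symmetric] x(3) .
qed

section \<open>From a bounded projection to the duality\<close>

context
  fixes C :: real
  assumes C: "1 \<le> C"
    and proj_int: "\<And>u z. u \<in> Lp_w p \<nu>' \<Longrightarrow> z \<in> disc \<Longrightarrow>
        integrable dA (\<lambda>\<zeta>. u \<zeta> * cnj (bkernel \<omega> z \<zeta>) * complex_of_real (\<omega> (cmod \<zeta>)))"
    and proj_Lp: "\<And>u. u \<in> Lp_w p \<nu>' \<Longrightarrow> bproj \<omega> u \<in> Lp_w p \<nu>'"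
    and proj_norm: "\<And>u. u \<in> Lp_w p \<nu>' \<Longrightarrow> norm_w p \<nu>' (bproj \<omega> u) \<le> C * norm_w p \<nu>' u"
begin

text \<open>At \<open>z = 0\<close> the kernel is a nonzero constant, so existence of the projection
  at the origin is integrability of \<open>u\<close> against \<omega>. No knowledge of \<sigma>
  enters, so this is available before \<sigma> is shown to be integrable.\<close>

lemma proj_weight_integrable:
  assumes "u \<in> Lp_w p \<nu>'"
  shows "weight_integrable \<omega> u"
proof -
  define m where "m = complex_of_real (even_moment \<omega> 0)"
  have m: "m \<noteq> 0" using even_moment_pos[OF \<omega>, of 0] by (simp add: m_def)
  have "bkernel \<omega> 0 \<zeta> = 1 / m" for \<zeta>
    using powser_zero[of "\<lambda>n. 1 / complex_of_real (2 * moment \<omega> (2 * real n + 1))"]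
    by (simp add: bkernel_def m_def even_moment_def)
  moreover have "cnj m = m" by (simp add: m_def)
  ultimately have "integrable dA (\<lambda>\<zeta>. m * (u \<zeta> * (1 / m) * complex_of_real (\<omega> (cmod \<zeta>))))"
    using proj_int[OF assms, of 0] by (intro integrable_mult_right) (simp add: disc_def)
  then show ?thesis using m by (simp add: weight_integrable_def)
qed

lemma proj_taylor:
  assumes "u \<in> Lp_w p \<nu>'"
  shows "taylor_on_disc (bproj \<omega> u) (weight_coeff \<omega> u)"
  using bproj_series(2)[OF \<omega> proj_weight_integrable[OF assms]] by (simp add: taylor_on_disc_def)

lemma proj_fejer_norm:
  assumes u: "u \<in> Lp_w p \<nu>'"
  shows "norm_w p \<nu>' (fejer (weight_coeff \<omega> u) N) \<le> C * norm_w p \<nu>' u"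
proof -
  have "wint p \<nu>' (fejer (weight_coeff \<omega> u) N) \<le> wint p \<nu>' (bproj \<omega> u)"
    using p by (intro wint_fejer_le[OF _ \<nu>'_measurable proj_taylor[OF u]]) auto
  then have "norm_w p \<nu>' (fejer (weight_coeff \<omega> u) N) \<le> norm_w p \<nu>' (bproj \<omega> u)"
    using proj_Lp[OF u] by (intro norm_w_mono[OF pq0(1)]) (auto simp: Lp_w_iff)
  then show ?thesis using proj_norm[OF u] by simp
qed

text \<open>The first Fejer mean of the projection of \<open>u\<close> is the constant
  \<open>weight_coeff \<omega> u 0\<close>. Dividing its norm by \<open>n\<close>, the norm of 1,
  and multiplying by the moment \<open>m\<close> gives \<open>K = C * m / n\<close>.\<close>

lemma proj_functional_bound:
  obtains K where "0 \<le> K" "\<And>u. u \<in> Lp_w p \<nu>' \<Longrightarrow> cmod (pairing \<omega> u (\<lambda>_. 1)) \<le> K * norm_w p \<nu>' u"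
proof -
  define n where "n = norm_w p \<nu>' (\<lambda>_. 1)"
  have n: "0 < n"
    using even_moment_pos[OF \<nu>, of 0] by (simp add: n_def norm_w_wint wint_\<nu>_one)
  define m where "m = even_moment \<omega> 0"
  have m: "0 < m" using even_moment_pos[OF \<omega>] by (simp add: m_def)
  have "cmod (pairing \<omega> u (\<lambda>_. 1)) \<le> (C * m / n) * norm_w p \<nu>' u" if u: "u \<in> Lp_w p \<nu>'" for u
  proof -
    have "cmod (weight_coeff \<omega> u 0) * n = norm_w p \<nu>' (\<lambda>z. weight_coeff \<omega> u 0 * 1)"
      unfolding n_def by (rule norm_w_cmult[OF pq0(1) \<nu>'_measurable, symmetric]) simp
    also have "\<dots> \<le> C * norm_w p \<nu>' u"
      using proj_fejer_norm[OF u, of 1] by (simp add: fejer_def[abs_def])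
    finally have "cmod (pairing \<omega> u (\<lambda>_. 1)) / m * n \<le> C * norm_w p \<nu>' u"
      using m by (simp add: weight_coeff_def norm_divide m_def)
    then show ?thesis using m n by (simp add: field_simps)
  qed
  then show ?thesis using that[of "C * m / n"] C m n by auto
qed

text \<open>The indicator of the zero set of \<nu> has norm 0, so the bounded functional
  \<open>proj_functional_bound\<close> annihilates it; its pairing with 1 is the \<omega> mass of
  that set. Infinite values of \<sigma> are thereby negligible.\<close>

lemma null_where_\<nu>_zero: "AE z in dA. \<nu> (cmod z) = 0 \<longrightarrow> \<omega> (cmod z) = 0"
proof -
  define u where "u z = (if \<nu> (cmod z) = 0 then 1 else 0 :: complex)" for z
  have um: "u \<in> borel_measurable dA" unfolding u_def by measurable
  have "wint p \<nu>' u = 0"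
    unfolding wint_def by (subst nn_integral_cong[where v = "\<lambda>_. 0"]) (auto simp: u_def \<nu>'_def)
  then have u: "u \<in> Lp_w p \<nu>'" "norm_w p \<nu>' u = 0"
    using um by (auto simp: Lp_w_iff norm_w_wint)
  define F where "F z = (if \<nu> (cmod z) = 0 then \<omega> (cmod z) else 0)" for z
  have eq: "u z * complex_of_real (\<omega> (cmod z)) = of_real (F z)" for z
    by (simp add: u_def F_def)
  have F_int: "integrable dA F"
    using proj_weight_integrable[OF u(1)] unfolding weight_integrable_def eq complex_of_real_integrable_eq .
  have "pairing \<omega> u (\<lambda>_. 1) = of_real (\<integral>z. F z \<partial>dA)"
    unfolding pairing_def by (simp add: eq)
  moreover have "pairing \<omega> u (\<lambda>_. 1) = 0"
    using proj_functional_bound u by (metis mult_zero_right norm_le_zero_iff)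
  ultimately have "(\<integral>z. F z \<partial>dA) = 0" by simp
  then have "AE z in dA. F z = 0"
    using F_int radial_weight_nonneg[OF \<omega>]
    by (subst (asm) integral_nonneg_eq_0_iff_AE) (auto simp: F_def)
  then show ?thesis by eventually_elim (simp add: F_def split: if_splits)
qed

lemma AE_sigma_eq: "AE z in dA. z \<in> disc \<and> (\<nu> (cmod z) = 0 \<longrightarrow> \<omega> (cmod z) = 0) \<and>
    \<sigma> (cmod z) = ennreal (dual_weight (cmod z) * \<omega> (cmod z))"
  using null_where_\<nu>_zero AE_space[of dA]
proof eventually_elim
  case (elim z)
  then show ?case
    using sigma_eq_dual_weight[of "cmod z"] radial_weight_nonneg[OF \<omega>] radial_weight_nonneg[OF \<nu>] by auto
qed

text \<open>For \<open>u\<close> the dual density cut to \<open>F \<le> j\<close>, the pairing with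
  1 and the \<open>p\<close>-th power of the norm are the same number \<open>i\<close>. Then
  \<open>i \<le> K * i powr (1 / p)\<close> gives \<open>i \<le> K powr q\<close>, independently of
  \<open>j\<close>, and Fatou's lemma removes the cut.\<close>

lemma proj_sigma_integrable: "wint q \<sigma> (\<lambda>_. 1) < \<infinity>"
proof -
  obtain K where K: "0 \<le> K" "\<And>u. u \<in> Lp_w p \<nu>' \<Longrightarrow> cmod (pairing \<omega> u (\<lambda>_. 1)) \<le> K * norm_w p \<nu>' u"
    using proj_functional_bound by blast
  define F where "F z = dual_weight (cmod z) * \<omega> (cmod z)" for z
  have [measurable]: "F \<in> borel_measurable dA" unfolding F_def by measurable
  have F0: "0 \<le> F z" if "z \<in> disc" for z
    using radial_weight_nonneg[OF \<omega> that] dual_weight_nonneg by (simp add: F_def)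
  define Fj where "Fj j z = (if F z \<le> real j then F z else 0)" for j z
  have Fjm [measurable]: "Fj j \<in> borel_measurable dA" for j
    unfolding Fj_def by measurable
  have Fj_bound: "(\<integral>\<^sup>+z. ennreal (Fj j z) \<partial>dA) \<le> ennreal (K powr q)" for j :: nat
  proof -
    define u where "u z = (if F z \<le> real j then complex_of_real (dual_weight (cmod z)) else 0)" for z
    have um: "u \<in> borel_measurable dA" unfolding u_def by measurable
    define I where "I = (\<integral>\<^sup>+z. ennreal (Fj j z) \<partial>dA)"
    have wu: "wint p \<nu>' u = I"
      unfolding wint_def I_def
    proof (rule nn_integral_cong)
      fix z assume "z \<in> space dA"
      then have "0 \<le> \<omega> (cmod z)" "0 \<le> \<nu> (cmod z)"
        using radial_weight_nonneg[OF \<omega>] radial_weight_nonneg[OF \<nu>] by auto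
      then show "ennreal (cmod (u z) powr p) * \<nu>' (cmod z) = ennreal (Fj j z)"
        using dual_weight_powr[of "cmod z"] dual_weight_nonneg[of "cmod z"]
        by (auto simp: u_def Fj_def F_def \<nu>'_def ennreal_mult[symmetric])
    qed
    \<comment> \<open>The cut and the finite total mass of \<open>dA\<close> ensure a finite
      \<open>I\<close>, without which the power of \<open>i\<close> could not be cancelled.\<close>
    have "I \<le> (\<integral>\<^sup>+z. ennreal (real j) \<partial>dA)"
      unfolding I_def by (intro nn_integral_mono ennreal_leI) (auto simp: Fj_def)
    also have "\<dots> < \<infinity>"
      using finite_measure.emeasure_finite[OF finite_measure_dA, of disc]
      by (simp add: ennreal_mult_less_top less_top)
    finally have I_fin: "I < \<infinity>" .
    then obtain i where i: "I = ennreal i" "0 \<le> i" by (cases I) auto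
    have u: "u \<in> Lp_w p \<nu>'" using um wu I_fin by (simp add: Lp_w_iff)
    have "pairing \<omega> u (\<lambda>_. 1) = (\<integral>z. complex_of_real (Fj j z) \<partial>dA)"
      unfolding pairing_def by (rule Bochner_Integration.integral_cong) (auto simp: u_def Fj_def F_def)
    also have "\<dots> = of_real (\<integral>z. Fj j z \<partial>dA)" by simp
    also have "(\<integral>z. Fj j z \<partial>dA) = i"
      using F0 i Fjm[of j] unfolding I_def
      by (subst integral_eq_nn_integral) (auto simp: Fj_def[of j])
    finally have "i \<le> K * norm_w p \<nu>' u"
      using K(2)[OF u] i by simp
    then have "i \<le> K * i powr (1 / p)"
      using i by (simp add: norm_w_wint wu)
    from powr_absorb[OF i(2) K(1) q(2) this] have "(i powr (1 / q)) powr q \<le> K powr q"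
      using q by (intro powr_mono2) auto
    then show ?thesis
      using i q by (simp add: I_def[symmetric] powr_powr)
  qed
  have "wint q \<sigma> (\<lambda>_. 1) = (\<integral>\<^sup>+z. ennreal (F z) \<partial>dA)"
    unfolding wint_def using AE_sigma_eq by (intro nn_integral_cong_AE) (auto simp: F_def)
  also have "\<dots> = (\<integral>\<^sup>+z. liminf (\<lambda>j. ennreal (Fj j z)) \<partial>dA)"
  proof (rule nn_integral_cong)
    fix z
    obtain j0 :: nat where "F z \<le> real j0" using real_arch_simple by blast
    then have "eventually (\<lambda>j. ennreal (F z) = ennreal (Fj j z)) sequentially"
      by (intro eventually_mono[OF eventually_ge_at_top[of j0]]) (auto simp: Fj_def)
    then have "(\<lambda>j. ennreal (Fj j z)) \<longlonglongrightarrow> ennreal (F z)"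
      by (rule Lim_transform_eventually[OF tendsto_const])
    then show "ennreal (F z) = liminf (\<lambda>j. ennreal (Fj j z))"
      by (rule lim_imp_Liminf[OF sequentially_bot, symmetric])
  qed
  also have "\<dots> \<le> liminf (\<lambda>j. \<integral>\<^sup>+z. ennreal (Fj j z) \<partial>dA)"
    by (rule nn_integral_liminf) measurable
  also have "\<dots> \<le> liminf (\<lambda>j::nat. ennreal (K powr q))"
    by (intro Liminf_mono always_eventually allI Fj_bound)
  also have "\<dots> = ennreal (K powr q)"
    by (rule Liminf_const) simp
  finally show ?thesis by (rule le_less_trans) simp
qed

text \<open>Self-adjointness of the projection, cut to polynomials: both sides are the same finite
  sum over products of coefficients.\<close>

lemma pairing_fejer_symmetric:
  assumes h: "weight_integrable \<omega> h" and u: "weight_integrable \<omega> u"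
  shows "pairing \<omega> (fejer (weight_coeff \<omega> h) N) u = pairing \<omega> h (fejer (weight_coeff \<omega> u) N)"
  unfolding pairing_cnj[of \<omega> "fejer (weight_coeff \<omega> h) N"] pairing_fejer[OF \<omega> h] pairing_fejer[OF \<omega> u]
  by (simp add: mult.commute mult.left_commute)

text \<open>The adjoint estimate, tested on the extremal \<open>u\<close> for \<open>h\<close> in Hoelder's inequality.\<close>

lemma adjoint_fejer_norm:
  assumes k: "k \<in> Lp_w q \<sigma>"
  shows "norm_w q \<sigma> (fejer (weight_coeff \<omega> k) N) \<le> C * norm_w q \<sigma> k"
proof -
  define h where "h = fejer (weight_coeff \<omega> k) N"
  have [measurable]: "h \<in> borel_measurable dA" by (simp add: h_def)
  have hX: "h \<in> Ap_w q \<sigma>" unfolding h_def by (rule fejer_A\<sigma>[OF proj_sigma_integrable])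
  \<comment> \<open>Chosen so that both \<open>|u|^p \<nu>\<close> and
    \<open>h * cnj u * \<omega>\<close> equal \<open>F\<close>, that is
    \<open>|h|^q \<sigma>\<close> almost everywhere.\<close>
  define u where "u z = h z * of_real (cmod (h z) powr (q - 2) * dual_weight (cmod z))" for z
  have [measurable]: "u \<in> borel_measurable dA" unfolding u_def by measurable
  define F where "F z = cmod (h z) powr q * (dual_weight (cmod z) * \<omega> (cmod z))" for z
  have Fm: "F \<in> borel_measurable dA" unfolding F_def by measurable
  have F0: "0 \<le> F z" if "z \<in> disc" for z
    using radial_weight_nonneg[OF \<omega> that] dual_weight_nonneg by (simp add: F_def)
  define H where "H = wint q \<sigma> h"
  have H_eq: "H = (\<integral>\<^sup>+z. ennreal (F z) \<partial>dA)"
    unfolding H_def wint_def using AE_sigma_eq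
  proof (intro nn_integral_cong_AE, eventually_elim)
    case (elim z)
    then show ?case
      using dual_weight_nonneg radial_weight_nonneg[OF \<omega>] by (simp add: F_def ennreal_mult)
  qed
  have wu: "wint p \<nu>' u = H"
    unfolding wint_def H_eq
  proof (rule nn_integral_cong)
    fix z assume "z \<in> space dA"
    then have nn: "0 \<le> \<omega> (cmod z)" "0 \<le> \<nu> (cmod z)"
      using radial_weight_nonneg[OF \<omega>] radial_weight_nonneg[OF \<nu>] by auto
    have "cmod (u z) powr p * \<nu> (cmod z) = cmod (h z) powr q * (dual_weight (cmod z) powr p * \<nu> (cmod z))"
      unfolding u_def dual_test_norm using dual_weight_nonneg by (simp add: powr_mult powr_powr q(4))
    then have "cmod (u z) powr p * \<nu> (cmod z) = F z"
      unfolding F_def dual_weight_powr[OF nn] .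
    then show "ennreal (cmod (u z) powr p) * \<nu>' (cmod z) = ennreal (F z)"
      using nn by (simp add: \<nu>'_def ennreal_mult[symmetric])
  qed
  \<comment> \<open>Here it matters that \<open>h\<close> is a polynomial and \<sigma> integrable:
    only a finite \<open>x\<close> can be cancelled at the end.\<close>
  have Hfin: "H < \<infinity>" using hX by (simp add: H_def Ap_w_iff)
  then obtain x where x: "H = ennreal x" "0 \<le> x" by (cases H) auto
  have u: "u \<in> Lp_w p \<nu>'" using wu Hfin by (simp add: Lp_w_iff)
  have "pairing \<omega> h u = (\<integral>z. complex_of_real (F z) \<partial>dA)"
    unfolding pairing_def u_def dual_test_mult by (simp add: F_def mult.assoc)
  also have "\<dots> = of_real (\<integral>z. F z \<partial>dA)" by simp
  also have "(\<integral>z. F z \<partial>dA) = x"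
    using F0 x H_eq Fm by (subst integral_eq_nn_integral) auto
  finally have "x = cmod (pairing \<omega> h u)" using x by simp
  also have "pairing \<omega> h u = pairing \<omega> k (fejer (weight_coeff \<omega> u) N)"
    unfolding h_def by (rule pairing_fejer_symmetric[OF L\<sigma>_weight_integrable[OF k] proj_weight_integrable[OF u]])
  also have "cmod \<dots> \<le> norm_w q \<sigma> k * norm_w p \<nu>' (fejer (weight_coeff \<omega> u) N)"
  proof (rule holder(2)[OF k])
    show "fejer (weight_coeff \<omega> u) N \<in> Lp_w p \<nu>'"
      using A\<nu>_bounded[OF fejer_holomorphic fejer_bounded] by (simp add: Ap_w_def)
  qed
  also have "\<dots> \<le> norm_w q \<sigma> k * (C * norm_w p \<nu>' u)"
    by (intro mult_left_mono proj_fejer_norm[OF u] norm_w_nonneg)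
  also have "norm_w p \<nu>' u = x powr (1 / p)"
    using x by (simp add: norm_w_wint wu)
  finally have "x \<le> (C * norm_w q \<sigma> k) * x powr (1 / p)"
    by (simp add: mult.commute mult.left_commute)
  from powr_absorb[OF x(2) _ q(2) this] have "x powr (1 / q) \<le> C * norm_w q \<sigma> k"
    using C norm_w_nonneg by simp
  moreover have "norm_w q \<sigma> h = x powr (1 / q)"
    using x by (simp add: norm_w_wint H_def[symmetric])
  ultimately show ?thesis by (simp add: h_def)
qed

text \<open>Forced by requiring \<open>L (z^n)\<close> to be the pairing of \<open>z^n\<close> with
  \<open>g\<close>: that pairing is the conjugate of the \<open>n\<close>-th coefficient of
  \<open>g\<close> times \<open>even_moment \<omega> n\<close>.\<close>

definition functional_coeff :: "((complex \<Rightarrow> complex) \<Rightarrow> complex) \<Rightarrow> nat \<Rightarrow> complex" where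
  "functional_coeff L n = cnj (L (\<lambda>z. z ^ n)) / of_real (even_moment \<omega> n)"

text \<open>The extremal \<open>k\<close> only sees the part \<open>u\<close> of \<open>g\<close> where \<open>\<omega> \<noteq> 0\<close>; since \<open>g = P u\<close>,
  boundedness of the projection controls the rest.\<close>

lemma functional_fejer_norm:
  assumes L: "bounded_functional (Ap_w q \<sigma>) (norm_w q \<sigma>) L"
    and M: "0 \<le> M" "\<And>f. f \<in> Ap_w q \<sigma> \<Longrightarrow> cmod (L f) \<le> M * norm_w q \<sigma> f"
  shows "norm_w p \<nu>' (fejer (functional_coeff L) N) \<le> C\<^sup>2 * M"
proof -
  define g where "g = fejer (functional_coeff L) N"
  have [measurable]: "g \<in> borel_measurable dA" by (simp add: g_def)
  have gY: "g \<in> Ap_w p \<nu>'"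
    unfolding g_def by (rule A\<nu>_bounded[OF fejer_holomorphic fejer_bounded])
  define u where "u z = (if \<omega> (cmod z) = 0 then 0 else g z)" for z
  have [measurable]: "u \<in> borel_measurable dA" unfolding u_def by measurable
  \<comment> \<open>Division by zero makes \<open>k\<close> vanish where \<omega> does. Elsewhere
    \<open>\<nu> / \<omega>\<close> turns \<open>|k|^q \<sigma>\<close> into
    \<open>|g|^p \<nu>\<close>, by \<open>sigma_ratio\<close> and
    \<open>(p - 1) * q = p\<close>.\<close>
  define k where "k z = g z * of_real (cmod (g z) powr (p - 2) * (\<nu> (cmod z) / \<omega> (cmod z)))" for z
  have [measurable]: "k \<in> borel_measurable dA" unfolding k_def by measurable
  define F where "F z = cmod (g z) powr p * (\<nu> (cmod z) / \<omega> (cmod z) * \<omega> (cmod z))" for z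
  have Fm: "F \<in> borel_measurable dA" unfolding F_def by measurable
  have F0: "0 \<le> F z" if "z \<in> disc" for z
    using radial_weight_nonneg[OF \<omega> that] radial_weight_nonneg[OF \<nu> that] by (simp add: F_def)
  define G where "G = wint p \<nu>' u"
  have G_eq: "G = (\<integral>\<^sup>+z. ennreal (F z) \<partial>dA)"
    unfolding G_def wint_def
  proof (rule nn_integral_cong)
    fix z assume "z \<in> space dA"
    then have "0 \<le> \<nu> (cmod z)" using radial_weight_nonneg[OF \<nu>] by auto
    then show "ennreal (cmod (u z) powr p) * \<nu>' (cmod z) = ennreal (F z)"
      using p by (simp add: u_def F_def \<nu>'_def ennreal_mult)
  qed
  have wk: "wint q \<sigma> k = G"
    unfolding wint_def G_eq
  proof (rule nn_integral_cong_AE, use AE_sigma_eq in eventually_elim)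
    case (elim z)
    then have nn: "0 \<le> \<omega> (cmod z)" "0 \<le> \<nu> (cmod z)"
      using radial_weight_nonneg[OF \<omega>] radial_weight_nonneg[OF \<nu>] by auto
    have kz: "cmod (k z) powr q = cmod (g z) powr p * (\<nu> (cmod z) / \<omega> (cmod z)) powr q"
      unfolding k_def dual_test_norm using nn by (simp only: powr_mult powr_powr q(5) abs_of_nonneg divide_nonneg_nonneg)
    have "cmod (k z) powr q * (dual_weight (cmod z) * \<omega> (cmod z)) = F z"
    proof (cases "\<omega> (cmod z) = 0")
      case True
      then show ?thesis by (simp add: F_def)
    next
      case False
      then have "0 < \<omega> (cmod z)" "0 < \<nu> (cmod z)" using nn elim by (auto simp: less_le)
      then show ?thesis
        unfolding kz using sigma_ratio[of "cmod z"] by (simp only: mult.assoc F_def) simp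
    qed
    then show ?case
      using elim nn dual_weight_nonneg[of "cmod z"] by (simp add: ennreal_mult[symmetric])
  qed
  have "G \<le> wint p \<nu>' g"
    unfolding G_def wint_def by (intro nn_integral_mono mult_right_mono ennreal_leI) (auto simp: u_def)
  then have Gfin: "G < \<infinity>" using gY by (auto simp: Ap_w_iff intro: le_less_trans)
  then obtain x where x: "G = ennreal x" "0 \<le> x" by (cases G) auto
  have u: "u \<in> Lp_w p \<nu>'" using Gfin by (simp add: Lp_w_iff G_def[symmetric])
  have k: "k \<in> Lp_w q \<sigma>" using Gfin by (simp add: Lp_w_iff wk)
  have "k z * cnj (g z) * complex_of_real (\<omega> (cmod z)) = of_real (F z)" for z
  proof -
    have "k z * cnj (g z) = cnj (g z * cnj (k z))" by simp
    also have "\<dots> = of_real (cmod (g z) powr p * (\<nu> (cmod z) / \<omega> (cmod z)))"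
      unfolding k_def dual_test_mult by simp
    finally show ?thesis by (simp add: F_def)
  qed
  then have "pairing \<omega> k g = of_real (\<integral>z. F z \<partial>dA)"
    unfolding pairing_def by simp
  also have "(\<integral>z. F z \<partial>dA) = x"
    using F0 x G_eq Fm by (subst integral_eq_nn_integral) auto
  finally have "x = cmod (pairing \<omega> k g)" using x by simp
  \<comment> \<open>The coefficients of \<open>g\<close> were defined for this identity: the moments
    cancel, and the Fejer multipliers pass from \<open>g\<close> to \<open>k\<close>.\<close>
  also have "pairing \<omega> k g = L (fejer (weight_coeff \<omega> k) N)"
    unfolding g_def pairing_fejer[OF \<omega> L\<sigma>_weight_integrable[OF k]] functional_fejer[OF proj_sigma_integrable L]
    using even_moment_pos[OF \<omega>] by (intro sum.cong refl) (auto simp: functional_coeff_def less_le)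
  also have "cmod \<dots> \<le> M * norm_w q \<sigma> (fejer (weight_coeff \<omega> k) N)"
    by (rule M(2)[OF fejer_A\<sigma>[OF proj_sigma_integrable]])
  also have "\<dots> \<le> M * (C * norm_w q \<sigma> k)"
    by (intro mult_left_mono adjoint_fejer_norm[OF k] M)
  also have "norm_w q \<sigma> k = x powr (1 / q)"
    using x by (simp add: norm_w_wint wk)
  finally have "x \<le> (M * C) * x powr (1 / q)" by (simp add: mult.assoc)
  from powr_absorb[OF x(2) _ q(3) this] have "x powr (1 / p) \<le> M * C"
    using C M by simp
  then have norm_u: "norm_w p \<nu>' u \<le> M * C"
    using x by (simp add: norm_w_wint G_def[symmetric])
  \<comment> \<open>\<open>u\<close> and \<open>g\<close> differ only where \<omega> vanishes, so
    they share coefficients and the projection maps \<open>u\<close> to \<open>g\<close>. Its bound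
    contributes the second factor \<open>C\<close>; the first came from
    \<open>adjoint_fejer_norm\<close>.\<close>
  have "weight_coeff \<omega> u n = weight_coeff \<omega> g n" for n
    unfolding weight_coeff_def pairing_def
    by (intro arg_cong2[where f = "(/)"] Bochner_Integration.integral_cong) (auto simp: u_def)
  moreover have "taylor_on_disc g (weight_coeff \<omega> g)"
  proof -
    obtain b where b: "taylor_on_disc g b"
      using gY taylor_on_disc_ex by (auto simp: Ap_w_iff)
    moreover have "weight_coeff \<omega> g = b"
      using A\<nu>_taylor_coeff[OF proj_sigma_integrable gY b] by blast
    ultimately show ?thesis by simp
  qed
  ultimately have "taylor_on_disc g (weight_coeff \<omega> u)" by presburger
  from taylor_on_disc_unique[OF this proj_taylor[OF u]]
  have "norm_w p \<nu>' g = norm_w p \<nu>' (bproj \<omega> u)"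
    by (intro norm_w_cong) simp
  also have "\<dots> \<le> C * norm_w p \<nu>' u" by (rule proj_norm[OF u])
  also have "\<dots> \<le> C * (M * C)" using norm_u C by (intro mult_left_mono) auto
  finally show ?thesis by (simp add: g_def power2_eq_square mult.commute mult.left_commute)
qed

text \<open>An arbitrary bound \<open>M\<close> is allowed so that the estimate serves twice: for
  membership of the representative of an abstract \<open>L\<close>, and, with \<open>M\<close> the
  functional norm, for the lower constant in the norm equivalence.\<close>

lemma functional_taylor_norm:
  assumes L: "bounded_functional (Ap_w q \<sigma>) (norm_w q \<sigma>) L"
    and M: "0 \<le> M" "\<And>f. f \<in> Ap_w q \<sigma> \<Longrightarrow> cmod (L f) \<le> M * norm_w q \<sigma> f"
    and g: "taylor_on_disc g (functional_coeff L)"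
  shows "g \<in> Ap_w p \<nu>'" and "norm_w p \<nu>' g \<le> C\<^sup>2 * M"
proof -
  have "wint p \<nu>' (fejer (functional_coeff L) N) \<le> ennreal ((C\<^sup>2 * M) powr p)" for N
  proof -
    have "fejer (functional_coeff L) N \<in> Ap_w p \<nu>'"
      by (rule A\<nu>_bounded[OF fejer_holomorphic fejer_bounded])
    then have "wint p \<nu>' (fejer (functional_coeff L) N) = ennreal (norm_w p \<nu>' (fejer (functional_coeff L) N) powr p)"
      by (intro norm_w_powr[OF pq0(1)]) (simp add: Ap_w_iff)
    then show ?thesis
      using functional_fejer_norm[OF L M, of N] p norm_w_nonneg by (auto intro!: ennreal_leI powr_mono2)
  qed
  from wint_taylor_le[OF pq0(1) \<nu>'_measurable g this]
  have le: "wint p \<nu>' g \<le> ennreal ((C\<^sup>2 * M) powr p)" .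
  then show gY: "g \<in> Ap_w p \<nu>'"
    using taylor_on_disc_holomorphic[OF g] by (auto simp: Ap_w_iff intro: le_less_trans)
  have "enn2real (wint p \<nu>' g) \<le> (C\<^sup>2 * M) powr p"
    using le by (intro enn2real_leI) auto
  then have "norm_w p \<nu>' g \<le> ((C\<^sup>2 * M) powr p) powr (1 / p)"
    unfolding norm_w_wint using p by (intro powr_mono2) auto
  then show "norm_w p \<nu>' g \<le> C\<^sup>2 * M"
    using p M C by (simp add: powr_powr)
qed

text \<open>Monomials have bounded norm on the \<sigma> side, so the values of \<open>L\<close> on
  them are bounded, and the reciprocal moments grow too slowly to spoil convergence inside the
  disc.\<close>

lemma functional_taylor_ex:
  assumes L: "bounded_functional (Ap_w q \<sigma>) (norm_w q \<sigma>) L"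
  obtains g where "taylor_on_disc g (functional_coeff L)"
proof -
  obtain M where M: "0 \<le> M" "\<And>f. f \<in> Ap_w q \<sigma> \<Longrightarrow> cmod (L f) \<le> M * norm_w q \<sigma> f"
    using bounded_functionalE[OF L norm_w_nonneg] by blast
  define B where "B = M * norm_w q \<sigma> (\<lambda>_. 1)"
  have L_le: "cmod (L (\<lambda>z. z ^ n)) \<le> B" for n
  proof -
    have "wint q \<sigma> (\<lambda>z. z ^ n) \<le> wint q \<sigma> (\<lambda>_. 1)"
      using wint_bounded_le[OF pq0(2) \<sigma>_measurable power_norm_le1] by simp
    then have "norm_w q \<sigma> (\<lambda>z. z ^ n) \<le> norm_w q \<sigma> (\<lambda>_. 1)"
      by (rule norm_w_mono[OF pq0(2) _ proj_sigma_integrable])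
    then show ?thesis
      using M(2)[OF power_A\<sigma>[OF proj_sigma_integrable, of n]] M(1)
      unfolding B_def by (meson mult_left_mono order_trans)
  qed
  define g where "g z = (\<Sum>n. functional_coeff L n * z ^ n)" for z
  have "taylor_on_disc g (functional_coeff L)"
    unfolding taylor_on_disc_def g_def
  proof (intro ballI summable_sums)
    fix z assume "z \<in> disc"
    then have "summable (\<lambda>n. B * (cmod z ^ n / even_moment \<omega> n))"
      by (intro summable_mult summable_power_even_moment[OF \<omega>]) (auto simp: disc_def)
    then show "summable (\<lambda>n. functional_coeff L n * z ^ n)"
    proof (rule summable_comparison_test'[where N = 0])
      fix n
      have "norm (functional_coeff L n * z ^ n) = cmod (L (\<lambda>z. z ^ n)) * (cmod z ^ n / even_moment \<omega> n)"
        using even_moment_pos[OF \<omega>, of n] by (simp add: functional_coeff_def norm_mult norm_divide norm_power)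
      also have "\<dots> \<le> B * (cmod z ^ n / even_moment \<omega> n)"
        using even_moment_pos[OF \<omega>, of n] L_le[of n] by (intro mult_right_mono) auto
      finally show "norm (functional_coeff L n * z ^ n) \<le> B * (cmod z ^ n / even_moment \<omega> n)" .
    qed
  qed
  then show ?thesis using that by blast
qed

text \<open>Every analytic \<open>g\<close> of finite norm is the candidate constructed from its own
  functional; uniqueness and the lower norm bound then follow from the results for general
  functionals.\<close>

lemma functional_coeff_pairing:
  assumes "g \<in> Ap_w p \<nu>'"
  shows "taylor_on_disc g (functional_coeff (\<lambda>f. pairing \<omega> f g))"
proof -
  obtain b where b: "taylor_on_disc g b"
    using assms taylor_on_disc_ex by (auto simp: Ap_w_iff)
  have "functional_coeff (\<lambda>f. pairing \<omega> f g) n = weight_coeff \<omega> g n" for n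
    unfolding functional_coeff_def weight_coeff_def by (subst pairing_cnj) simp
  then have "functional_coeff (\<lambda>f. pairing \<omega> f g) = b"
    using A\<nu>_taylor_coeff[OF proj_sigma_integrable assms b] by auto
  then show ?thesis using b by simp
qed

lemma functional_representation:
  assumes L: "bounded_functional (Ap_w q \<sigma>) (norm_w q \<sigma>) L"
  obtains g where "g \<in> Ap_w p \<nu>'" "\<And>f. f \<in> Ap_w q \<sigma> \<Longrightarrow> L f = pairing \<omega> f g"
proof -
  obtain g where g: "taylor_on_disc g (functional_coeff L)" using functional_taylor_ex[OF L] .
  obtain M where M: "0 \<le> M" "\<And>f. f \<in> Ap_w q \<sigma> \<Longrightarrow> cmod (L f) \<le> M * norm_w q \<sigma> f"
    using bounded_functionalE[OF L norm_w_nonneg] by blast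
  have gY: "g \<in> Ap_w p \<nu>'" by (rule functional_taylor_norm(1)[OF L M g])
  have "L (\<lambda>z. z ^ n) = pairing \<omega> (\<lambda>z. z ^ n) g" for n
  proof -
    have "weight_coeff \<omega> g n = functional_coeff L n"
      by (rule A\<nu>_taylor_coeff[OF proj_sigma_integrable gY g])
    then have "pairing \<omega> g (\<lambda>z. z ^ n) = cnj (L (\<lambda>z. z ^ n))"
      using even_moment_pos[OF \<omega>, of n] by (simp add: weight_coeff_def functional_coeff_def)
    then show ?thesis by (subst pairing_cnj) simp
  qed
  moreover have "bounded_functional (Ap_w q \<sigma>) (norm_w q \<sigma>) (\<lambda>f. pairing \<omega> f g)"
    using gY by (intro pairing_bounded_functional) (simp add: Ap_w_def)
  ultimately have "L f = pairing \<omega> f g" if "f \<in> Ap_w q \<sigma>" for f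
    using functional_eqI[OF proj_sigma_integrable L _ _ that] by blast
  then show ?thesis using that gY by blast
qed

lemma dual_if_proj: "dual_via_pairing p \<omega> \<nu>"
  unfolding dual_via_pairing_def Let_def q_def[symmetric] \<sigma>_def[symmetric] \<nu>'_def[symmetric]
proof (intro conjI ballI allI impI)
  fix g assume "g \<in> Ap_w p \<nu>'"
  then have g: "g \<in> Lp_w p \<nu>'" by (simp add: Ap_w_def)
  show "bounded_functional (Ap_w q \<sigma>) (norm_w q \<sigma>) (\<lambda>f. pairing \<omega> f g)"
    by (rule pairing_bounded_functional[OF g])
  show "integrable dA (\<lambda>z. f z * cnj (g z) * complex_of_real (\<omega> (cmod z)))" if "f \<in> Ap_w q \<sigma>" for f
    using that by (intro holder(1)[OF _ g]) (simp add: Ap_w_def)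
next
  fix L assume L: "bounded_functional (Ap_w q \<sigma>) (norm_w q \<sigma>) L"
  show "\<exists>g\<in>Ap_w p \<nu>'. \<forall>f\<in>Ap_w q \<sigma>. L f = pairing \<omega> f g"
    using functional_representation[OF L] by metis
  fix g1 g2 z
  assume g: "g1 \<in> Ap_w p \<nu>'" "g2 \<in> Ap_w p \<nu>'"
    and eq: "\<forall>f\<in>Ap_w q \<sigma>. L f = pairing \<omega> f g1" "\<forall>f\<in>Ap_w q \<sigma>. L f = pairing \<omega> f g2" and z: "z \<in> disc"
  have "functional_coeff (\<lambda>f. pairing \<omega> f g1) = functional_coeff (\<lambda>f. pairing \<omega> f g2)"
    unfolding functional_coeff_def[abs_def] using eq power_A\<sigma>[OF proj_sigma_integrable] by metis
  then show "g1 z = g2 z"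
    using taylor_on_disc_unique[OF functional_coeff_pairing[OF g(1)] _ z] functional_coeff_pairing[OF g(2)] by simp
next
  \<comment> \<open>The upper constant 1 is Hoelder's inequality; the lower one is
    \<open>functional_taylor_norm\<close> applied to the functional of \<open>g\<close>
    itself.\<close>
  have "(1 / C\<^sup>2) * norm_w p \<nu>' g \<le> functional_norm (Ap_w q \<sigma>) (norm_w q \<sigma>) (\<lambda>f. pairing \<omega> f g) \<and>
      functional_norm (Ap_w q \<sigma>) (norm_w q \<sigma>) (\<lambda>f. pairing \<omega> f g) \<le> 1 * norm_w p \<nu>' g"
    if gY: "g \<in> Ap_w p \<nu>'" for g
  proof
    have g: "g \<in> Lp_w p \<nu>'" using gY by (simp add: Ap_w_def)
    define M where "M = functional_norm (Ap_w q \<sigma>) (norm_w q \<sigma>) (\<lambda>f. pairing \<omega> f g)"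
    note T = pairing_bounded_functional[OF g]
    have M: "cmod (pairing \<omega> f g) \<le> M * norm_w q \<sigma> f" if "f \<in> Ap_w q \<sigma>" for f
      unfolding M_def by (rule functional_norm_bound[OF T that])
    show "M \<le> 1 * norm_w p \<nu>' g"
      unfolding M_def
    proof (rule functional_norm_le)
      fix f assume f: "f \<in> Ap_w q \<sigma>" "norm_w q \<sigma> f \<le> 1"
      have "cmod (pairing \<omega> f g) \<le> norm_w q \<sigma> f * norm_w p \<nu>' g"
        using f by (intro holder(2)[OF _ g]) (simp add: Ap_w_def)
      also have "\<dots> \<le> 1 * norm_w p \<nu>' g"
        using f norm_w_nonneg by (intro mult_right_mono) auto
      finally show "cmod (pairing \<omega> f g) \<le> 1 * norm_w p \<nu>' g" .
    qed
    \<comment> \<open>The zero function lies in the unit ball, which shows that the supremum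
      \<open>M\<close> is nonnegative.\<close>
    have "cmod (pairing \<omega> (\<lambda>_. 0) g) \<le> M"
      unfolding M_def using Ap_w_zero[OF pq0(2)] q
      by (intro functional_norm_upper[OF T]) (simp_all add: norm_w_wint wint_def)
    then have "0 \<le> M"
      using norm_ge_zero order_trans by blast
    from functional_taylor_norm(2)[OF T this M functional_coeff_pairing[OF gY]]
    have "norm_w p \<nu>' g \<le> C\<^sup>2 * M" .
    then show "(1 / C\<^sup>2) * norm_w p \<nu>' g \<le> M" using C by (simp add: field_simps)
  qed
  then show "\<exists>c C. 0 < c \<and> 0 < C \<and> (\<forall>g\<in>Ap_w p \<nu>'.
      c * norm_w p \<nu>' g \<le> functional_norm (Ap_w q \<sigma>) (norm_w q \<sigma>) (\<lambda>f. pairing \<omega> f g) \<and>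
      functional_norm (Ap_w q \<sigma>) (norm_w q \<sigma>) (\<lambda>f. pairing \<omega> f g) \<le> C * norm_w p \<nu>' g)"
    using C by (intro exI[of _ "1 / C\<^sup>2"] exI[of _ 1]) auto
qed

end

lemma dual_if_proj_bounded:
  assumes "proj_bounded p \<omega> \<nu>"
  shows "dual_via_pairing p \<omega> \<nu>"
proof -
  obtain C0 where C0: "\<And>u. u \<in> Lp_w p \<nu>' \<Longrightarrow>
      (\<forall>z\<in>disc. integrable dA (\<lambda>\<zeta>. u \<zeta> * cnj (bkernel \<omega> z \<zeta>) * complex_of_real (\<omega> (cmod \<zeta>)))) \<and>
      bproj \<omega> u \<in> Lp_w p \<nu>' \<and> norm_w p \<nu>' (bproj \<omega> u) \<le> C0 * norm_w p \<nu>' u"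
    using assms unfolding proj_bounded_def \<nu>'_def[symmetric] by blast
  \<comment> \<open>\<open>proj_bounded\<close> admits any real constant; raising it to at least 1
    keeps \<open>1 / C\<^sup>2\<close> positive and products monotone.\<close>
  have "norm_w p \<nu>' (bproj \<omega> u) \<le> max C0 1 * norm_w p \<nu>' u" if "u \<in> Lp_w p \<nu>'" for u
    using C0[OF that] mult_right_mono[OF max.cobounded1[of C0 1] norm_w_nonneg[of p \<nu>' u]] by linarith
  then show ?thesis
    using C0 by (intro dual_if_proj[of "max C0 1"]) auto
qed

end

theorem theorem2:
  fixes p :: real and \<omega> \<nu> :: "real \<Rightarrow> real"
  assumes "1 < p" and "Dhat \<omega>" and "radial_weight \<nu>"
  shows "proj_bounded p \<omega> \<nu> \<longleftrightarrow> dual_via_pairing p \<omega> \<nu>"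
proof -
  have "radial_weight \<omega>" using assms(2) by (simp add: Dhat_def)
  then interpret weight_pair p "conj_exp p" \<omega> \<nu> "sigma_w p \<omega> \<nu>" "\<lambda>r. ennreal (\<nu> r)"
    using assms by unfold_locales
  show ?thesis
    using dual_if_proj_bounded proj_bounded_if_dual by blast
qed

end
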